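(* Let $M,\widehat M$ be oriented connected $n$-dimensional Riemannian manifolds, let $q_0:[0,\tau]\to Q$ be an intrinsic rolling of $M$ on $\widehat M$, and let $\iota:M\to\mathbb{R}^{n+\nu}$ and $\widehat\iota:\widehat M\to\mathbb{R}^{n+\nu}$ be given isometric imbeddings. Then there exists a rolling $(q_0,p):[0,\tau]\to Q\oplus P_{\iota,\widehat\iota}$, and it is unique up to a right action of $\mathrm{SO}(\nu)$.
   Context: $\mathbb{R}^{n+\nu}$ has its standard metric and orientation; $T_x\mathbb{R}^{n+\nu}=T_xM\oplus T_xM^\perp$ (similarly for $\widehat M$), and normal spaces carry the induced orientation. $\mathrm{Isom}_0^+$ denotes linear orientation preserving isometries. $Q=\{q\in\mathrm{Isom}_0^+(T_xM,T_{\widehat x}\widehat M): x\in M,\widehat x\in\widehat M\}$ and $P_{\iota,\widehat\iota}=\{p\in\mathrm{Isom}_0^+(T_xM^\perp,T_{\widehat x}\widehat M^\perp): x\in M,\widehat x\in\widehat M\}$ are bundles over $M\times\widehat M$, and $Q\oplus P_{\iota,\widehat\iota}$ is their fibre product. For tangent fields $Z$ and normal fields $\Psi$ (absolutely continuous) along a curve, $\frac{D}{dt}Z=(\dot Z)^\top$ and $\frac{D^\perp}{dt}\Psi=(\dot\Psi)^\perp$ (tangential and normal projections); $Z$ is parallel if $\frac{D}{dt}Z=0$ a.e., $\Psi$ is normal parallel if $\frac{D^\perp}{dt}\Psi=0$ a.e. An intrinsic rolling is an absolutely continuous curve $q:[0,\tau]\to Q$ with projections $x(t),\widehat x(t)$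 such that (I') $\dot{\widehat x}(t)=q(t)\dot x(t)$ for almost all $t$, and (II') a tangent field $Z(t)$ is parallel along $x(t)$ if and only if $q(t)Z(t)$ is parallel along $\widehat x(t)$. A rolling is an absolutely continuous curve $(q,p):[0,\tau]\to Q\oplus P_{\iota,\widehat\iota}$, over $(x(t),\widehat x(t))$, such that (I) $\dot{\widehat x}(t)=q(t)\dot x(t)$ for a.e. $t$; (II) $q(t)\frac{D}{dt}Z(t)=\frac{D}{dt}q(t)Z(t)$ for any tangent field $Z$ along $x$ and a.e. $t$; (III) $p(t)\frac{D^\perp}{dt}\Psi(t)=\frac{D^\perp}{dt}p(t)\Psi(t)$ for any normal field $\Psi$ along $x$ and a.e. $t$. Right action of $\mathrm{SO}(\nu)$: fix positively oriented orthonormal normal parallel frames $\{\epsilon_\lambda(t)\}_{\lambda=1}^\nu$ along $x(t)$ and $\{\hat\epsilon_\kappa(t)\}_{\kappa=1}^\nu$ along $\widehat x(t)$; if $p$ over $(x(t),\widehat x(t))$ has matrix $B=(\langle\hat\epsilon_\kappa(t),p\,\epsilon_\lambda(t)\rangle)_{\kappa,\lambda}$, then $pB_0$ has matrix $BB_0$. "Unique up to a right action" means: for a fixed rolling $(q_0,p_0)$ extending $q_0$, the rollings extending $q_0$ are exactly the curves $(q_0(t),p_0(t)B_0)$ with $B_0\in\mathrm{SO}(\nu)$ constant. *)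

theory Defs
  imports "HOL-Analysis.Analysis"
begin

section \<open>Absolute continuity and smoothness\<close>

definition abs_cont_on :: "real \<Rightarrow> real \<Rightarrow> (real \<Rightarrow> 'b::real_normed_vector) \<Rightarrow> bool" where
  "abs_cont_on a b f \<longleftrightarrow>
    (\<forall>e>0. \<exists>d>0. \<forall>D. finite D \<and> (\<forall>(u, v)\<in>D. a \<le> u \<and> u \<le> v \<and> v \<le> b) \<and>
        pairwise (\<lambda>(u, v) (u', v'). {u<..<v} \<inter> {u'<..<v'} = {}) D \<and>
        (\<Sum>(u, v)\<in>D. v - u) < d
      \<longrightarrow> (\<Sum>(u, v)\<in>D. norm (f v - f u)) < e)"

primrec Ck_on :: "nat \<Rightarrow> 'a::real_normed_vector set \<Rightarrow> ('a \<Rightarrow> 'b::real_normed_vector) \<Rightarrow> bool" where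
  "Ck_on 0 S f \<longleftrightarrow> continuous_on S f"
| "Ck_on (Suc k) S f \<longleftrightarrow> (\<forall>x\<in>S. f differentiable at x) \<and>
      (\<forall>v. Ck_on k S (\<lambda>x. frechet_derivative f (at x) v))"

(* to be used on open sets S only *)
definition smooth_on :: "'a::real_normed_vector set \<Rightarrow> ('a \<Rightarrow> 'b::real_normed_vector) \<Rightarrow> bool" where
  "smooth_on S f \<longleftrightarrow> (\<forall>k. Ck_on k S f)"

section \<open>Oriented Riemannian manifolds\<close>

(* A chart is a pair (domain, coordinate map).  A tangent vector at p is the family of its
   coordinate vectors in all charts around p; it is set to 0 at every other argument, so that
   equality of tangent vectors is equality of functions. *)

type_synonym ('p, 'n) chart = "'p set \<times> ('p \<Rightarrow> real ^ 'n)"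
type_synonym ('p, 'n) tvec = "('p, 'n) chart \<Rightarrow> real ^ 'n"

record ('p, 'n) riemannian =
  atlas :: "('p, 'n::finite) chart set"
  metric :: "'p \<Rightarrow> ('p, 'n) tvec \<Rightarrow> ('p, 'n) tvec \<Rightarrow> real"

definition is_chart :: "('p::topological_space, 'n::finite) chart \<Rightarrow> bool" where
  "is_chart c \<longleftrightarrow> open (fst c) \<and> open (snd c ` fst c) \<and>
     homeomorphism (fst c) (snd c ` fst c) (snd c) (inv_into (fst c) (snd c))"

definition transition :: "('p, 'n) chart \<Rightarrow> ('p, 'n) chart \<Rightarrow> real ^ 'n \<Rightarrow> real ^ 'n" where
  "transition c d = snd d \<circ> inv_into (fst c) (snd c)"

definition charts_at :: "('p, 'n::finite) riemannian \<Rightarrow> 'p \<Rightarrow> ('p, 'n) chart set" where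
  "charts_at M p = {c \<in> atlas M. p \<in> fst c}"

definition tangent_space_at :: "('p, 'n::finite) riemannian \<Rightarrow> 'p \<Rightarrow> ('p, 'n) tvec set" where
  "tangent_space_at M p =
     {v. (\<forall>c. c \<notin> charts_at M p \<longrightarrow> v c = 0) \<and>
         (\<forall>c\<in>charts_at M p. \<forall>d\<in>charts_at M p.
            v d = frechet_derivative (transition c d) (at (snd c p)) (v c))}"

definition lincomb :: "real \<Rightarrow> ('p, 'n::finite) tvec \<Rightarrow> real \<Rightarrow> ('p, 'n) tvec \<Rightarrow> ('p, 'n) tvec" where
  "lincomb a u b v = (\<lambda>c. a *\<^sub>R u c + b *\<^sub>R v c)"

(* the tangent vector at p with coordinate vector w in the chart c *)
definition coord_vec ::
    "('p, 'n::finite) riemannian \<Rightarrow> ('p, 'n) chart \<Rightarrow> 'p \<Rightarrow> real ^ 'n \<Rightarrow> ('p, 'n) tvec" where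
  "coord_vec M c p w =
     (\<lambda>d. if d \<in> charts_at M p
          then frechet_derivative (transition c d) (at (snd c p)) w else 0)"

(* The orientation is part of the atlas: all coordinate changes have positive Jacobian. *)
definition oriented_smooth_atlas :: "('p::topological_space, 'n::finite) chart set \<Rightarrow> bool" where
  "oriented_smooth_atlas A \<longleftrightarrow>
     (\<forall>c\<in>A. is_chart c) \<and> (\<Union>c\<in>A. fst c) = UNIV \<and>
     (\<forall>c\<in>A. \<forall>d\<in>A. smooth_on (snd c ` (fst c \<inter> fst d)) (transition c d) \<and>
        (\<forall>p\<in>fst c \<inter> fst d.
           0 < det (matrix (frechet_derivative (transition c d) (at (snd c p))))))"

definition riemannian_metric :: "('p::topological_space, 'n::finite) riemannian \<Rightarrow> bool" where
  "riemannian_metric M \<longleftrightarrow>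
     (\<forall>p. \<forall>u\<in>tangent_space_at M p. \<forall>v\<in>tangent_space_at M p.
        metric M p u v = metric M p v u \<and>
        (u \<noteq> (\<lambda>c. 0) \<longrightarrow> 0 < metric M p u u) \<and>
        (\<forall>w\<in>tangent_space_at M p. \<forall>a b.
           metric M p (lincomb a u b v) w = a * metric M p u w + b * metric M p v w)) \<and>
     (\<forall>c\<in>atlas M. \<forall>w w'. smooth_on (snd c ` fst c)
        (\<lambda>y. let p = inv_into (fst c) (snd c) y
             in metric M p (coord_vec M c p w) (coord_vec M c p w')))"

(* The underlying space is the whole type 'p. *)
definition oriented_riemannian_manifold ::
    "('p::{t2_space, second_countable_topology}, 'n::finite) riemannian \<Rightarrow> bool" where
  "oriented_riemannian_manifold M \<longleftrightarrow> oriented_smooth_atlas (atlas M) \<and> riemannian_metric M"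

definition pos_tangent_frame ::
    "('p, 'n::finite) riemannian \<Rightarrow> 'p \<Rightarrow> ('n \<Rightarrow> ('p, 'n) tvec) \<Rightarrow> bool" where
  "pos_tangent_frame M p e \<longleftrightarrow> (\<forall>j. e j \<in> tangent_space_at M p) \<and>
     (\<forall>c\<in>charts_at M p. 0 < det (\<chi> i j. e j c $ i))"

section \<open>Isometric imbeddings\<close>

(* The index type 'n + 'v renders R^(n + nu): n = CARD('n), nu = CARD('v), with the
   standard basis ordered so that the Inl coordinates precede the Inr ones. *)

definition differential ::
    "('p, 'n::finite) riemannian \<Rightarrow> ('p \<Rightarrow> 'b::real_normed_vector) \<Rightarrow> 'p \<Rightarrow> ('p, 'n) tvec \<Rightarrow> 'b" where
  "differential M \<iota> p v =
     (let c = (SOME c. c \<in> charts_at M p)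
      in frechet_derivative (\<iota> \<circ> inv_into (fst c) (snd c)) (at (snd c p)) (v c))"

definition isometric_imbedding ::
    "('p::topological_space, 'n::finite) riemannian \<Rightarrow> ('p \<Rightarrow> real ^ ('n + 'v::finite)) \<Rightarrow> bool" where
  "isometric_imbedding M \<iota> \<longleftrightarrow>
     (\<forall>c\<in>atlas M. smooth_on (snd c ` fst c) (\<iota> \<circ> inv_into (fst c) (snd c))) \<and>
     (\<exists>g. homeomorphism UNIV (range \<iota>) \<iota> g) \<and>
     (\<forall>p. \<forall>u\<in>tangent_space_at M p. \<forall>v\<in>tangent_space_at M p.
        differential M \<iota> p u \<bullet> differential M \<iota> p v = metric M p u v)"

definition tangent_image ::
    "('p, 'n::finite) riemannian \<Rightarrow> ('p \<Rightarrow> real ^ ('n + 'v::finite)) \<Rightarrow> 'p \<Rightarrow> (real ^ ('n + 'v)) set" where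
  "tangent_image M \<iota> p = differential M \<iota> p ` tangent_space_at M p"

definition normal_space_at ::
    "('p, 'n::finite) riemannian \<Rightarrow> ('p \<Rightarrow> real ^ ('n + 'v::finite)) \<Rightarrow> 'p \<Rightarrow> (real ^ ('n + 'v)) set" where
  "normal_space_at M \<iota> p = (tangent_image M \<iota> p)\<^sup>\<bottom>"

definition orth_proj :: "'b::real_inner set \<Rightarrow> 'b \<Rightarrow> 'b" where
  "orth_proj S v = (THE y. y \<in> S \<and> (\<forall>z\<in>S. (v - y) \<bullet> z = 0))"

(* induced orientation of the normal space: tangent frame first, normal frame second *)
definition pos_normal_frame ::
    "('p, 'n::finite) riemannian \<Rightarrow> ('p \<Rightarrow> real ^ ('n + 'v::finite)) \<Rightarrow> 'p \<Rightarrow>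
     ('v \<Rightarrow> real ^ ('n + 'v)) \<Rightarrow> bool" where
  "pos_normal_frame M \<iota> p f \<longleftrightarrow> (\<forall>l. f l \<in> normal_space_at M \<iota> p) \<and>
     (\<forall>e. pos_tangent_frame M p e \<longrightarrow>
        0 < det (\<chi> i j. (case j of Inl k \<Rightarrow> differential M \<iota> p (e k) | Inr l \<Rightarrow> f l) $ i))"

section \<open>The fibres of Q and P\<close>

definition isom_tangent ::
    "('p, 'n::finite) riemannian \<Rightarrow> ('q, 'n) riemannian \<Rightarrow> 'p \<Rightarrow> 'q \<Rightarrow>
     (('p, 'n) tvec \<Rightarrow> ('q, 'n) tvec) set" where
  "isom_tangent M M' x x' =
     {A. (\<forall>u\<in>tangent_space_at M x. A u \<in> tangent_space_at M' x') \<and>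
         (\<forall>u\<in>tangent_space_at M x. \<forall>v\<in>tangent_space_at M x. \<forall>a b.
            A (lincomb a u b v) = lincomb a (A u) b (A v)) \<and>
         (\<forall>u\<in>tangent_space_at M x. \<forall>v\<in>tangent_space_at M x.
            metric M' x' (A u) (A v) = metric M x u v) \<and>
         (\<forall>e. pos_tangent_frame M x e \<longrightarrow> pos_tangent_frame M' x' (A \<circ> e))}"

definition isom_normal ::
    "('p, 'n::finite) riemannian \<Rightarrow> ('p \<Rightarrow> real ^ ('n + 'v::finite)) \<Rightarrow>
     ('q, 'n) riemannian \<Rightarrow> ('q \<Rightarrow> real ^ ('n + 'v)) \<Rightarrow> 'p \<Rightarrow> 'q \<Rightarrow>
     (real ^ ('n + 'v) \<Rightarrow> real ^ ('n + 'v)) set" where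
  "isom_normal M \<iota> M' \<iota>' x x' =
     {A. (\<forall>u\<in>normal_space_at M \<iota> x. A u \<in> normal_space_at M' \<iota>' x') \<and>
         (\<forall>u\<in>normal_space_at M \<iota> x. \<forall>v\<in>normal_space_at M \<iota> x. \<forall>a b.
            A (a *\<^sub>R u + b *\<^sub>R v) = a *\<^sub>R A u + b *\<^sub>R A v) \<and>
         (\<forall>u\<in>normal_space_at M \<iota> x. \<forall>v\<in>normal_space_at M \<iota> x. A u \<bullet> A v = u \<bullet> v) \<and>
         (\<forall>f. pos_normal_frame M \<iota> x f \<longrightarrow> pos_normal_frame M' \<iota>' x' (A \<circ> f))}"

section \<open>Absolutely continuous curves and fields\<close>

(* Absolute continuity of curves in M, TM and Q is expressed in the local coordinates given by
   charts, on all subintervals mapped into the chart domains. *)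

definition ac_curve ::
    "('p::topological_space, 'n::finite) riemannian \<Rightarrow> real \<Rightarrow> (real \<Rightarrow> 'p) \<Rightarrow> bool" where
  "ac_curve M \<tau> x \<longleftrightarrow> continuous_on {0..\<tau>} x \<and>
     (\<forall>c\<in>atlas M. \<forall>a b. 0 \<le> a \<and> a \<le> b \<and> b \<le> \<tau> \<and> x ` {a..b} \<subseteq> fst c
        \<longrightarrow> abs_cont_on a b (snd c \<circ> x))"

definition tangent_field ::
    "('p, 'n::finite) riemannian \<Rightarrow> real \<Rightarrow> (real \<Rightarrow> 'p) \<Rightarrow> (real \<Rightarrow> ('p, 'n) tvec) \<Rightarrow> bool" where
  "tangent_field M \<tau> x Z \<longleftrightarrow> (\<forall>t\<in>{0..\<tau>}. Z t \<in> tangent_space_at M (x t)) \<and>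
     (\<forall>c\<in>atlas M. \<forall>a b. 0 \<le> a \<and> a \<le> b \<and> b \<le> \<tau> \<and> x ` {a..b} \<subseteq> fst c
        \<longrightarrow> abs_cont_on a b (\<lambda>t. Z t c))"

definition normal_field ::
    "('p, 'n::finite) riemannian \<Rightarrow> ('p \<Rightarrow> real ^ ('n + 'v::finite)) \<Rightarrow> real \<Rightarrow> (real \<Rightarrow> 'p) \<Rightarrow>
     (real \<Rightarrow> real ^ ('n + 'v)) \<Rightarrow> bool" where
  "normal_field M \<iota> \<tau> x \<Psi> \<longleftrightarrow>
     (\<forall>t\<in>{0..\<tau>}. \<Psi> t \<in> normal_space_at M \<iota> (x t)) \<and> abs_cont_on 0 \<tau> \<Psi>"

definition ac_curve_Q ::
    "('p::topological_space, 'n::finite) riemannian \<Rightarrow> ('q::topological_space, 'n) riemannian \<Rightarrow> real \<Rightarrow>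
     (real \<Rightarrow> 'p) \<Rightarrow> (real \<Rightarrow> 'q) \<Rightarrow> (real \<Rightarrow> ('p, 'n) tvec \<Rightarrow> ('q, 'n) tvec) \<Rightarrow> bool" where
  "ac_curve_Q M M' \<tau> x x' q \<longleftrightarrow> ac_curve M \<tau> x \<and> ac_curve M' \<tau> x' \<and>
     (\<forall>t\<in>{0..\<tau>}. q t \<in> isom_tangent M M' (x t) (x' t)) \<and>
     (\<forall>c\<in>atlas M. \<forall>d\<in>atlas M'. \<forall>a b.
        0 \<le> a \<and> a \<le> b \<and> b \<le> \<tau> \<and> x ` {a..b} \<subseteq> fst c \<and> x' ` {a..b} \<subseteq> fst d
        \<longrightarrow> (\<forall>w. abs_cont_on a b (\<lambda>t. q t (coord_vec M c (x t) w) d)))"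

(* P is regarded as a submanifold of M \<times> M' \<times> Hom(R^(n + nu), R^(n + nu)), a normal isometry being
   extended by 0 on the tangent space. *)
definition ac_curve_P ::
    "('p::topological_space, 'n::finite) riemannian \<Rightarrow> ('p \<Rightarrow> real ^ ('n + 'v::finite)) \<Rightarrow>
     ('q::topological_space, 'n) riemannian \<Rightarrow> ('q \<Rightarrow> real ^ ('n + 'v)) \<Rightarrow> real \<Rightarrow>
     (real \<Rightarrow> 'p) \<Rightarrow> (real \<Rightarrow> 'q) \<Rightarrow> (real \<Rightarrow> real ^ ('n + 'v) \<Rightarrow> real ^ ('n + 'v)) \<Rightarrow> bool" where
  "ac_curve_P M \<iota> M' \<iota>' \<tau> x x' p \<longleftrightarrow> ac_curve M \<tau> x \<and> ac_curve M' \<tau> x' \<and>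
     (\<forall>t\<in>{0..\<tau>}. p t \<in> isom_normal M \<iota> M' \<iota>' (x t) (x' t)) \<and>
     (\<forall>w. abs_cont_on 0 \<tau> (\<lambda>t. p t (orth_proj (normal_space_at M \<iota> (x t)) w)))"

definition velocity ::
    "('p, 'n::finite) riemannian \<Rightarrow> (real \<Rightarrow> 'p) \<Rightarrow> real \<Rightarrow> ('p, 'n) tvec" where
  "velocity M x t =
     (\<lambda>c. if c \<in> charts_at M (x t) then vector_derivative (snd c \<circ> x) (at t) else 0)"

(* D/dt Z is the tangential part of the derivative of Z in R^(n + nu), where T_xM is identified
   with its image under the differential of \<iota>. *)
definition cov_deriv ::
    "('p, 'n::finite) riemannian \<Rightarrow> ('p \<Rightarrow> real ^ ('n + 'v::finite)) \<Rightarrow> (real \<Rightarrow> 'p) \<Rightarrow>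
     (real \<Rightarrow> ('p, 'n) tvec) \<Rightarrow> real \<Rightarrow> ('p, 'n) tvec" where
  "cov_deriv M \<iota> x Z t =
     (THE w. w \<in> tangent_space_at M (x t) \<and>
        differential M \<iota> (x t) w =
          orth_proj (tangent_image M \<iota> (x t))
            (vector_derivative (\<lambda>s. differential M \<iota> (x s) (Z s)) (at t)))"

definition normal_deriv ::
    "('p, 'n::finite) riemannian \<Rightarrow> ('p \<Rightarrow> real ^ ('n + 'v::finite)) \<Rightarrow> (real \<Rightarrow> 'p) \<Rightarrow>
     (real \<Rightarrow> real ^ ('n + 'v)) \<Rightarrow> real \<Rightarrow> real ^ ('n + 'v)" where
  "normal_deriv M \<iota> x \<Psi> t =
     orth_proj (normal_space_at M \<iota> (x t)) (vector_derivative \<Psi> (at t))"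

definition parallel ::
    "('p, 'n::finite) riemannian \<Rightarrow> ('p \<Rightarrow> real ^ ('n + 'v::finite)) \<Rightarrow> real \<Rightarrow> (real \<Rightarrow> 'p) \<Rightarrow>
     (real \<Rightarrow> ('p, 'n) tvec) \<Rightarrow> bool" where
  "parallel M \<iota> \<tau> x Z \<longleftrightarrow> tangent_field M \<tau> x Z \<and>
     (AE t in lebesgue_on {0..\<tau>}. cov_deriv M \<iota> x Z t = (\<lambda>c. 0))"

definition normal_parallel ::
    "('p, 'n::finite) riemannian \<Rightarrow> ('p \<Rightarrow> real ^ ('n + 'v::finite)) \<Rightarrow> real \<Rightarrow> (real \<Rightarrow> 'p) \<Rightarrow>
     (real \<Rightarrow> real ^ ('n + 'v)) \<Rightarrow> bool" where
  "normal_parallel M \<iota> \<tau> x \<Psi> \<longleftrightarrow> normal_field M \<iota> \<tau> x \<Psi> \<and>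
     (AE t in lebesgue_on {0..\<tau>}. normal_deriv M \<iota> x \<Psi> t = 0)"

section \<open>Rollings\<close>

(* The imbeddings enter only through D/dt, which equals the Levi-Civita covariant derivative
   along the curve (Gauss formula). *)
definition intrinsic_rolling ::
    "('p::topological_space, 'n::finite) riemannian \<Rightarrow> ('p \<Rightarrow> real ^ ('n + 'v::finite)) \<Rightarrow>
     ('q::topological_space, 'n) riemannian \<Rightarrow> ('q \<Rightarrow> real ^ ('n + 'v)) \<Rightarrow> real \<Rightarrow>
     (real \<Rightarrow> 'p) \<Rightarrow> (real \<Rightarrow> 'q) \<Rightarrow> (real \<Rightarrow> ('p, 'n) tvec \<Rightarrow> ('q, 'n) tvec) \<Rightarrow> bool" where
  "intrinsic_rolling M \<iota> M' \<iota>' \<tau> x x' q \<longleftrightarrow>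
     ac_curve_Q M M' \<tau> x x' q \<and>
     (AE t in lebesgue_on {0..\<tau>}. velocity M' x' t = q t (velocity M x t)) \<and>
     (\<forall>Z. tangent_field M \<tau> x Z \<longrightarrow>
        (parallel M \<iota> \<tau> x Z \<longleftrightarrow> parallel M' \<iota>' \<tau> x' (\<lambda>t. q t (Z t))))"

definition rolling ::
    "('p::topological_space, 'n::finite) riemannian \<Rightarrow> ('p \<Rightarrow> real ^ ('n + 'v::finite)) \<Rightarrow>
     ('q::topological_space, 'n) riemannian \<Rightarrow> ('q \<Rightarrow> real ^ ('n + 'v)) \<Rightarrow> real \<Rightarrow>
     (real \<Rightarrow> 'p) \<Rightarrow> (real \<Rightarrow> 'q) \<Rightarrow> (real \<Rightarrow> ('p, 'n) tvec \<Rightarrow> ('q, 'n) tvec) \<Rightarrow>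
     (real \<Rightarrow> real ^ ('n + 'v) \<Rightarrow> real ^ ('n + 'v)) \<Rightarrow> bool" where
  "rolling M \<iota> M' \<iota>' \<tau> x x' q p \<longleftrightarrow>
     ac_curve_Q M M' \<tau> x x' q \<and> ac_curve_P M \<iota> M' \<iota>' \<tau> x x' p \<and>
     (AE t in lebesgue_on {0..\<tau>}. velocity M' x' t = q t (velocity M x t)) \<and>
     (\<forall>Z. tangent_field M \<tau> x Z \<longrightarrow>
        (AE t in lebesgue_on {0..\<tau>}.
           q t (cov_deriv M \<iota> x Z t) = cov_deriv M' \<iota>' x' (\<lambda>s. q s (Z s)) t)) \<and>
     (\<forall>\<Psi>. normal_field M \<iota> \<tau> x \<Psi> \<longrightarrow>
        (AE t in lebesgue_on {0..\<tau>}.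
           p t (normal_deriv M \<iota> x \<Psi> t) = normal_deriv M' \<iota>' x' (\<lambda>s. p s (\<Psi> s)) t))"

definition parallel_normal_frame ::
    "('p, 'n::finite) riemannian \<Rightarrow> ('p \<Rightarrow> real ^ ('n + 'v::finite)) \<Rightarrow> real \<Rightarrow> (real \<Rightarrow> 'p) \<Rightarrow>
     ('v \<Rightarrow> real \<Rightarrow> real ^ ('n + 'v)) \<Rightarrow> bool" where
  "parallel_normal_frame M \<iota> \<tau> x \<epsilon> \<longleftrightarrow>
     (\<forall>l. normal_parallel M \<iota> \<tau> x (\<epsilon> l)) \<and>
     (\<forall>t\<in>{0..\<tau>}. (\<forall>k l. \<epsilon> k t \<bullet> \<epsilon> l t = (if k = l then 1 else 0)) \<and>
        pos_normal_frame M \<iota> (x t) (\<lambda>l. \<epsilon> l t))"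

definition frame_matrix ::
    "('v::finite \<Rightarrow> 'b::real_inner) \<Rightarrow> ('v \<Rightarrow> 'b) \<Rightarrow> ('b \<Rightarrow> 'b) \<Rightarrow> real ^ 'v ^ 'v" where
  "frame_matrix f f' A = (\<chi> k l. f' k \<bullet> A (f l))"

(* the map span f \<rightarrow> span f' whose matrix with respect to the orthonormal frames f, f' is that of A
   multiplied by B on the right *)
definition right_action ::
    "('v::finite \<Rightarrow> 'b::real_inner) \<Rightarrow> ('v \<Rightarrow> 'b) \<Rightarrow> ('b \<Rightarrow> 'b) \<Rightarrow> real ^ 'v ^ 'v \<Rightarrow> 'b \<Rightarrow> 'b" where
  "right_action f f' A B v =
     (\<Sum>k\<in>UNIV. \<Sum>l\<in>UNIV. ((frame_matrix f f' A ** B) $ k $ l * (f l \<bullet> v)) *\<^sub>R f' k)"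

end

theory Submission
  imports Defs
begin

text \<open>Write \<open>P t\<close> for the orthogonal projection onto the tangent (or normal) space along a curve, an absolutely
  continuous family of projections. The linear equation \<open>w' = P' w\<close> has integrable coefficients and transports
  a vector of the initial space to a parallel section, so parallel orthonormal tangent and normal frames
  exist. With respect to such frames \<open>D/dt\<close> and \<open>D\<^sup>\<bottom>/dt\<close> are componentwise differentiation. Hence (II)
  follows from (II') by expanding a tangent field in a parallel frame, and (III) says precisely that the matrix
  of \<open>p\<close> in parallel normal frames is constant; the admissible constants are the rotation matrices, because
  \<open>p\<close> preserves inner products and orientation.\<close>

section \<open>Absolutely continuous functions\<close>

text \<open>The curves are only absolutely continuous, and this shapes the proof. Derivatives exist
  only almost everywhere, and a vanishing derivative forces constancy only because an absolutely
  continuous function is the integral of its derivative. The transport equation has merely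
  integrable coefficients, so its solution is an indefinite integral and in general not C1. A second
  obstacle is that absolute continuity on the manifolds is stated in charts, whereas D/dt and the
  normal derivative live in the ambient space. The two are matched by comparing coordinate Jacobians
  at two times: their increments are dominated by those of one scalar absolutely continuous
  function, and on a compact time interval they are bounded below on unit vectors. This also shows
  that the projections depend absolutely continuously on time. Parallel sections have constant inner
  products, so transport keeps frames orthonormal; the orientation of a normal frame persists
  because a determinant is continuous and never zero.\<close>

definition interval_system :: "real \<Rightarrow> real \<Rightarrow> (real \<times> real) set \<Rightarrow> bool" where
  "interval_system a b D \<longleftrightarrow> finite D \<and> (\<forall>(u, v)\<in>D. a \<le> u \<and> u \<le> v \<and> v \<le> b) \<and>
     pairwise (\<lambda>(u, v) (u', v'). {u<..<v} \<inter> {u'<..<v'} = {}) D"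

text \<open>For the identity function this is the total length of the intervals, so one functional
  serves for both sums in \<open>abs_cont_on\<close>.\<close>

definition variation_over :: "(real \<Rightarrow> 'b::real_normed_vector) \<Rightarrow> (real \<times> real) set \<Rightarrow> real" where
  "variation_over f D = (\<Sum>p\<in>D. norm (f (snd p) - f (fst p)))"

lemma interval_system_finite: "interval_system a b D \<Longrightarrow> finite D"
  by (simp add: interval_system_def)

lemma interval_systemD:
  assumes "interval_system a b D" "p \<in> D"
  shows "a \<le> fst p" "fst p \<le> snd p" "snd p \<le> b"
  using assms by (auto simp: interval_system_def)

lemma interval_system_mono:
  assumes "interval_system a b D" "a' \<le> a" "b \<le> b'" "D' \<subseteq> D"
  shows "interval_system a' b' D'"
  unfolding interval_system_def
proof (intro conjI ballI)
  show "finite D'" using assms by (blast intro: finite_subset interval_system_finite)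
  show "case p of (u, v) \<Rightarrow> a' \<le> u \<and> u \<le> v \<and> v \<le> b'" if "p \<in> D'" for p
    using interval_systemD[OF assms(1) subsetD[OF assms(4) that]] assms(2,3) by (simp add: split_beta)
  show "pairwise (\<lambda>(u, v) (u', v'). {u<..<v} \<inter> {u'<..<v'} = {}) D'"
    using pairwise_subset[OF _ assms(4)] assms(1) by (simp add: interval_system_def)
qed

lemma interval_system_disjoint:
  assumes "interval_system a b D" "p \<in> D" "p' \<in> D" "p \<noteq> p'"
  shows "{fst p<..<snd p} \<inter> {fst p'<..<snd p'} = {}"
proof -
  have "pairwise (\<lambda>(u, v) (u', v'). {u<..<v} \<inter> {u'<..<v'} = {}) D"
    using assms(1) by (simp add: interval_system_def)
  from pairwiseD[OF this assms(2-4)] show ?thesis by (simp only: split_beta)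
qed

lemma variation_over_nonneg: "0 \<le> variation_over f D"
  unfolding variation_over_def by (simp add: sum_nonneg)

lemma abs_cont_on_iff:
  "abs_cont_on a b f \<longleftrightarrow> (\<forall>e>0. \<exists>d>0. \<forall>D. interval_system a b D \<longrightarrow>
     variation_over (\<lambda>t. t) D < d \<longrightarrow> variation_over f D < e)"
proof -
  have length: "variation_over (\<lambda>t. t) D = (\<Sum>(u, v)\<in>D. v - u)" if "interval_system a b D" for D
    unfolding variation_over_def split_beta
  proof (rule sum.cong[OF refl])
    show "norm (snd p - fst p) = snd p - fst p" if "p \<in> D" for p
      using interval_systemD[OF \<open>interval_system a b D\<close> that] by simp
  qed
  have "((finite D \<and> (\<forall>(u, v)\<in>D. a \<le> u \<and> u \<le> v \<and> v \<le> b) \<and>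
        pairwise (\<lambda>(u, v) (u', v'). {u<..<v} \<inter> {u'<..<v'} = {}) D \<and>
        (\<Sum>(u, v)\<in>D. v - u) < d) \<longrightarrow> (\<Sum>(u, v)\<in>D. norm (f v - f u)) < e) \<longleftrightarrow>
      (interval_system a b D \<longrightarrow> (\<Sum>(u, v)\<in>D. v - u) < d \<longrightarrow> variation_over f D < e)" for D d e
    unfolding interval_system_def variation_over_def split_beta by (simp only: imp_conjL conj_assoc)
  moreover have "(interval_system a b D \<longrightarrow> (\<Sum>(u, v)\<in>D. v - u) < d \<longrightarrow> variation_over f D < e) \<longleftrightarrow> (interval_system a b D \<longrightarrow> variation_over (\<lambda>t. t) D < d \<longrightarrow>
      variation_over f D < e)" for D d e
    by (simp add: length cong: imp_cong)
  ultimately show ?thesis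
    unfolding abs_cont_on_def by (simp only:)
qed

lemma abs_cont_onD:
  assumes "abs_cont_on a b f" "0 < e"
  shows "\<exists>d>0. \<forall>D. interval_system a b D \<longrightarrow> variation_over (\<lambda>t. t) D < d \<longrightarrow> variation_over f D < e"
  using assms unfolding abs_cont_on_iff by simp

lemma abs_cont_on_subinterval:
  assumes "abs_cont_on a b f" "a \<le> a'" "b' \<le> b"
  shows "abs_cont_on a' b' f"
  using assms unfolding abs_cont_on_iff
  by (meson interval_system_mono subset_refl)

text \<open>The open intervals are disjoint, so their lengths add up to the measure of a subset of
  \<open>S\<close>. The set \<open>S\<close> is general because it will also be a countable union of
  intervals that covers a null set.\<close>

lemma interval_system_length_le:
  assumes D: "interval_system a b D" and S: "S \<in> lmeasurable"
    and sub: "\<And>p. p \<in> D \<Longrightarrow> {fst p<..<snd p} \<subseteq> S"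
  shows "variation_over (\<lambda>t. t) D \<le> measure lebesgue S"
proof -
  have "variation_over (\<lambda>t. t) D = (\<Sum>p\<in>D. measure lebesgue {fst p<..<snd p})"
    unfolding variation_over_def
    by (rule sum.cong[OF refl]) (use interval_systemD(2)[OF D] in simp)
  also have "\<dots> = measure lebesgue (\<Union>p\<in>D. {fst p<..<snd p})"
  proof (rule measure_finite_Union[symmetric])
    show "disjoint_family_on (\<lambda>p. {fst p<..<snd p}) D"
      unfolding disjoint_family_on_def using interval_system_disjoint[OF D] by blast
    show "emeasure lebesgue {fst p<..<snd p} \<noteq> \<infinity>" if "p \<in> D" for p
      using interval_systemD(2)[OF D that] by simp
  qed (use interval_system_finite[OF D] in auto)
  also have "\<dots> \<le> measure lebesgue S"
    using S sub interval_system_finite[OF D] by (intro measure_mono_fmeasurable) (auto intro: UN_least)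
  finally show ?thesis .
qed

lemma interval_system_length:
  assumes "interval_system a b D" "a \<le> b"
  shows "variation_over (\<lambda>t. t) D \<le> b - a"
proof -
  have "{fst p<..<snd p} \<subseteq> {a..b}" if "p \<in> D" for p
    using interval_systemD[OF assms(1) that] by auto
  then show ?thesis
    using interval_system_length_le[OF assms(1), of "{a..b}"] assms(2) by simp
qed

text \<open>Truncations from above by \<open>min\<close> and from below by \<open>max\<close> are
  treated together. The middle clause keeps image intervals inside the original ones, hence
  disjoint; the last one keeps the total length from growing.\<close>

definition clip_map :: "(real \<Rightarrow> real) \<Rightarrow> bool" where
  "clip_map \<phi> \<longleftrightarrow> mono \<phi> \<and> (\<forall>u v z. \<phi> u < z \<and> z < \<phi> v \<longrightarrow> u < z \<and> z < v) \<and>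
     (\<forall>u v. \<bar>\<phi> v - \<phi> u\<bar> \<le> \<bar>v - u\<bar>)"

lemma clip_mapD:
  assumes "clip_map \<phi>"
  shows "u \<le> v \<Longrightarrow> \<phi> u \<le> \<phi> v" "{\<phi> u<..<\<phi> v} \<subseteq> {u<..<v}" "\<bar>\<phi> v - \<phi> u\<bar> \<le> \<bar>v - u\<bar>"
proof -
  note \<phi> = assms[unfolded clip_map_def]
  show "u \<le> v \<Longrightarrow> \<phi> u \<le> \<phi> v" by (rule monoD[OF conjunct1[OF \<phi>]])
  show "{\<phi> u<..<\<phi> v} \<subseteq> {u<..<v}"
  proof
    fix z assume "z \<in> {\<phi> u<..<\<phi> v}"
    then show "z \<in> {u<..<v}"
      using \<phi>[THEN conjunct2, THEN conjunct1, rule_format, of u z v]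
      unfolding greaterThanLessThan_iff by fast
  qed
  show "\<bar>\<phi> v - \<phi> u\<bar> \<le> \<bar>v - u\<bar>"
    by (rule \<phi>[THEN conjunct2, THEN conjunct2, rule_format])
qed

lemma clip_map_min: "clip_map (\<lambda>t. min t m)"
  unfolding clip_map_def
proof (intro conjI)
  show "mono (\<lambda>t. min t m)" by (rule monoI) simp
  show "\<forall>u v z. min u m < z \<and> z < min v m \<longrightarrow> u < z \<and> z < v" by auto
  show "\<forall>u v. \<bar>min v m - min u m\<bar> \<le> \<bar>v - u\<bar>"
  proof (intro allI)
    show "\<bar>min v m - min u m\<bar> \<le> \<bar>v - u\<bar>" for u v
      by (smt (verit) min_def)
  qed
qed

lemma clip_map_max: "clip_map (\<lambda>t. max m t)"
  unfolding clip_map_def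
proof (intro conjI)
  show "mono (\<lambda>t. max m t)" by (rule monoI) simp
  show "\<forall>u v z. max m u < z \<and> z < max m v \<longrightarrow> u < z \<and> z < v" by auto
  show "\<forall>u v. \<bar>max m v - max m u\<bar> \<le> \<bar>v - u\<bar>"
  proof (intro allI)
    show "\<bar>max m v - max m u\<bar> \<le> \<bar>v - u\<bar>" for u v
      by (smt (verit) max_def)
  qed
qed

text \<open>Clipping can send two intervals of \<open>D\<close> to the same pair. Disjointness then
  forces that pair to be degenerate, so merging the two in the image set loses no variation.\<close>

lemma interval_system_clip:
  assumes D: "interval_system a b D" and \<phi>: "clip_map \<phi>" and "a \<le> b"
  shows "interval_system (\<phi> a) (\<phi> b) (map_prod \<phi> \<phi> ` D)"
    and "variation_over f (map_prod \<phi> \<phi> ` D) = variation_over (f \<circ> \<phi>) D"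
proof -
  have mono: "\<phi> s \<le> \<phi> t" if "s \<le> t" for s t
    using clip_mapD(1)[OF \<phi> that] .
  have sub: "{\<phi> (fst p)<..<\<phi> (snd p)} \<subseteq> {fst p<..<snd p}" for p
    by (rule clip_mapD(2)[OF \<phi>])
  have disj: "{\<phi> (fst p)<..<\<phi> (snd p)} \<inter> {\<phi> (fst p')<..<\<phi> (snd p')} = {}"
    if "p \<in> D" "p' \<in> D" "p \<noteq> p'" for p p'
    using interval_system_disjoint[OF D that] sub by blast
  show "interval_system (\<phi> a) (\<phi> b) (map_prod \<phi> \<phi> ` D)"
    unfolding interval_system_def
  proof (intro conjI)
    show "finite (map_prod \<phi> \<phi> ` D)" using interval_system_finite[OF D] by simp
    show "\<forall>(u, v)\<in>map_prod \<phi> \<phi> ` D. \<phi> a \<le> u \<and> u \<le> v \<and> v \<le> \<phi> b"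
    proof (rule ballI, elim imageE)
      fix r p assume "r = map_prod \<phi> \<phi> p" "p \<in> D"
      then show "case r of (u, v) \<Rightarrow> \<phi> a \<le> u \<and> u \<le> v \<and> v \<le> \<phi> b"
        using interval_systemD[OF D \<open>p \<in> D\<close>] by (simp add: split_beta mono)
    qed
    show "pairwise (\<lambda>(u, v) (u', v'). {u<..<v} \<inter> {u'<..<v'} = {}) (map_prod \<phi> \<phi> ` D)"
    proof (rule pairwiseI)
      fix r r' assume *: "r \<in> map_prod \<phi> \<phi> ` D" "r' \<in> map_prod \<phi> \<phi> ` D" "r \<noteq> r'"
      obtain p where p: "p \<in> D" "r = map_prod \<phi> \<phi> p" using *(1) by (rule imageE)
      obtain p' where p': "p' \<in> D" "r' = map_prod \<phi> \<phi> p'" using *(2) by (rule imageE)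
      have "p \<noteq> p'" using *(3) p(2) p'(2) by metis
      have r: "r = (\<phi> (fst p), \<phi> (snd p))" "r' = (\<phi> (fst p'), \<phi> (snd p'))"
        using p(2) p'(2) by (simp_all add: prod_eq_iff)
      from disj[OF p(1) p'(1) \<open>p \<noteq> p'\<close>]
      show "(case r of (u, v) \<Rightarrow> \<lambda>(u', v'). {u<..<v} \<inter> {u'<..<v'} = {}) r'"
        by (simp only: r prod.case)
    qed
  qed
  have degenerate: "norm (f (\<phi> (snd p)) - f (\<phi> (fst p))) = 0"
    if "p \<in> D" "p' \<in> D" "p \<noteq> p'" "map_prod \<phi> \<phi> p = map_prod \<phi> \<phi> p'" for p p'
  proof -
    have "\<phi> (fst p) = \<phi> (fst p')" "\<phi> (snd p) = \<phi> (snd p')"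
      using that(4) by (simp_all add: prod_eq_iff)
    then have "{\<phi> (fst p)<..<\<phi> (snd p)} = {}"
      using disj[OF that(1-3)] by simp
    moreover have "\<phi> (fst p) \<le> \<phi> (snd p)"
      using interval_systemD(2)[OF D that(1)] mono by blast
    ultimately have "\<phi> (fst p) = \<phi> (snd p)"
      by simp
    then show ?thesis by simp
  qed
  have "variation_over f (map_prod \<phi> \<phi> ` D) = (\<Sum>p\<in>D. norm (f (\<phi> (snd p)) - f (\<phi> (fst p))))"
    unfolding variation_over_def
  proof (subst sum.reindex_nontrivial[OF interval_system_finite[OF D]])
    show "norm (f (snd (map_prod \<phi> \<phi> p)) - f (fst (map_prod \<phi> \<phi> p))) = 0"
      if "p \<in> D" "p' \<in> D" "p \<noteq> p'" "map_prod \<phi> \<phi> p = map_prod \<phi> \<phi> p'" for p p'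
      unfolding fst_map_prod snd_map_prod by (rule degenerate[OF that])
  qed simp
  then show "variation_over f (map_prod \<phi> \<phi> ` D) = variation_over (f \<circ> \<phi>) D"
    by (simp add: variation_over_def)
qed

section \<open>Closure properties of absolutely continuous functions\<close>

lemma abs_cont_on_dominated2:
  assumes "abs_cont_on a b f" "abs_cont_on a b g" "0 \<le> K"
    and "\<And>u v. a \<le> u \<Longrightarrow> u \<le> v \<Longrightarrow> v \<le> b \<Longrightarrow>
           norm (h v - h u) \<le> K * (norm (f v - f u) + norm (g v - g u))"
  shows "abs_cont_on a b h"
  unfolding abs_cont_on_iff
proof (intro allI impI)
  fix e :: real assume "0 < e"
  \<comment> \<open>Each of the two variations gets half of the budget; \<open>K + 1\<close> in
    place of \<open>K\<close> keeps the divisor positive when \<open>K\<close> vanishes.\<close>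
  then have e: "0 < e / (2 * (K + 1))" using assms(3) by simp
  obtain d where d: "0 < d" "\<And>D. interval_system a b D \<Longrightarrow>
      variation_over (\<lambda>t. t) D < d \<Longrightarrow> variation_over f D < e / (2 * (K + 1))"
    using abs_cont_onD[OF assms(1) e] by auto
  obtain d' where d': "0 < d'" "\<And>D. interval_system a b D \<Longrightarrow>
      variation_over (\<lambda>t. t) D < d' \<Longrightarrow> variation_over g D < e / (2 * (K + 1))"
    using abs_cont_onD[OF assms(2) e] by auto
  have "variation_over h D < e"
    if D: "interval_system a b D" "variation_over (\<lambda>t. t) D < min d d'" for D
  proof -
    have "variation_over h D \<le> K * (variation_over f D + variation_over g D)"
      unfolding variation_over_def sum.distrib[symmetric] sum_distrib_left
      by (intro sum_mono assms(4)) (use interval_systemD[OF D(1)] in auto)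
    also have "\<dots> \<le> (K + 1) * (variation_over f D + variation_over g D)"
      by (simp add: mult_right_mono variation_over_nonneg add_nonneg_nonneg)
    also have "\<dots> < (K + 1) * (e / (2 * (K + 1)) + e / (2 * (K + 1)))"
      using d(2)[OF D(1)] d'(2)[OF D(1)] D(2) assms(3)
      by (intro mult_strict_left_mono add_strict_mono) auto
    also have "\<dots> = e" using assms(3) by (simp add: divide_simps)
    finally show ?thesis .
  qed
  then show "\<exists>d>0. \<forall>D. interval_system a b D \<longrightarrow> variation_over (\<lambda>t. t) D < d \<longrightarrow> variation_over h D < e"
    using d(1) d'(1) by (meson min_less_iff_conj)
qed

lemma abs_cont_on_const: "abs_cont_on a b (\<lambda>_. c)"
  unfolding abs_cont_on_iff by (simp add: variation_over_def)

lemma abs_cont_on_dominated: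
  assumes "abs_cont_on a b f" "0 \<le> K"
    and "\<And>u v. a \<le> u \<Longrightarrow> u \<le> v \<Longrightarrow> v \<le> b \<Longrightarrow> norm (g v - g u) \<le> K * norm (f v - f u)"
  shows "abs_cont_on a b g"
  by (rule abs_cont_on_dominated2[OF assms(1) abs_cont_on_const[where c = "0 :: real"] assms(2)])
    (simp add: assms(3))

lemma abs_cont_on_add:
  "abs_cont_on a b f \<Longrightarrow> abs_cont_on a b g \<Longrightarrow> abs_cont_on a b (\<lambda>t. f t + g t)"
  by (rule abs_cont_on_dominated2[of a b f g 1]) (auto simp: add_diff_add norm_triangle_ineq)

lemma abs_cont_on_diff:
  "abs_cont_on a b f \<Longrightarrow> abs_cont_on a b g \<Longrightarrow> abs_cont_on a b (\<lambda>t. f t - g t)"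
  using abs_cont_on_add[of a b f "\<lambda>t. - g t"]
    abs_cont_on_dominated[of a b g 1 "\<lambda>t. - g t"] by (simp add: norm_minus_commute)

lemma abs_cont_on_cong:
  assumes "abs_cont_on a b f" "\<And>t. a \<le> t \<Longrightarrow> t \<le> b \<Longrightarrow> f t = g t"
  shows "abs_cont_on a b g"
  by (rule abs_cont_on_dominated[OF assms(1), of 1]) (use assms(2) in auto)

lemma abs_cont_on_sum:
  assumes "\<And>i. i \<in> I \<Longrightarrow> abs_cont_on a b (f i)"
  shows "abs_cont_on a b (\<lambda>t. \<Sum>i\<in>I. f i t)"
proof (cases "finite I")
  case True
  then show ?thesis using assms
    by (induction I) (auto intro: abs_cont_on_const abs_cont_on_add)
qed (auto intro: abs_cont_on_const)

lemma abs_cont_on_bounded_linear: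
  assumes "bounded_linear L" "abs_cont_on a b f"
  shows "abs_cont_on a b (\<lambda>t. L (f t))"
proof -
  interpret bounded_linear L by fact
  obtain K where "0 \<le> K" "\<And>x. norm (L x) \<le> norm x * K"
    using nonneg_bounded by blast
  then show ?thesis
    by (intro abs_cont_on_dominated[OF assms(2)]) (auto simp: diff[symmetric] mult.commute)
qed

lemma abs_cont_on_clip:
  assumes "abs_cont_on c d f" and \<phi>: "clip_map \<phi>" and "a \<le> b" "c \<le> \<phi> a" "\<phi> b \<le> d"
  shows "abs_cont_on a b (f \<circ> \<phi>)"
  unfolding abs_cont_on_iff
proof (intro allI impI)
  fix e :: real assume "0 < e"
  obtain \<delta> where \<delta>: "0 < \<delta>" "\<And>D. interval_system c d D \<Longrightarrow>
      variation_over (\<lambda>t. t) D < \<delta> \<Longrightarrow> variation_over f D < e"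
    using abs_cont_onD[OF assms(1) \<open>0 < e\<close>] by auto
  have "variation_over (f \<circ> \<phi>) D < e"
    if D: "interval_system a b D" "variation_over (\<lambda>t. t) D < \<delta>" for D
  proof -
    have "variation_over ((\<lambda>t. t) \<circ> \<phi>) D \<le> variation_over (\<lambda>t. t) D"
      unfolding variation_over_def by (intro sum_mono) (simp add: clip_mapD(3)[OF \<phi>])
    moreover have "interval_system c d (map_prod \<phi> \<phi> ` D)"
      using interval_system_clip(1)[OF D(1) \<phi> \<open>a \<le> b\<close>] assms(4,5) interval_system_mono by blast
    ultimately show ?thesis
      using \<delta>(2) D(2) interval_system_clip(2)[OF D(1) \<phi> \<open>a \<le> b\<close>] by (metis le_less_trans)
  qed
  then show "\<exists>d>0. \<forall>D. interval_system a b D \<longrightarrow> variation_over (\<lambda>t. t) D < d \<longrightarrow>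
      variation_over (f \<circ> \<phi>) D < e"
    using \<delta>(1) by blast
qed

text \<open>The identity \<open>f t = f (min t m) + f (max m t) - f m\<close> writes
  \<open>f\<close> as a combination of clipped functions.\<close>

lemma abs_cont_on_join:
  assumes "abs_cont_on a m f" "abs_cont_on m b f" "a \<le> m" "m \<le> b"
  shows "abs_cont_on a b f"
proof -
  have "abs_cont_on a b (f \<circ> (\<lambda>t. min t m))" "abs_cont_on a b (f \<circ> (\<lambda>t. max m t))"
    using assms abs_cont_on_clip[OF assms(1) clip_map_min, of a b m]
      abs_cont_on_clip[OF assms(2) clip_map_max, of a b m] by (auto simp: min_def max_def)
  then have "abs_cont_on a b (\<lambda>t. (f \<circ> (\<lambda>t. min t m)) t + (f \<circ> (\<lambda>t. max m t)) t - f m)"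
    by (intro abs_cont_on_add abs_cont_on_diff abs_cont_on_const)
  then show ?thesis
    by (rule abs_cont_on_cong) (auto simp: min_def max_def)
qed

text \<open>Bisection takes the place of a covering argument: \<open>abs_cont_on_join\<close> is the
  transitivity that \<open>Bolzano\<close> asks for. In this way estimates valid in one chart or one
  small ball become statements on the whole interval.\<close>

lemma abs_cont_on_local:
  assumes "a \<le> b"
    and "\<And>t. a \<le> t \<Longrightarrow> t \<le> b \<Longrightarrow> \<exists>d>0. \<forall>u v. a \<le> u \<longrightarrow> u \<le> t \<longrightarrow> t \<le> v \<longrightarrow> v \<le> b \<longrightarrow>
           v - u < d \<longrightarrow> abs_cont_on u v f"
  shows "abs_cont_on a b f"
proof -
  have "a \<le> a \<longrightarrow> b \<le> b \<longrightarrow> abs_cont_on a b f"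
    using \<open>a \<le> b\<close>
  proof (induction rule: Bolzano[where P = "\<lambda>u v. a \<le> u \<longrightarrow> v \<le> b \<longrightarrow> abs_cont_on u v f"])
    case (trans u v w)
    then show ?case by (auto intro: abs_cont_on_join)
  next
    case (local t)
    then show ?case using assms(2)[of t] by meson
  qed
  then show ?thesis by simp
qed

lemma interval_system_singleton: "a \<le> u \<Longrightarrow> u \<le> v \<Longrightarrow> v \<le> b \<Longrightarrow> interval_system a b {(u, v)}"
  by (simp add: interval_system_def)

lemma abs_cont_on_imp_continuous_on:
  assumes "abs_cont_on a b f"
  shows "continuous_on {a..b} f"
  unfolding continuous_on_iff
proof (intro ballI allI impI)
  fix t e :: real assume t: "t \<in> {a..b}" "0 < e"
  obtain d where d: "0 < d" "\<And>D. interval_system a b D \<Longrightarrow>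
      variation_over (\<lambda>t. t) D < d \<Longrightarrow> variation_over f D < e"
    using abs_cont_onD[OF assms t(2)] by auto
  have "dist (f s) (f t) < e" if s: "s \<in> {a..b}" "dist s t < d" for s
    using d(2)[OF interval_system_singleton, of "min s t" "max s t"] s t(1)
    by (cases "s \<le> t") (auto simp: variation_over_def dist_norm min_def max_def norm_minus_commute)
  then show "\<exists>d>0. \<forall>s\<in>{a..b}. dist s t < d \<longrightarrow> dist (f s) (f t) < e"
    using d(1) by blast
qed

lemma abs_cont_on_bounded:
  assumes "abs_cont_on a b f"
  shows "\<exists>K>0. \<forall>t\<in>{a..b}. norm (f t) \<le> K"
proof -
  have "bounded (f ` {a..b})"
    by (intro compact_imp_bounded compact_continuous_image abs_cont_on_imp_continuous_on assms) simp
  then show ?thesis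
    unfolding bounded_pos by auto
qed

lemma abs_cont_on_bilinear:
  assumes "bounded_bilinear B" "abs_cont_on a b f" "abs_cont_on a b g"
  shows "abs_cont_on a b (\<lambda>t. B (f t) (g t))"
proof -
  interpret bounded_bilinear B by fact
  obtain K where K: "0 \<le> K" "\<And>x y. norm (B x y) \<le> norm x * norm y * K"
    using nonneg_bounded by blast
  obtain F where F: "0 < F" "\<And>t. a \<le> t \<Longrightarrow> t \<le> b \<Longrightarrow> norm (f t) \<le> F"
    using abs_cont_on_bounded[OF assms(2)] by auto
  obtain G where G: "0 < G" "\<And>t. a \<le> t \<Longrightarrow> t \<le> b \<Longrightarrow> norm (g t) \<le> G"
    using abs_cont_on_bounded[OF assms(3)] by auto
  show ?thesis
  proof (rule abs_cont_on_dominated2[OF assms(2,3), of "K * (F + G)"])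
    fix u v assume uv: "a \<le> u" "u \<le> v" "v \<le> b"
    have "norm (B (f v) (g v) - B (f u) (g u)) = norm (B (f v - f u) (g v) + B (f u) (g v - g u))"
      by (simp add: diff_left diff_right)
    also have "\<dots> \<le> norm (f v - f u) * norm (g v) * K + norm (f u) * norm (g v - g u) * K"
      by (rule order_trans[OF norm_triangle_ineq add_mono[OF K(2) K(2)]])
    also have "\<dots> \<le> norm (f v - f u) * (F + G) * K + (F + G) * norm (g v - g u) * K"
      using F(2)[of u] G(2)[of v] uv K(1) F(1) G(1)
      by (intro add_mono mult_right_mono mult_left_mono) auto
    finally show "norm (B (f v) (g v) - B (f u) (g u))
        \<le> K * (F + G) * (norm (f v - f u) + norm (g v - g u))"
      by (simp add: algebra_simps)
  qed (use K F G in auto)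
qed

lemmas abs_cont_on_inner = abs_cont_on_bilinear[OF bounded_bilinear_inner]
lemmas abs_cont_on_scaleR = abs_cont_on_bilinear[OF bounded_bilinear_scaleR]
lemmas abs_cont_on_mult = abs_cont_on_bilinear[OF bounded_bilinear_mult]

section \<open>Total variation and the fundamental theorem of calculus\<close>

text \<open>Interval systems may leave gaps, unlike partitions. Filling the gaps can only increase
  the sum, so the supremum is the classical total variation.\<close>

definition total_variation :: "(real \<Rightarrow> 'b::real_normed_vector) \<Rightarrow> real \<Rightarrow> real \<Rightarrow> real" where
  "total_variation f a b = (SUP D\<in>{D. interval_system a b D}. variation_over f D)"

lemma interval_system_empty: "interval_system a b {}"
  by (simp add: interval_system_def)

text \<open>An interval that contains \<open>m\<close> is cut there at the cost of one triangle
  inequality; clipping \<open>D\<close> from above and from below does this for all intervals at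
  once.\<close>

lemma interval_system_split:
  assumes "interval_system a b D" "a \<le> m" "m \<le> b"
  shows "\<exists>D1 D2. interval_system a m D1 \<and> interval_system m b D2 \<and>
    variation_over f D \<le> variation_over f D1 + variation_over f D2"
proof -
  have "a \<le> b" using assms by simp
  define D1 where "D1 = map_prod (\<lambda>t. min t m) (\<lambda>t. min t m) ` D"
  define D2 where "D2 = map_prod (\<lambda>t. max m t) (\<lambda>t. max m t) ` D"
  have "norm (f (snd p) - f (fst p)) \<le>
      norm (f (min (snd p) m) - f (min (fst p) m)) + norm (f (max m (snd p)) - f (max m (fst p)))"
    if "p \<in> D" for p
  proof -
    consider "snd p \<le> m" | "m \<le> fst p" | "fst p \<le> m" "m \<le> snd p" by linarith
    then show ?thesis
    proof cases
      case 3
      then show ?thesis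
        using norm_triangle_ineq[of "f m - f (fst p)" "f (snd p) - f m"] by simp
    qed (use interval_systemD(2)[OF assms(1) that] in \<open>simp_all\<close>)
  qed
  then have "variation_over f D \<le> variation_over (f \<circ> (\<lambda>t. min t m)) D + variation_over (f \<circ> (\<lambda>t. max m t)) D"
    unfolding variation_over_def comp_def sum.distrib[symmetric] by (intro sum_mono)
  moreover note interval_system_clip(1)[OF assms(1) clip_map_min[of m] \<open>a \<le> b\<close>]
    interval_system_clip(1)[OF assms(1) clip_map_max[of m] \<open>a \<le> b\<close>]
    interval_system_clip(2)[OF assms(1) clip_map_min[of m] \<open>a \<le> b\<close>, where f = f]
    interval_system_clip(2)[OF assms(1) clip_map_max[of m] \<open>a \<le> b\<close>, where f = f]
  ultimately have "interval_system a m D1 \<and> interval_system m b D2 \<and>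
      variation_over f D \<le> variation_over f D1 + variation_over f D2"
    using assms(2,3) by (simp add: D1_def D2_def min_absorb1 min_absorb2 max_absorb1 max_absorb2)
  then show ?thesis by blast
qed

text \<open>A system in an interval shorter than \<open>d\<close> has total length below
  \<open>d\<close>, hence variation below 1. Bisection adds up finitely many such bounds through
  \<open>interval_system_split\<close>.\<close>

lemma abs_cont_on_bounded_variation:
  assumes "abs_cont_on a b f" "a \<le> b"
  shows "\<exists>K. \<forall>D. interval_system a b D \<longrightarrow> variation_over f D \<le> K"
proof -
  obtain d where d: "0 < d" "\<And>D. interval_system a b D \<Longrightarrow>
      variation_over (\<lambda>t. t) D < d \<Longrightarrow> variation_over f D < 1"
    using abs_cont_onD[OF assms(1), of 1] by auto
  have "a \<le> a \<longrightarrow> b \<le> b \<longrightarrow> (\<exists>K. \<forall>D. interval_system a b D \<longrightarrow> variation_over f D \<le> K)"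
    using \<open>a \<le> b\<close>
  proof (induction rule: Bolzano[where P = "\<lambda>u v. a \<le> u \<longrightarrow> v \<le> b \<longrightarrow>
      (\<exists>K. \<forall>D. interval_system u v D \<longrightarrow> variation_over f D \<le> K)"])
    case (trans u v w)
    show ?case
    proof (intro impI)
      assume uw: "a \<le> u" "w \<le> b"
      have "a \<le> v" "v \<le> b" using uw trans(3,4) by linarith+
      then obtain K1 K2 where K: "\<And>D. interval_system u v D \<Longrightarrow> variation_over f D \<le> K1"
          "\<And>D. interval_system v w D \<Longrightarrow> variation_over f D \<le> K2"
        using trans(1,2) uw by blast
      have "variation_over f D \<le> K1 + K2" if D: "interval_system u w D" for D
      proof -
        obtain D1 D2 where "interval_system u v D1" "interval_system v w D2"
          "variation_over f D \<le> variation_over f D1 + variation_over f D2"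
          using interval_system_split[OF D trans(3,4), of f] by blast
        then show ?thesis using K(1)[of D1] K(2)[of D2] by linarith
      qed
      then show "\<exists>K. \<forall>D. interval_system u w D \<longrightarrow> variation_over f D \<le> K" by blast
    qed
  next
    case (local t)
    have "\<exists>K. \<forall>D. interval_system u v D \<longrightarrow> variation_over f D \<le> K"
      if uv: "u \<le> t" "t \<le> v" "v - u < d" "a \<le> u" "v \<le> b" for u v
    proof (intro exI allI impI)
      fix D assume D: "interval_system u v D"
      have "variation_over (\<lambda>t. t) D < d"
        using interval_system_length[OF D] uv by linarith
      then show "variation_over f D \<le> 1"
        using d(2)[OF interval_system_mono[OF D uv(4,5) subset_refl]] by linarith
    qed
    then show ?case using d(1) by blast
  qed
  then show ?thesis by simp
qed

lemma total_variation_upper: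
  assumes "abs_cont_on a b f" "a \<le> u" "u \<le> v" "v \<le> b" "interval_system u v D"
  shows "variation_over f D \<le> total_variation f u v"
proof -
  obtain K where K: "\<And>D. interval_system u v D \<Longrightarrow> variation_over f D \<le> K"
    using abs_cont_on_bounded_variation[OF abs_cont_on_subinterval[OF assms(1,2,4)] assms(3)] by blast
  show ?thesis
    unfolding total_variation_def
    by (rule cSUP_upper) (use assms(5) K in \<open>auto intro!: bdd_aboveI2\<close>)
qed

lemma total_variation_least:
  assumes "\<And>D. interval_system a b D \<Longrightarrow> variation_over f D \<le> K"
  shows "total_variation f a b \<le> K"
  unfolding total_variation_def
  by (rule cSUP_least) (use assms interval_system_empty in auto)

lemma total_variation_superadditive:
  assumes f: "abs_cont_on a b f" and uv: "a \<le> u" "u \<le> v" "v \<le> b"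
  shows "total_variation f a u + norm (f v - f u) \<le> total_variation f a v"
\<comment> \<open>For \<open>u = v\<close> the pair could already belong to \<open>D\<close>, and
  inserting it would then not create a new summand.\<close>
proof (cases "u = v")
  case False
  have "variation_over f D \<le> total_variation f a v - norm (f v - f u)"
    if D: "interval_system a u D" for D
  proof -
    have notin: "(u, v) \<notin> D"
      using interval_systemD(3)[OF D, of "(u, v)"] False uv(2) by auto
    have "{u<..<v} \<inter> {fst p<..<snd p} = {}" if "p \<in> D" for p
      using interval_systemD(3)[OF D that] by auto
    then have "interval_system a v (insert (u, v) D)"
      using D uv unfolding interval_system_def pairwise_insert
      by (fastforce simp: split_beta Int_commute)
    then have "variation_over f (insert (u, v) D) \<le> total_variation f a v"
      using total_variation_upper[OF f] uv by simp
    then show ?thesis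
      using notin interval_system_finite[OF D] by (simp add: variation_over_def)
  qed
  then have "total_variation f a u \<le> total_variation f a v - norm (f v - f u)"
    by (rule total_variation_least)
  then show ?thesis by simp
qed simp

lemma total_variation_subadditive:
  assumes f: "abs_cont_on a b f" and uv: "a \<le> u" "u \<le> v" "v \<le> b"
  shows "total_variation f a v \<le> total_variation f a u + total_variation f u v"
proof (rule total_variation_least)
  fix D assume "interval_system a v D"
  then obtain D1 D2 where "interval_system a u D1" "interval_system u v D2"
    "variation_over f D \<le> variation_over f D1 + variation_over f D2"
    using interval_system_split[of a v D u f] uv by blast
  then show "variation_over f D \<le> total_variation f a u + total_variation f u v"
    using total_variation_upper[OF f, of a u D1] total_variation_upper[OF f, of u v D2] uv by linarith
qed

text \<open>Discarding degenerate intervals costs no variation. Nondegeneracy is what makes the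
  systems \<open>E p\<close> in \<open>interval_system_refine\<close> pairwise disjoint as
  sets.\<close>

lemma total_variation_approx:
  assumes "0 < \<eta>"
  shows "\<exists>D. interval_system u v D \<and> (\<forall>p\<in>D. fst p < snd p) \<and>
    total_variation f u v - \<eta> < variation_over f D"
proof (rule ccontr)
  assume contra: "\<not> ?thesis"
  have "total_variation f u v \<le> total_variation f u v - \<eta>"
  proof (rule total_variation_least)
    fix D assume D: "interval_system u v D"
    define D' where "D' = {p \<in> D. fst p < snd p}"
    have D': "interval_system u v D'"
      using interval_system_mono[OF D order_refl order_refl] by (auto simp: D'_def)
    have degenerate: "fst p = snd p" if "p \<in> D - D'" for p
      using interval_systemD(2)[OF D, of p] that by (auto simp: D'_def)
    have "variation_over f D = variation_over f D'"
      unfolding variation_over_def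
    proof (rule sum.mono_neutral_right)
      show "\<forall>p\<in>D - D'. norm (f (snd p) - f (fst p)) = 0"
        using degenerate by simp
    qed (use interval_system_finite[OF D] in \<open>auto simp: D'_def\<close>)
    moreover have "variation_over f D' \<le> total_variation f u v - \<eta>"
      using contra D' by (auto simp: D'_def not_less)
    ultimately show "variation_over f D \<le> total_variation f u v - \<eta>" by simp
  qed
  then show False using assms by simp
qed

lemma interval_system_refine:
  assumes D: "interval_system a b D"
    and E: "\<And>p. p \<in> D \<Longrightarrow> interval_system (fst p) (snd p) (E p)"
      "\<And>p r. p \<in> D \<Longrightarrow> r \<in> E p \<Longrightarrow> fst r < snd r"
  shows "interval_system a b (\<Union>p\<in>D. E p)"
    and "variation_over f (\<Union>p\<in>D. E p) = (\<Sum>p\<in>D. variation_over f (E p))"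
proof -
  have sub: "{fst r<..<snd r} \<subseteq> {fst p<..<snd p}" if "p \<in> D" "r \<in> E p" for p r
    using interval_systemD(1,3)[OF E(1)[OF that(1)] that(2)] by auto
  have disj: "{fst r<..<snd r} \<inter> {fst r'<..<snd r'} = {}"
    if "p \<in> D" "p' \<in> D" "p \<noteq> p'" "r \<in> E p" "r' \<in> E p'" for p p' r r'
    using sub[OF that(1,4)] sub[OF that(2,5)] interval_system_disjoint[OF D that(1-3)] by blast
  have inter: "E p \<inter> E p' = {}" if "p \<in> D" "p' \<in> D" "p \<noteq> p'" for p p'
  proof (rule ccontr)
    assume "E p \<inter> E p' \<noteq> {}"
    then obtain r where r: "r \<in> E p" "r \<in> E p'" by blast
    then show False using disj[OF that r] E(2)[OF that(1) r(1)] by simp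
  qed
  show "interval_system a b (\<Union>p\<in>D. E p)"
    unfolding interval_system_def
  proof (intro conjI ballI pairwiseI)
    show "finite (\<Union>p\<in>D. E p)"
      using interval_system_finite[OF D] interval_system_finite[OF E(1)] by blast
  next
    fix r assume "r \<in> (\<Union>p\<in>D. E p)"
    then obtain p where p: "p \<in> D" "r \<in> E p" by blast
    then show "case r of (u, v) \<Rightarrow> a \<le> u \<and> u \<le> v \<and> v \<le> b"
      using interval_systemD[OF D p(1)] interval_systemD[OF E(1)[OF p(1)] p(2)]
      by (simp add: split_beta)
  next
    fix r r' assume r: "r \<in> (\<Union>p\<in>D. E p)" "r' \<in> (\<Union>p\<in>D. E p)" "r \<noteq> r'"
    obtain p where p: "p \<in> D" "r \<in> E p" using r(1) by (rule UN_E)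
    obtain p' where p': "p' \<in> D" "r' \<in> E p'" using r(2) by (rule UN_E)
    have "{fst r<..<snd r} \<inter> {fst r'<..<snd r'} = {}"
    proof (cases "p = p'")
      case True
      then show ?thesis
        using interval_system_disjoint[OF E(1)[OF p(1)] p(2) _ r(3)] p'(2) by simp
    next
      case False
      then show ?thesis using disj[OF p(1) p'(1) False p(2) p'(2)] by simp
    qed
    then show "(case r of (u, v) \<Rightarrow> \<lambda>(u', v'). {u<..<v} \<inter> {u'<..<v'} = {}) r'"
      by (simp only: split_beta)
  qed
  show "variation_over f (\<Union>p\<in>D. E p) = (\<Sum>p\<in>D. variation_over f (E p))"
    unfolding variation_over_def
    using interval_system_finite[OF D] interval_system_finite[OF E(1)] inter
    by (intro sum.UNION_disjoint) auto
qed

text \<open>Inside every interval of \<open>D\<close> a nearly optimal system for \<open>f\<close>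
  is chosen. Together these form a system no longer than \<open>D\<close>, and its variation bounds
  the increments of the total variation up to a small error per interval.\<close>

lemma abs_cont_on_total_variation:
  assumes f: "abs_cont_on a b f"
  shows "abs_cont_on a b (total_variation f a)"
  unfolding abs_cont_on_iff
proof (intro allI impI)
  fix e :: real assume e: "0 < e"
  obtain d where d: "0 < d" "\<And>D. interval_system a b D \<Longrightarrow>
      variation_over (\<lambda>t. t) D < d \<Longrightarrow> variation_over f D < e / 2"
    using abs_cont_onD[OF f, of "e / 2"] e by auto
  have "variation_over (total_variation f a) D < e"
    if D: "interval_system a b D" "variation_over (\<lambda>t. t) D < d" for D
  proof -
    note fin = interval_system_finite[OF D(1)]
    \<comment> \<open>At most \<open>card D\<close> errors of this size occur, and they sum to at
      most \<open>e / 2\<close>; the added 1 covers the empty system.\<close>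
    define \<eta> where "\<eta> = e / (2 * (real (card D) + 1))"
    have "0 < \<eta>" using e by (simp add: \<eta>_def add_pos_nonneg)
    have "\<exists>E. interval_system (fst p) (snd p) E \<and> (\<forall>r\<in>E. fst r < snd r) \<and>
        total_variation f (fst p) (snd p) - \<eta> < variation_over f E" for p
      using total_variation_approx[OF \<open>0 < \<eta>\<close>] by blast
    then obtain E where E: "\<And>p. interval_system (fst p) (snd p) (E p)"
        "\<And>p r. p \<in> D \<Longrightarrow> r \<in> E p \<Longrightarrow> fst r < snd r"
        "\<And>p. total_variation f (fst p) (snd p) - \<eta> < variation_over f (E p)"
      by metis
    have refine: "interval_system a b (\<Union>p\<in>D. E p)"
        "variation_over f (\<Union>p\<in>D. E p) = (\<Sum>p\<in>D. variation_over f (E p))"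
        "variation_over (\<lambda>t. t) (\<Union>p\<in>D. E p) = (\<Sum>p\<in>D. variation_over (\<lambda>t. t) (E p))"
      by (rule interval_system_refine[OF D(1)]; use E in blast)+
    have "variation_over (\<lambda>t. t) (\<Union>p\<in>D. E p) \<le> variation_over (\<lambda>t. t) D"
      unfolding refine(3) unfolding variation_over_def[of "\<lambda>t. t" D]
    proof (rule sum_mono)
      fix p assume "p \<in> D"
      then show "variation_over (\<lambda>t. t) (E p) \<le> norm (snd p - fst p)"
        using interval_system_length[OF E(1)[of p]] interval_systemD(2)[OF D(1)] by fastforce
    qed
    then have less: "(\<Sum>p\<in>D. variation_over f (E p)) < e / 2"
      using d(2)[OF refine(1)] D(2) refine(2) by simp
    have "variation_over (total_variation f a) D \<le> (\<Sum>p\<in>D. variation_over f (E p) + \<eta>)"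
      unfolding variation_over_def[of _ D]
    proof (rule sum_mono)
      fix p assume p: "p \<in> D"
      note b = interval_systemD[OF D(1) p]
      have "0 \<le> total_variation f a (snd p) - total_variation f a (fst p)"
        using total_variation_superadditive[OF f b] norm_ge_zero[of "f (snd p) - f (fst p)"] by linarith
      then show "norm (total_variation f a (snd p) - total_variation f a (fst p)) \<le> variation_over f (E p) + \<eta>"
        using total_variation_subadditive[OF f b] E(3)[of p] by simp
    qed
    also have "\<dots> = (\<Sum>p\<in>D. variation_over f (E p)) + real (card D) * \<eta>"
      by (simp add: sum.distrib)
    also have "\<dots> < e / 2 + e / 2"
    proof (rule add_less_le_mono[OF less])
      have "real (card D) * \<eta> \<le> (real (card D) + 1) * \<eta>" using \<open>0 < \<eta>\<close> by simp
      also have "\<dots> = e / 2" by (simp add: \<eta>_def field_simps add_eq_0_iff)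
      finally show "real (card D) * \<eta> \<le> e / 2" .
    qed
    finally show ?thesis by simp
  qed
  then show "\<exists>d>0. \<forall>D. interval_system a b D \<longrightarrow> variation_over (\<lambda>t. t) D < d \<longrightarrow>
      variation_over (total_variation f a) D < e"
    using d(1) by blast
qed

text \<open>Here absolute continuity of a function becomes absolute continuity of a measure. The set
  \<open>N\<close> is covered by nonoverlapping closed intervals of total length at most
  \<open>d / 2\<close>, and every finite subfamily is an interval system, over which
  \<open>G\<close> varies by less than \<open>e\<close>. Boundedness of \<open>N\<close> provides
  the box in which the cover lives.\<close>

lemma monotone_abs_cont_on_null:
  assumes AC: "\<And>u v. u \<le> v \<Longrightarrow> abs_cont_on u v G" and mono: "\<And>x y. x \<le> y \<Longrightarrow> G x \<le> G y"
    and cont: "continuous_on UNIV G"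
    and N: "N \<in> null_sets lborel" "N \<subseteq> {-n..n}" "0 \<le> n"
  shows "N \<in> null_sets (interval_measure G)"
proof -
  let ?\<mu> = "interval_measure G"
  have "emeasure ?\<mu> N \<le> 0 + ennreal e" if e: "0 < e" for e
  proof -
    obtain d where d: "0 < d" "\<And>D. interval_system (-n) n D \<Longrightarrow>
        variation_over (\<lambda>t. t) D < d \<Longrightarrow> variation_over G D < e"
      using abs_cont_onD[OF AC e, of "-n" n] N(3) by auto
    have N': "N \<in> lmeasurable" "measure lebesgue N = 0"
      using null_sets_completionI[OF N(1)] by (auto intro: fmeasurableI_null_sets measure_eq_0_null_sets)
    obtain \<D> where \<D>: "countable \<D>"
        "\<And>K. K \<in> \<D> \<Longrightarrow> K \<subseteq> cbox (-n) n \<and> K \<noteq> {} \<and> (\<exists>c d. K = cbox c d)"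
        "pairwise (\<lambda>A B. interior A \<inter> interior B = {}) \<D>"
        "N \<subseteq> \<Union>\<D>" "\<Union>\<D> \<in> lmeasurable" "measure lebesgue (\<Union>\<D>) \<le> measure lebesgue N + d / 2"
      by (rule measurable_outer_intervals_bounded[OF N'(1), of "-n" n "d / 2"])
         (use N(2) d(1) in auto)
    have K: "K = {Inf K..Sup K}" "Inf K \<le> Sup K" "-n \<le> Inf K" "Sup K \<le> n" if "K \<in> \<D>" for K
      using \<D>(2)[OF that] by auto
    have meas: "K \<in> sets ?\<mu>" if "K \<in> \<D>" for K
      using \<D>(2)[OF that] by auto
    have le: "(\<Sum>K\<in>\<F>. emeasure ?\<mu> K) \<le> ennreal e" if \<F>: "finite \<F>" "\<F> \<subseteq> \<D>" for \<F>
    proof -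
      define D where "D = (\<lambda>K. (Inf K, Sup K)) ` \<F>"
      have inj: "inj_on (\<lambda>K. (Inf K, Sup K)) \<F>"
      proof (rule inj_onI)
        fix K K' assume "K \<in> \<F>" "K' \<in> \<F>" "(Inf K, Sup K) = (Inf K', Sup K')"
        then show "K = K'" using K(1)[of K] K(1)[of K'] \<F>(2) by auto
      qed
      have D: "interval_system (-n) n D"
        unfolding interval_system_def
      proof (intro conjI pairwiseI)
        show "finite D" using \<F>(1) by (simp add: D_def)
        show "\<forall>(u, v)\<in>D. -n \<le> u \<and> u \<le> v \<and> v \<le> n"
          using K(2-4) \<F>(2) by (auto simp: D_def)
        fix p p' assume "p \<in> D" "p' \<in> D" "p \<noteq> p'"
        then obtain L L' where L: "L \<in> \<F>" "p = (Inf L, Sup L)" "L' \<in> \<F>" "p' = (Inf L', Sup L')" "L \<noteq> L'"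
          by (auto simp: D_def)
        have "interior L \<inter> interior L' = {}"
          using \<D>(3) L \<F>(2) unfolding pairwise_def by blast
        moreover have "interior L = {Inf L<..<Sup L}" "interior L' = {Inf L'<..<Sup L'}"
          using K(1)[of L] K(1)[of L'] L \<F>(2) interior_atLeastAtMost_real by (metis subsetD)+
        ultimately show "(case p of (u, v) \<Rightarrow> \<lambda>(u', v'). {u<..<v} \<inter> {u'<..<v'} = {}) p'"
          using L by simp
      qed
      have "{fst p<..<snd p} \<subseteq> \<Union>\<D>" if p: "p \<in> D" for p
      proof -
        obtain L where L: "L \<in> \<D>" "p = (Inf L, Sup L)" using p \<F>(2) by (auto simp: D_def)
        then have "{fst p<..<snd p} \<subseteq> L" by (subst K(1)[OF L(1)]) auto
        then show ?thesis using L(1) by blast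
      qed
      then have "variation_over (\<lambda>t. t) D \<le> d / 2"
        using interval_system_length_le[OF D \<D>(5)] \<D>(6) N'(2) by simp
      then have less: "variation_over G D < e" using d D by simp
      have "(\<Sum>K\<in>\<F>. emeasure ?\<mu> K) = (\<Sum>K\<in>\<F>. ennreal (norm (G (Sup K) - G (Inf K))))"
      proof (rule sum.cong[OF refl])
        fix L assume "L \<in> \<F>"
        then have L: "L \<in> \<D>" using \<F>(2) by blast
        have "emeasure ?\<mu> {Inf L..Sup L} = ennreal (G (Sup L) - G (Inf L))"
          by (rule emeasure_interval_measure_Icc[OF K(2)[OF L] mono cont])
        then show "emeasure ?\<mu> L = ennreal (norm (G (Sup L) - G (Inf L)))"
          using K(1)[OF L] mono[OF K(2)[OF L]] by simp
      qed
      also have "\<dots> = ennreal (variation_over G D)"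
        unfolding variation_over_def D_def by (simp add: sum.reindex[OF inj] sum_ennreal)
      also have "\<dots> \<le> ennreal e" using less by (simp add: ennreal_leI)
      finally show ?thesis .
    qed
    show ?thesis
    proof (cases "\<D> = {}")
      case True
      then show ?thesis using \<D>(4) by simp
    next
      case False
      \<comment> \<open>The enumeration \<open>from_nat_into\<close> repeats intervals when the
        family is finite, which is harmless for unions. Continuity of the measure from below then
        passes from finite subfamilies to the whole cover.\<close>
      define A where "A k = \<Union>(from_nat_into \<D> ` {..k})" for k :: nat
      have sub: "from_nat_into \<D> ` {..k} \<subseteq> \<D>" for k
        using from_nat_into[OF False] by auto
      have A: "range A \<subseteq> sets ?\<mu>" "incseq A"
        using sub meas by (auto simp: A_def incseq_def intro!: sets.finite_Union) fastforce
      have "N \<subseteq> (\<Union>k. A k)"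
      proof
        fix t assume "t \<in> N"
        then obtain L where "L \<in> \<D>" "t \<in> L" using \<D>(4) by blast
        then obtain k where "L = from_nat_into \<D> k"
          using from_nat_into_surj[OF \<D>(1)] by metis
        then show "t \<in> (\<Union>k. A k)" using \<open>t \<in> L\<close> by (auto simp: A_def)
      qed
      then have "emeasure ?\<mu> N \<le> emeasure ?\<mu> (\<Union>k. A k)"
        using A by (intro emeasure_mono) auto
      also have "\<dots> = (SUP k. emeasure ?\<mu> (A k))"
        using SUP_emeasure_incseq[OF A] by simp
      also have "\<dots> \<le> ennreal e"
      proof (rule SUP_least)
        fix k
        have "emeasure ?\<mu> (A k) \<le> (\<Sum>K\<in>from_nat_into \<D> ` {..k}. emeasure ?\<mu> K)"
          unfolding A_def
          using emeasure_subadditive_finite[of "from_nat_into \<D> ` {..k}" "\<lambda>K. K" ?\<mu>] sub[of k] meas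
          by auto
        also have "\<dots> \<le> ennreal e" using le[OF _ sub] by simp
        finally show "emeasure ?\<mu> (A k) \<le> ennreal e" .
      qed
      finally show ?thesis by simp
    qed
  qed
  then have "emeasure ?\<mu> N \<le> 0" by (rule ennreal_le_epsilon)
  then show ?thesis using N(1) by (auto simp: null_sets_def)
qed

text \<open>For \<open>a \<le> b\<close>, some \<open>g\<close> with this property exists exactly
  when \<open>f\<close> is absolutely continuous; the two directions are
  \<open>abs_cont_on_imp_indefinite_integral\<close> and
  \<open>indefinite_integral_imp_abs_cont_on\<close>.\<close>

definition indefinite_integral_on ::
    "real \<Rightarrow> real \<Rightarrow> (real \<Rightarrow> 'b::euclidean_space) \<Rightarrow> (real \<Rightarrow> 'b) \<Rightarrow> bool" where
  "indefinite_integral_on a b f g \<longleftrightarrow> g absolutely_integrable_on {a..b} \<and>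
     (\<forall>s t. a \<le> s \<longrightarrow> s \<le> t \<longrightarrow> t \<le> b \<longrightarrow> (g has_integral (f t - f s)) {s..t})"

text \<open>The integrand is the Radon-Nikodym density of the Stieltjes measure of \<open>F\<close>
  with respect to Lebesgue measure. Freezing \<open>F\<close> outside \<open>{a..b}\<close> gives
  the globally monotone and continuous \<open>G\<close> that \<open>interval_measure\<close> works
  with.\<close>

lemma monotone_abs_cont_on_imp_indefinite_integral:
  fixes F :: "real \<Rightarrow> real"
  assumes F: "abs_cont_on a b F" and "a \<le> b"
    and mono: "\<And>s t. a \<le> s \<Longrightarrow> s \<le> t \<Longrightarrow> t \<le> b \<Longrightarrow> F s \<le> F t"
  shows "\<exists>g. indefinite_integral_on a b F g"
proof -
  define G where "G t = F (min (max a t) b)" for t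
  let ?\<mu> = "interval_measure G"
  have Gmono: "G s \<le> G t" if "s \<le> t" for s t
    unfolding G_def using that \<open>a \<le> b\<close> by (intro mono) auto
  have Gcont: "continuous_on UNIV G"
    unfolding G_def
    by (rule continuous_on_compose2[OF abs_cont_on_imp_continuous_on[OF F]])
       (use \<open>a \<le> b\<close> in \<open>auto intro!: continuous_intros\<close>)
  have GAC: "abs_cont_on u v G" if "u \<le> v" for u v
  proof -
    have "abs_cont_on a (max a v) (F \<circ> (\<lambda>t. min t b))"
      by (rule abs_cont_on_clip[OF F clip_map_min]) (use \<open>a \<le> b\<close> in auto)
    then have "abs_cont_on u v ((F \<circ> (\<lambda>t. min t b)) \<circ> (\<lambda>t. max a t))"
      by (rule abs_cont_on_clip[OF _ clip_map_max]) (use that in auto)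
    then show ?thesis by (simp add: G_def[abs_def] comp_def)
  qed
  have "N \<in> null_sets ?\<mu>" if N: "N \<in> null_sets lborel" for N
  proof -
    have "N \<inter> {- real n..real n} \<in> null_sets lborel" for n
      using N by (intro null_set_Int2) auto
    then have "(\<Union>n. N \<inter> {- real n..real n}) \<in> null_sets ?\<mu>"
      by (intro null_sets_UN monotone_abs_cont_on_null[OF GAC Gmono Gcont, where n = "real _"]) auto
    moreover have "t \<in> (\<Union>n. {- real n..real n})" for t
    proof -
      obtain n where "\<bar>t\<bar> \<le> real n" using real_arch_simple by blast
      then have "t \<in> {- real n..real n}" by auto
      then show ?thesis by blast
    qed
    then have "N = (\<Union>n. N \<inter> {- real n..real n})" by blast
    ultimately show ?thesis by simp
  qed
  then have "absolutely_continuous lborel ?\<mu>"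
    unfolding absolutely_continuous_def by blast
  from sigma_finite_measure.Radon_Nikodym[OF sigma_finite_lborel this]
  obtain f where f[measurable]: "f \<in> borel_measurable borel" and dens: "density lborel f = ?\<mu>"
    by auto
  have int: "(\<integral>\<^sup>+t. f t * indicator {u..v} t \<partial>lborel) = ennreal (F v - F u)"
    if "a \<le> u" "u \<le> v" "v \<le> b" for u v
  proof -
    have "(\<integral>\<^sup>+t. f t * indicator {u..v} t \<partial>lborel) = emeasure ?\<mu> {u..v}"
      unfolding dens[symmetric] by (rule emeasure_density[symmetric]) auto
    also have "\<dots> = ennreal (G v - G u)"
      by (rule emeasure_interval_measure_Icc[OF that(2) Gmono Gcont])
    finally show ?thesis using that by (simp add: G_def min_def max_def)
  qed
  \<comment> \<open>The density takes extended real values. Its integral over \<open>{a..b}\<close>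
    is finite, so \<open>enn2real\<close> alters it there only on a null set.\<close>
  define g where "g t = enn2real (f t)" for t
  have g[measurable]: "g \<in> borel_measurable borel" unfolding g_def[abs_def] by measurable
  have "AE t in lborel. f t * indicator {a..b} t \<noteq> \<infinity>"
    using int[of a b] \<open>a \<le> b\<close> by (intro nn_integral_PInf_AE) auto
  then have fin: "AE t in lborel. t \<in> {a..b} \<longrightarrow> f t = ennreal (g t)"
    by (rule AE_mp) (auto intro!: AE_I2 simp: g_def indicator_def less_top split: if_splits)
  have has: "(g has_integral (F v - F u)) {u..v}" if uv: "a \<le> u" "u \<le> v" "v \<le> b" for u v
  proof -
    have "(\<integral>\<^sup>+t. ennreal (indicator {u..v} t * g t) \<partial>lborel) = (\<integral>\<^sup>+t. f t * indicator {u..v} t \<partial>lborel)"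
    proof (rule nn_integral_cong_AE)
      show "AE t in lborel. ennreal (indicator {u..v} t * g t) = f t * indicator {u..v} t"
        using fin by (rule AE_mp) (use uv in \<open>auto intro!: AE_I2 simp: indicator_def\<close>)
    qed
    then have "((\<lambda>t. indicator {u..v} t * g t) has_integral (F v - F u)) UNIV"
      by - (rule nn_integral_has_integral, use int[OF uv] mono[OF uv] in \<open>auto simp: g_def indicator_def\<close>)
    then have "((\<lambda>t. if t \<in> {u..v} then g t else 0) has_integral (F v - F u)) UNIV"
      by (rule back_subst[of "\<lambda>h. (h has_integral (F v - F u)) UNIV"]) (auto simp: indicator_def)
    then show ?thesis by (simp only: has_integral_restrict_UNIV)
  qed
  have "g absolutely_integrable_on {a..b}"
    using has[of a b] \<open>a \<le> b\<close>
    by (intro nonnegative_absolutely_integrable_1) (auto simp: g_def has_integral_integrable)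
  then show ?thesis unfolding indefinite_integral_on_def using has by blast
qed

text \<open>Jordan decomposition: \<open>f\<close> is the difference of the monotone functions
  \<open>?V\<close> and \<open>?V - f\<close>.\<close>

lemma abs_cont_on_imp_indefinite_integral_real:
  fixes f :: "real \<Rightarrow> real"
  assumes f: "abs_cont_on a b f" and "a \<le> b"
  shows "\<exists>g. indefinite_integral_on a b f g"
proof -
  let ?V = "total_variation f a"
  note V = abs_cont_on_total_variation[OF f]
  have super: "?V s + \<bar>f t - f s\<bar> \<le> ?V t" if "a \<le> s" "s \<le> t" "t \<le> b" for s t
    using total_variation_superadditive[OF f that] by simp
  obtain g1 where g1: "indefinite_integral_on a b ?V g1"
  proof -
    have "?V s \<le> ?V t" if "a \<le> s" "s \<le> t" "t \<le> b" for s t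
      using super[OF that] by linarith
    then show ?thesis
      using that monotone_abs_cont_on_imp_indefinite_integral[OF V \<open>a \<le> b\<close>] by blast
  qed
  obtain g2 where g2: "indefinite_integral_on a b (\<lambda>t. ?V t - f t) g2"
  proof -
    have "?V s - f s \<le> ?V t - f t" if "a \<le> s" "s \<le> t" "t \<le> b" for s t
      using super[OF that] by linarith
    then show ?thesis
      using that monotone_abs_cont_on_imp_indefinite_integral[OF abs_cont_on_diff[OF V f] \<open>a \<le> b\<close>] by blast
  qed
  have "indefinite_integral_on a b f (\<lambda>t. g1 t - g2 t)"
    unfolding indefinite_integral_on_def
  proof (intro conjI allI impI)
    show "(\<lambda>t. g1 t - g2 t) absolutely_integrable_on {a..b}"
      using g1 g2 unfolding indefinite_integral_on_def by (intro set_integral_diff) auto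
    fix s t assume "a \<le> s" "s \<le> t" "t \<le> b"
    then have "(g1 has_integral (?V t - ?V s)) {s..t}" "(g2 has_integral (?V t - f t - (?V s - f s))) {s..t}"
      using g1 g2 unfolding indefinite_integral_on_def by blast+
    from has_integral_diff[OF this] show "((\<lambda>t. g1 t - g2 t) has_integral (f t - f s)) {s..t}"
      by simp
  qed
  then show ?thesis by blast
qed

lemma abs_cont_on_imp_indefinite_integral:
  fixes f :: "real \<Rightarrow> 'b::euclidean_space"
  assumes f: "abs_cont_on a b f" and "a \<le> b"
  shows "\<exists>g. indefinite_integral_on a b f g"
proof -
  have "\<exists>g. indefinite_integral_on a b (\<lambda>t. f t \<bullet> i) g" for i
    by (rule abs_cont_on_imp_indefinite_integral_real
        [OF abs_cont_on_bounded_linear[OF bounded_linear_inner_left f] \<open>a \<le> b\<close>])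
  then obtain g where g: "\<And>i. indefinite_integral_on a b (\<lambda>t. f t \<bullet> i) (g i)" by metis
  have "indefinite_integral_on a b f (\<lambda>t. \<Sum>i\<in>Basis. g i t *\<^sub>R i)"
    unfolding indefinite_integral_on_def
  proof (intro conjI allI impI)
    show "(\<lambda>t. \<Sum>i\<in>Basis. g i t *\<^sub>R i) absolutely_integrable_on {a..b}"
      using g unfolding indefinite_integral_on_def
      by (intro absolutely_integrable_sum absolutely_integrable_scaleR_right) auto
    fix s t assume st: "a \<le> s" "s \<le> t" "t \<le> b"
    have "((\<lambda>t. \<Sum>i\<in>Basis. g i t *\<^sub>R i) has_integral (\<Sum>i\<in>Basis. (f t \<bullet> i - f s \<bullet> i) *\<^sub>R i)) {s..t}"
      using g st unfolding indefinite_integral_on_def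
      by (intro has_integral_sum has_integral_scaleR_left) auto
    then show "((\<lambda>t. \<Sum>i\<in>Basis. g i t *\<^sub>R i) has_integral (f t - f s)) {s..t}"
      by (simp add: inner_diff_left[symmetric] euclidean_representation)
  qed
  then show ?thesis by blast
qed

text \<open>This is Lebesgue differentiation. The averaging theorem speaks of boxes that start at
  \<open>t\<close>, hence yields right derivatives; applied to the reflected function
  \<open>\<lambda>t. h (- t)\<close> it yields left derivatives as well.\<close>

lemma indefinite_integral_has_vector_derivative:
  fixes f :: "real \<Rightarrow> 'b::euclidean_space"
  assumes "indefinite_integral_on a b f g"
  shows "\<exists>N. negligible N \<and> (\<forall>t\<in>{a<..<b} - N. (f has_vector_derivative g t) (at t))"
proof -
  define h where "h t = (if t \<in> {a..b} then g t else 0)" for t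
  have "g absolutely_integrable_on {a..b}" and
    diff: "\<And>s t. a \<le> s \<Longrightarrow> s \<le> t \<Longrightarrow> t \<le> b \<Longrightarrow> (g has_integral (f t - f s)) {s..t}"
    using assms by (auto simp: indefinite_integral_on_def)
  then have "h integrable_on UNIV"
    unfolding h_def integrable_restrict_UNIV by (simp add: absolutely_integrable_on_def)
  then have int: "h integrable_on cbox u v" for u v
    using integrable_on_subcbox[of h UNIV u v] by simp
  then have int': "(\<lambda>t. h (- t)) integrable_on cbox u v" for u v
    using integrable_reflect[of h "- u" "- v"] int by simp
  have h: "integral {s..t} h = f t - f s" if "a \<le> s" "s \<le> t" "t \<le> b" for s t
  proof -
    have "integral {s..t} h = integral {s..t} g"
      using that by (intro integral_cong) (auto simp: h_def)
    then show ?thesis using diff[OF that] by (simp add: integral_unique)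
  qed
  obtain N1 where N1: "negligible N1" "\<And>t e. t \<notin> N1 \<Longrightarrow> 0 < e \<Longrightarrow>
      \<exists>d>0. \<forall>k. 0 < k \<and> k < d \<longrightarrow> norm (integral (cbox t (t + k *\<^sub>R One)) h /\<^sub>R k ^ DIM(real) - h t) < e"
    using integrable_ccontinuous_explicit[of h] int by metis
  obtain N2 where N2: "negligible N2" "\<And>t e. t \<notin> N2 \<Longrightarrow> 0 < e \<Longrightarrow>
      \<exists>d>0. \<forall>k. 0 < k \<and> k < d \<longrightarrow> norm (integral (cbox t (t + k *\<^sub>R One)) (\<lambda>t. h (- t)) /\<^sub>R k ^ DIM(real) - h (- t)) < e"
    using integrable_ccontinuous_explicit[of "\<lambda>t. h (- t)"] int' by metis
  have "negligible (uminus ` N2)"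
    using N2(1) by (intro negligible_differentiable_image_negligible)
      (auto intro!: differentiable_on_minus differentiable_on_ident)
  moreover have "(f has_vector_derivative g t) (at t)" if t: "t \<in> {a<..<b} - (N1 \<union> uminus ` N2)" for t
    unfolding has_vector_derivative_def has_derivative_at_alt
  proof (intro conjI allI impI bounded_linear_scaleR_left)
    fix e :: real assume e: "0 < e"
    have "- t \<notin> N2" using t by (metis DiffD2 UnCI image_eqI minus_minus)
    obtain d1 where d1: "0 < d1" "\<And>k. 0 < k \<Longrightarrow> k < d1 \<Longrightarrow> norm (integral {t..t + k} h /\<^sub>R k - h t) < e"
      using N1(2)[of t e] t e by auto
    obtain d2 where d2: "0 < d2" "\<And>k. 0 < k \<Longrightarrow> k < d2 \<Longrightarrow>
        norm (integral {- t..- t + k} (\<lambda>t. h (- t)) /\<^sub>R k - h t) < e"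
      using N2(2)[OF \<open>- t \<notin> N2\<close> e] by auto
    have ht: "h t = g t" using t by (simp add: h_def)
    have scale: "norm (y - k *\<^sub>R g t) \<le> e * k" if "0 < k" "norm (y /\<^sub>R k - g t) < e" for k y
    proof -
      have "y - k *\<^sub>R g t = k *\<^sub>R (y /\<^sub>R k - g t)" using that(1) by (simp add: algebra_simps)
      then have "norm (y - k *\<^sub>R g t) = k * norm (y /\<^sub>R k - g t)" using that(1) by simp
      then show ?thesis using that by (simp add: mult.commute mult_left_mono)
    qed
    define d where "d = Min {d1, d2, t - a, b - t}"
    have d: "0 < d" "d \<le> d1" "d \<le> d2" "d \<le> t - a" "d \<le> b - t"
      using d1(1) d2(1) t by (auto simp: d_def)
    have "norm (f y - f t - (y - t) *\<^sub>R g t) \<le> e * norm (y - t)" if y: "norm (y - t) < d" for y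
    proof -
      consider "y = t" | "t < y" | "y < t" by linarith
      then show ?thesis
      proof cases
        case 2
        have "integral {t..t + (y - t)} h = f y - f t" using h[of t y] 2 y d t by auto
        then show ?thesis
          using scale[of "y - t" "f y - f t"] d1(2)[of "y - t"] 2 y d ht by simp
      next
        case 3
        have "integral {- t..- t + (t - y)} (\<lambda>t. h (- t)) = f t - f y"
          using h[of y t] 3 y d t integral_reflect_real[of t y h] by auto
        then have "norm (f t - f y - (t - y) *\<^sub>R g t) \<le> e * (t - y)"
          using scale[of "t - y" "f t - f y"] d2(2)[of "t - y"] 3 y d ht by simp
        moreover have "f y - f t - (y - t) *\<^sub>R g t = - (f t - f y - (t - y) *\<^sub>R g t)"
          by (simp add: algebra_simps)
        ultimately show ?thesis using 3 by (simp only: norm_minus_cancel) simp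
      qed simp
    qed
    then show "\<exists>d>0. \<forall>y. norm (y - t) < d \<longrightarrow>
        norm (f y - f t - (y - t) *\<^sub>R g t) \<le> e * norm (y - t)" using d(1) by blast
  qed
  ultimately show ?thesis using N1(1) by (meson negligible_Un)
qed

lemma interval_system_integral_le:
  fixes h :: "real \<Rightarrow> real"
  assumes D: "interval_system a b D" and h: "h integrable_on {a..b}" "\<And>t. t \<in> {a..b} \<Longrightarrow> 0 \<le> h t"
  shows "(\<Sum>p\<in>D. integral {fst p..snd p} h) \<le> integral {a..b} h"
proof -
  have "(h has_integral (\<Sum>p\<in>D. integral {fst p..snd p} h)) (\<Union>p\<in>D. {fst p<..<snd p})"
  proof (rule has_integral_UN[OF interval_system_finite[OF D]])
    show "(h has_integral integral {fst p..snd p} h) {fst p<..<snd p}" if "p \<in> D" for p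
    proof -
      have "h integrable_on {fst p..snd p}"
        using interval_systemD[OF D that] by (intro integrable_subinterval_real[OF h(1)]) auto
      then show ?thesis
        unfolding has_integral_Icc_iff_Ioo[symmetric] by (rule integrable_integral)
    qed
    show "pairwise (\<lambda>p p'. negligible ({fst p<..<snd p} \<inter> {fst p'<..<snd p'})) D"
      using interval_system_disjoint[OF D] unfolding pairwise_def by (metis negligible_empty)
  qed
  moreover have "(\<Union>p\<in>D. {fst p<..<snd p}) \<subseteq> {a..b}"
  proof (rule UN_least)
    show "{fst p<..<snd p} \<subseteq> {a..b}" if "p \<in> D" for p
      using interval_systemD[OF D that] by auto
  qed
  ultimately show ?thesis
    using has_integral_subset_le[OF _ _ integrable_integral[OF h(1)]] h(2) by blast
qed

text \<open>Truncation splits \<open>norm (g t)\<close> into a part bounded by \<open>k\<close> and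
  a remainder \<open>r\<close> of integral below \<open>e / 2\<close>. The bounded part contributes
  at most \<open>k\<close> times the length of the system, the remainder at most its full
  integral.\<close>

lemma indefinite_integral_imp_abs_cont_on:
  fixes f :: "real \<Rightarrow> 'b::euclidean_space"
  assumes fg: "indefinite_integral_on a b f g"
  shows "abs_cont_on a b f"
  unfolding abs_cont_on_iff
proof (intro allI impI)
  fix e :: real assume e: "0 < e"
  have g: "g absolutely_integrable_on {a..b}" and
    diff: "\<And>s t. a \<le> s \<Longrightarrow> s \<le> t \<Longrightarrow> t \<le> b \<Longrightarrow> (g has_integral (f t - f s)) {s..t}"
    using fg by (auto simp: indefinite_integral_on_def)
  define h where "h t = norm (g t)" for t
  have h: "h absolutely_integrable_on {a..b}"
    using absolutely_integrable_norm[OF g] by (simp add: h_def[abs_def] comp_def)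
  then have hint: "h integrable_on {a..b}" by (simp add: absolutely_integrable_on_def)
  have min: "(\<lambda>t. min (h t) (real k)) absolutely_integrable_on {a..b}" for k
    by (intro absolutely_integrable_min_1 h absolutely_integrable_continuous_real continuous_on_const)
  then have minint: "(\<lambda>t. min (h t) (real k)) integrable_on {a..b}" for k
    by (simp add: absolutely_integrable_on_def)
  have "(\<lambda>k. integral {a..b} (\<lambda>t. min (h t) (real k))) \<longlonglongrightarrow> integral {a..b} h"
  proof (rule dominated_convergence(2)[OF minint hint])
    show "norm (min (h t) (real k)) \<le> h t" for k t by (simp add: h_def)
    show "(\<lambda>k. min (h t) (real k)) \<longlonglongrightarrow> h t" for t
    proof (rule tendsto_eventually)
      obtain n where "h t \<le> real n" using real_arch_simple by blast
      then have "min (h t) (real k) = h t" if "n \<le> k" for k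
        using that by (simp add: min_def)
      then show "\<forall>\<^sub>F k in sequentially. min (h t) (real k) = h t"
        unfolding eventually_sequentially by blast
    qed
  qed
  then obtain k where k: "\<bar>integral {a..b} (\<lambda>t. min (h t) (real k)) - integral {a..b} h\<bar> < e / 2"
    using LIMSEQ_D[of _ _ "e / 2"] e by fastforce
  define r where "r t = h t - min (h t) (real k)" for t
  have rint: "r integrable_on {a..b}"
    unfolding r_def[abs_def] by (intro integrable_diff hint minint)
  have r: "integral {a..b} r < e / 2"
    using k unfolding r_def[abs_def] Henstock_Kurzweil_Integration.integral_diff[OF hint minint]
    by linarith
  have "variation_over f D < e"
    if D: "interval_system a b D" "variation_over (\<lambda>t. t) D < e / (2 * (real k + 1))" for D
  proof -
    have "norm (f (snd p) - f (fst p)) \<le> real k * norm (snd p - fst p) + integral {fst p..snd p} r"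
      if p: "p \<in> D" for p
    proof -
      note b = interval_systemD[OF D(1) p]
      have sub: "h integrable_on {fst p..snd p}" "r integrable_on {fst p..snd p}"
        using b by (auto intro: integrable_subinterval_real[OF hint] integrable_subinterval_real[OF rint])
      have "norm (f (snd p) - f (fst p)) = norm (integral {fst p..snd p} g)"
        using diff[OF b] by (simp add: integral_unique)
      also have "\<dots> \<le> integral {fst p..snd p} (\<lambda>t. real k + r t)"
      proof (rule integral_norm_bound_integral)
        show "g integrable_on {fst p..snd p}" using diff[OF b] by (rule has_integral_integrable)
        show "(\<lambda>t. real k + r t) integrable_on {fst p..snd p}"
          by (intro integrable_add sub integrable_const_ivl)
        show "norm (g t) \<le> real k + r t" for t by (simp add: r_def h_def)
      qed
      also have "\<dots> = real k * norm (snd p - fst p) + integral {fst p..snd p} r"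
        using b sub by (simp add: Henstock_Kurzweil_Integration.integral_add integrable_const_ivl mult.commute)
      finally show ?thesis .
    qed
    then have "variation_over f D \<le> (\<Sum>p\<in>D. real k * norm (snd p - fst p) + integral {fst p..snd p} r)"
      unfolding variation_over_def by (rule sum_mono)
    also have "\<dots> = real k * variation_over (\<lambda>t. t) D + (\<Sum>p\<in>D. integral {fst p..snd p} r)"
      by (simp add: variation_over_def sum.distrib sum_distrib_left)
    also have "\<dots> \<le> (real k + 1) * variation_over (\<lambda>t. t) D + integral {a..b} r"
    proof (rule add_mono)
      show "real k * variation_over (\<lambda>t. t) D \<le> (real k + 1) * variation_over (\<lambda>t. t) D"
        by (simp add: mult_right_mono variation_over_nonneg)
      show "(\<Sum>p\<in>D. integral {fst p..snd p} r) \<le> integral {a..b} r"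
        by (rule interval_system_integral_le[OF D(1) rint]) (simp add: r_def)
    qed
    also have "\<dots> < (real k + 1) * (e / (2 * (real k + 1))) + e / 2"
      using D(2) r by (intro add_strict_mono mult_strict_left_mono) auto
    also have "\<dots> = e" by (simp add: field_simps add_eq_0_iff)
    finally show ?thesis .
  qed
  moreover have "0 < e / (2 * (real k + 1))" using e by simp
  ultimately show "\<exists>d>0. \<forall>D. interval_system a b D \<longrightarrow> variation_over (\<lambda>t. t) D < d \<longrightarrow> variation_over f D < e"
    by blast
qed

section \<open>Almost everywhere derivatives of absolutely continuous functions\<close>

lemma abs_cont_on_has_vector_derivative:
  fixes f :: "real \<Rightarrow> 'b::euclidean_space"
  assumes f: "abs_cont_on a b f" and "a \<le> b"
  shows "\<exists>N. negligible N \<and> (\<forall>t\<in>{a<..<b} - N. (f has_vector_derivative vector_derivative f (at t)) (at t))"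
proof -
  obtain g where g: "indefinite_integral_on a b f g"
    using abs_cont_on_imp_indefinite_integral[OF assms] by (rule exE)
  obtain N where N: "negligible N" "\<forall>t\<in>{a<..<b} - N. (f has_vector_derivative g t) (at t)"
    using indefinite_integral_has_vector_derivative[OF g] by auto
  have "(f has_vector_derivative vector_derivative f (at t)) (at t)" if "t \<in> {a<..<b} - N" for t
    using differentiableI_vector[OF bspec[OF N(2) that]] by (rule iffD1[OF vector_derivative_works])
  then show ?thesis using N(1) by (intro exI[of _ N]) simp
qed

lemma abs_cont_on_integral_derivative:
  fixes f :: "real \<Rightarrow> 'b::euclidean_space"
  assumes f: "abs_cont_on a b f" and "a \<le> b" and N: "negligible N"
    and f': "\<And>t. t \<in> {a<..<b} - N \<Longrightarrow> (f has_vector_derivative f' t) (at t)"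
  shows "indefinite_integral_on a b f f'"
proof -
  obtain g where g: "indefinite_integral_on a b f g"
    using abs_cont_on_imp_indefinite_integral[OF f \<open>a \<le> b\<close>] by blast
  obtain N' where N': "negligible N'" "\<And>t. t \<in> {a<..<b} - N' \<Longrightarrow> (f has_vector_derivative g t) (at t)"
    using indefinite_integral_has_vector_derivative[OF g] by blast
  let ?N = "N \<union> N' \<union> {a, b}"
  have neg: "negligible ?N" using N N'(1) by simp
  have eq: "f' t = g t" if "t \<in> {a..b} - ?N" for t
  proof -
    have "t \<in> {a<..<b} - N" "t \<in> {a<..<b} - N'" using that by auto
    then show ?thesis using vector_derivative_unique_at[OF f' N'(2)] by blast
  qed
  show ?thesis
    unfolding indefinite_integral_on_def
  proof (intro conjI allI impI)
    show "f' absolutely_integrable_on {a..b}"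
    proof (rule absolutely_integrable_spike[OF _ neg])
      show "g absolutely_integrable_on {a..b}" using g by (simp add: indefinite_integral_on_def)
      show "f' t = g t" if "t \<in> {a..b} - ?N" for t by (rule eq[OF that])
    qed
    fix s t assume st: "a \<le> s" "s \<le> t" "t \<le> b"
    have "(g has_integral (f t - f s)) {s..t}"
      using g st unfolding indefinite_integral_on_def by blast
    then show "(f' has_integral (f t - f s)) {s..t}"
    proof (rule has_integral_spike[OF neg, rotated])
      show "f' r = g r" if "r \<in> {s..t} - ?N" for r
        by (rule eq) (use that st in auto)
    qed
  qed
qed

text \<open>Absolute continuity makes this true: the Cantor function has derivative zero almost
  everywhere without being constant. The constancy of inner products and of matrices below rests on
  it.\<close>

lemma abs_cont_on_zero_derivative:
  fixes f :: "real \<Rightarrow> 'b::euclidean_space"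
  assumes f: "abs_cont_on a b f" and N: "negligible N"
    and f': "\<And>t. t \<in> {a<..<b} - N \<Longrightarrow> (f has_vector_derivative 0) (at t)"
    and t: "a \<le> t" "t \<le> b"
  shows "f t = f a"
proof -
  have "indefinite_integral_on a b f (\<lambda>_. 0)"
    using abs_cont_on_integral_derivative[OF f _ N f'] t by simp
  then have "((\<lambda>_. 0) has_integral (f t - f a)) {a..t}"
    using t unfolding indefinite_integral_on_def by blast
  then show ?thesis using has_integral_unique[OF _ has_integral_0] by fastforce
qed

text \<open>Continuous directional derivatives are bounded on a small closed ball, so
  \<open>g\<close> is Lipschitz there by the mean value inequality on a convex set, and Lipschitz
  maps preserve absolute continuity. \<open>abs_cont_on_local\<close> then removes the
  smallness.\<close>

lemma abs_cont_on_compose_C1: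
  fixes g :: "'a::euclidean_space \<Rightarrow> 'b::real_normed_vector"
  assumes S: "open S" and g: "\<And>y. y \<in> S \<Longrightarrow> (g has_derivative g' y) (at y)"
    and cont: "\<And>v. continuous_on S (\<lambda>y. g' y v)"
    and f: "abs_cont_on a b f" "a \<le> b" "f ` {a..b} \<subseteq> S"
  shows "abs_cont_on a b (\<lambda>t. g (f t))"
proof (rule abs_cont_on_local[OF \<open>a \<le> b\<close>])
  fix t assume t: "a \<le> t" "t \<le> b"
  then have "f t \<in> S" using f(3) by auto
  then obtain r where r: "0 < r" "cball (f t) r \<subseteq> S"
    using S open_contains_cball by blast
  obtain d where d: "0 < d" "\<And>s. s \<in> {a..b} \<Longrightarrow> dist s t < d \<Longrightarrow> dist (f s) (f t) < r"
    using abs_cont_on_imp_continuous_on[OF f(1)] t r(1) unfolding continuous_on_iff by (meson atLeastAtMost_iff)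
  have "\<exists>K\<ge>0. \<forall>y\<in>cball (f t) r. norm (g' y i) \<le> K" for i
  proof -
    have "bounded ((\<lambda>y. g' y i) ` cball (f t) r)"
      using continuous_on_subset[OF cont r(2)]
      by (intro compact_imp_bounded compact_continuous_image) auto
    then show ?thesis unfolding bounded_pos by (auto intro: less_imp_le)
  qed
  then obtain K where K: "\<And>i. 0 \<le> K i" "\<And>i y. y \<in> cball (f t) r \<Longrightarrow> norm (g' y i) \<le> K i" by metis
  let ?K = "\<Sum>i\<in>Basis. K i"
  have lip: "norm (g y - g z) \<le> ?K * norm (y - z)" if yz: "y \<in> cball (f t) r" "z \<in> cball (f t) r" for y z
  proof (rule differentiable_bound[OF convex_cball _ _ yz])
    fix w assume w: "w \<in> cball (f t) r"
    then have gw: "(g has_derivative g' w) (at w)" using g r(2) by blast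
    then show "(g has_derivative g' w) (at w within cball (f t) r)" by (rule has_derivative_at_withinI)
    interpret bounded_linear "g' w" using gw by (rule has_derivative_bounded_linear)
    show "onorm (g' w) \<le> ?K"
    proof (rule onorm_bound)
      show "0 \<le> ?K" using K(1) by (simp add: sum_nonneg)
      fix v
      have "g' w v = (\<Sum>i\<in>Basis. (v \<bullet> i) *\<^sub>R g' w i)"
        by (subst euclidean_representation[of v, symmetric]) (simp add: sum scaleR)
      also have "norm \<dots> \<le> (\<Sum>i\<in>Basis. norm v * K i)"
        by (intro sum_norm_le) (use K w in \<open>auto intro!: mult_mono Basis_le_norm\<close>)
      finally show "norm (g' w v) \<le> ?K * norm v" by (simp add: sum_distrib_left mult.commute)
    qed
  qed
  have "abs_cont_on u v (\<lambda>t. g (f t))"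
    if uv: "a \<le> u" "u \<le> t" "t \<le> v" "v \<le> b" "v - u < d" for u v
  proof (rule abs_cont_on_dominated[OF abs_cont_on_subinterval[OF f(1) uv(1,4)]])
    show "0 \<le> ?K" using K(1) by (simp add: sum_nonneg)
    fix s s' assume "u \<le> s" "s \<le> s'" "s' \<le> v"
    then have "dist (f s) (f t) < r" "dist (f s') (f t) < r"
      using uv by (auto intro!: d(2) simp: dist_real_def)
    then show "norm (g (f s') - g (f s)) \<le> ?K * norm (f s' - f s)"
      by (intro lip) (auto simp: dist_commute)
  qed
  then show "\<exists>d>0. \<forall>u v. a \<le> u \<longrightarrow> u \<le> t \<longrightarrow> t \<le> v \<longrightarrow> v \<le> b \<longrightarrow> v - u < d \<longrightarrow> abs_cont_on u v (\<lambda>t. g (f t))"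
    using d(1) by blast
qed

section \<open>Linear differential equations with integrable coefficients\<close>

lemma absolutely_integrable_continuous_scaleR:
  fixes f :: "real \<Rightarrow> real" and g :: "real \<Rightarrow> 'b::euclidean_space"
  assumes f: "continuous_on {a..b} f" and g: "g absolutely_integrable_on {a..b}"
  shows "(\<lambda>t. f t *\<^sub>R g t) absolutely_integrable_on {a..b}"
proof (rule absolutely_integrable_bounded_measurable_product[where h = "(*\<^sub>R)" and f = f, OF _ _ _ _ g])
  show "bilinear ((*\<^sub>R) :: real \<Rightarrow> 'b \<Rightarrow> 'b)"
    using bilinear_conv_bounded_bilinear bounded_bilinear_scaleR by blast
  show "f \<in> borel_measurable (lebesgue_on {a..b})"
    by (rule continuous_imp_measurable_on_sets_lebesgue[OF f]) simp
  show "bounded (f ` {a..b})"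
    by (intro compact_imp_bounded compact_continuous_image f) simp
qed simp

lemma indefinite_integral_on_integral:
  fixes g :: "real \<Rightarrow> 'b::euclidean_space"
  assumes "g absolutely_integrable_on {a..b}"
  shows "indefinite_integral_on a b (\<lambda>t. c + integral {a..t} g) g"
  unfolding indefinite_integral_on_def
proof (intro conjI allI impI assms)
  fix s t assume st: "a \<le> s" "s \<le> t" "t \<le> b"
  have g: "g integrable_on {a..b}" using assms by (simp add: absolutely_integrable_on_def)
  have "integral {a..s} g + integral {s..t} g = integral {a..t} g"
    using st by (intro Henstock_Kurzweil_Integration.integral_combine integrable_subinterval_real[OF g]) auto
  moreover have "(g has_integral integral {s..t} g) {s..t}"
    using st by (intro integrable_integral integrable_subinterval_real[OF g]) auto
  ultimately show "(g has_integral (c + integral {a..t} g - (c + integral {a..s} g))) {s..t}"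
    by (simp add: algebra_simps) (metis add_diff_cancel_left')
qed

lemma indefinite_integral_onD:
  assumes "indefinite_integral_on a b f g" "a \<le> s" "s \<le> t" "t \<le> b"
  shows "(g has_integral (f t - f s)) {s..t}"
  using assms unfolding indefinite_integral_on_def by blast

lemma indefinite_integral_on_cong:
  fixes g :: "real \<Rightarrow> 'b::euclidean_space"
  assumes "indefinite_integral_on a b f g" "\<And>t. t \<in> {a..b} \<Longrightarrow> g' t = g t"
  shows "indefinite_integral_on a b f g'"
  unfolding indefinite_integral_on_def
proof (intro conjI allI impI)
  show "g' absolutely_integrable_on {a..b}"
  proof (rule absolutely_integrable_spike[OF _ negligible_empty])
    show "g absolutely_integrable_on {a..b}" using assms(1) by (simp add: indefinite_integral_on_def)
    show "g' t = g t" if "t \<in> {a..b} - {}" for t using assms(2) that by simp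
  qed
  fix s t assume st: "a \<le> s" "s \<le> t" "t \<le> b"
  then have "(g has_integral (f t - f s)) {s..t}"
    using assms(1) unfolding indefinite_integral_on_def by blast
  then show "(g' has_integral (f t - f s)) {s..t}"
    by (rule has_integral_eq[rotated]) (use assms(2) st in auto)
qed

text \<open>Picard iteration is a contraction with factor one half for the supremum norm weighted
  by \<open>exp (- 2 F)\<close>, where \<open>F\<close> is a primitive of a bound for the norm of the coefficients.\<close>

lemma linear_ode_solution:
  fixes g :: "'a::euclidean_space \<Rightarrow> real \<Rightarrow> 'a"
  assumes "a \<le> b" and g: "\<And>i. i \<in> Basis \<Longrightarrow> g i absolutely_integrable_on {a..b}"
  shows "\<exists>w. w a = w0 \<and> indefinite_integral_on a b w (\<lambda>t. \<Sum>i\<in>Basis. (w t \<bullet> i) *\<^sub>R g i t)"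
proof -
  define B where "B t u = (\<Sum>i\<in>Basis. (u \<bullet> i) *\<^sub>R g i t)" for t u
  define \<beta> where "\<beta> t = (\<Sum>i\<in>Basis. norm (g i t))" for t
  define F where "F t = 0 + integral {a..t} \<beta>" for t
  \<comment> \<open>The exponent 2 yields the contraction factor one half: the integral of
    \<open>2 * \<beta> * E\<close> is \<open>E - 1\<close>, while the coefficients are bounded by
    \<beta> alone.\<close>
  define E where "E t = exp (2 * F t)" for t
  have \<beta>: "\<beta> absolutely_integrable_on {a..b}"
    unfolding \<beta>_def[abs_def]
    using absolutely_integrable_norm[OF g] by (intro absolutely_integrable_sum) (auto simp: comp_def)
  have B_le: "norm (B t u) \<le> norm u * \<beta> t" for t u
    unfolding B_def \<beta>_def sum_distrib_left
    by (intro sum_norm_le) (auto intro!: mult_right_mono Basis_le_norm)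
  have B_diff: "B t u - B t v = B t (u - v)" for t u v
    by (simp add: B_def inner_diff_left scaleR_diff_left sum_subtractf)
  have B_scale: "c *\<^sub>R B t u = B t (c *\<^sub>R u)" for c t u
    by (simp add: B_def scaleR_sum_right)
  have indF: "indefinite_integral_on a b F \<beta>"
    unfolding F_def[abs_def] by (rule indefinite_integral_on_integral[OF \<beta>])
  have FAC: "abs_cont_on a b F" by (rule indefinite_integral_imp_abs_cont_on[OF indF])
  obtain N where N: "negligible N" "\<And>t. t \<in> {a<..<b} - N \<Longrightarrow> (F has_vector_derivative \<beta> t) (at t)"
    using indefinite_integral_has_vector_derivative[OF indF] by blast
  have EAC: "abs_cont_on a b E"
    unfolding E_def[abs_def]
    by (rule abs_cont_on_compose_C1[OF open_UNIV, where g' = "\<lambda>y v. v * (2 * exp (2 * y))"])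
       (use FAC \<open>a \<le> b\<close> in \<open>auto intro!: derivative_eq_intros continuous_intros\<close>)
  have indE: "indefinite_integral_on a b E (\<lambda>t. 2 * \<beta> t * E t)"
  proof (rule abs_cont_on_integral_derivative[OF EAC \<open>a \<le> b\<close> N(1)])
    fix t assume "t \<in> {a<..<b} - N"
    then have "(F has_real_derivative \<beta> t) (at t)"
      using N(2) by (simp add: has_real_derivative_iff_has_vector_derivative)
    then have "(E has_real_derivative (2 * \<beta> t * E t)) (at t)"
      unfolding E_def[abs_def] by (auto intro!: derivative_eq_intros)
    then show "(E has_vector_derivative (2 * \<beta> t * E t)) (at t)"
      by (simp add: has_real_derivative_iff_has_vector_derivative)
  qed
  have Ea: "E a = 1" by (simp add: E_def F_def)
  have Epos: "0 < E t" for t by (simp add: E_def)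
  have Econt: "continuous_on {a..b} E" by (rule abs_cont_on_imp_continuous_on[OF EAC])
  \<comment> \<open>The unknown of the iteration is the rescaled function \<open>u = w / E\<close>,
    so \<open>h u\<close> is the right-hand side of the equation for \<open>w\<close>.\<close>
  define h where "h u s = E s *\<^sub>R B s (u s)" for u s
  have h: "h u absolutely_integrable_on {a..b}" if "continuous_on {a..b} u" for u
  proof -
    have "h u = (\<lambda>s. \<Sum>i\<in>Basis. (E s * (u s \<bullet> i)) *\<^sub>R g i s)"
      by (simp add: h_def[abs_def] B_def scaleR_sum_right)
    moreover have "(\<lambda>s. \<Sum>i\<in>Basis. (E s * (u s \<bullet> i)) *\<^sub>R g i s) absolutely_integrable_on {a..b}"
      by (intro absolutely_integrable_sum finite_Basis absolutely_integrable_continuous_scaleR g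
          continuous_intros Econt that)
    ultimately show ?thesis by simp
  qed
  define J where "J u t = w0 + integral {a..t} (h u)" for u t
  have indJ: "indefinite_integral_on a b (J u) (h u)" if "continuous_on {a..b} u" for u
    unfolding J_def[abs_def] by (rule indefinite_integral_on_integral[OF h[OF that]])
  \<comment> \<open>The fixed point theorem is applied to bounded continuous functions on the whole
    real line; clamping the time extends functions on \<open>{a..b}\<close> to such
    functions.\<close>
  define c where "c t = max a (min t b)" for t
  have c: "c t \<in> {a..b}" for t using \<open>a \<le> b\<close> by (simp add: c_def)
  define K where "K u t = (1 / E t) *\<^sub>R J u t" for u t
  have "(\<lambda>t. K u (c t)) \<in> bcontfun" if "continuous_on {a..b} u" for u
  proof -
    have K: "continuous_on {a..b} (K u)"
      unfolding K_def[abs_def]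
      using Epos by (intro continuous_intros Econt
        abs_cont_on_imp_continuous_on[OF indefinite_integral_imp_abs_cont_on[OF indJ[OF that]]])
        (metis less_irrefl)
    have "continuous_on UNIV c" unfolding c_def[abs_def] by (intro continuous_intros)
    then have "continuous_on UNIV (\<lambda>t. K u (c t))"
      by (rule continuous_on_compose2[OF K]) (use c in blast)
    moreover have "bounded (range (\<lambda>t. K u (c t)))"
    proof (rule bounded_subset)
      show "bounded (K u ` {a..b})" by (intro compact_imp_bounded compact_continuous_image K) simp
      show "range (\<lambda>t. K u (c t)) \<subseteq> K u ` {a..b}" using c by blast
    qed
    ultimately show ?thesis by (simp add: bcontfun_def)
  qed
  then have Kc: "(\<lambda>t. K (apply_bcontfun u) (c t)) \<in> bcontfun" for u :: "real \<Rightarrow>\<^sub>C 'a"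
    using continuous_on_apply_bcontfun by blast
  define T where "T u = Bcontfun (\<lambda>t. K (apply_bcontfun u) (c t))" for u :: "real \<Rightarrow>\<^sub>C 'a"
  have T: "apply_bcontfun (T u) = (\<lambda>t. K (apply_bcontfun u) (c t))" for u
    unfolding T_def by (rule Bcontfun_inverse[OF Kc])
  have "dist (T u) (T v) \<le> 1 / 2 * dist u v" for u v
  proof (rule dist_bound)
    fix t
    let ?s = "c t" and ?d = "dist u v"
    have s: "a \<le> ?s" "?s \<le> b" using c[of t] by auto
    have int: "h (apply_bcontfun w) integrable_on {a..?s}" for w
    proof (rule integrable_subinterval_real)
      show "h (apply_bcontfun w) integrable_on {a..b}"
        using h[OF continuous_on_apply_bcontfun, of w] unfolding absolutely_integrable_on_def by blast
    qed (use s in auto)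
    have E: "((\<lambda>r. ?d / 2 * (2 * \<beta> r * E r)) has_integral (?d / 2 * (E ?s - 1))) {a..?s}"
      using has_integral_mult_right[OF indefinite_integral_onD[OF indE order_refl s], of "?d / 2"]
      unfolding Ea .
    have "norm (J u ?s - J v ?s) = norm (integral {a..?s} (\<lambda>r. h u r - h v r))"
      by (simp add: J_def Henstock_Kurzweil_Integration.integral_diff int)
    also have "\<dots> \<le> integral {a..?s} (\<lambda>r. ?d / 2 * (2 * \<beta> r * E r))"
    proof (rule integral_norm_bound_integral)
      show "(\<lambda>r. h u r - h v r) integrable_on {a..?s}" by (intro integrable_diff int)
      show "(\<lambda>r. ?d / 2 * (2 * \<beta> r * E r)) integrable_on {a..?s}"
        using E by (rule has_integral_integrable)
      fix r
      have "norm (h u r - h v r) = E r * norm (B r (u r - v r))"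
        using Epos[of r] by (simp add: h_def B_diff[symmetric] scaleR_diff_right[symmetric])
      also have "\<dots> \<le> E r * (?d * \<beta> r)"
      proof (intro mult_left_mono order_trans[OF B_le] mult_right_mono)
        show "norm (u r - v r) \<le> ?d" using dist_bounded[of u r v] by (simp add: dist_norm)
        show "0 \<le> \<beta> r" by (simp add: \<beta>_def sum_nonneg)
      qed (use Epos[of r] in simp)
      finally show "norm (h u r - h v r) \<le> ?d / 2 * (2 * \<beta> r * E r)" by (simp add: mult_ac)
    qed
    also have "\<dots> = ?d / 2 * (E ?s - 1)" using E by (rule integral_unique)
    also have "\<dots> \<le> ?d / 2 * E ?s" by (intro mult_left_mono) auto
    finally have "norm (J u ?s - J v ?s) \<le> ?d / 2 * E ?s" .
    then have "norm (J u ?s - J v ?s) / E ?s \<le> ?d / 2"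
      using Epos[of ?s] by (simp add: divide_le_eq)
    moreover have "dist (T u t) (T v t) = norm (J u ?s - J v ?s) / E ?s"
      using Epos[of ?s] unfolding T K_def dist_norm scaleR_diff_right[symmetric] by simp
    ultimately show "dist (T u t) (T v t) \<le> 1 / 2 * ?d" by simp
  qed
  then have "\<exists>!u. T u = u"
    by (intro banach_fix_type[of "1 / 2"]) auto
  then obtain u where u: "T u = u" by blast
  have uK: "u t = (1 / E t) *\<^sub>R J u t" if "t \<in> {a..b}" for t
  proof -
    have "apply_bcontfun u t = K u (c t)" using T[of u] u by metis
    then show ?thesis using that by (simp add: K_def c_def)
  qed
  have "indefinite_integral_on a b (J u) (\<lambda>t. B t (J u t))"
  proof (rule indefinite_integral_on_cong[OF indJ])
    fix t assume t: "t \<in> {a..b}"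
    have "E t *\<^sub>R u t = J u t" using uK[OF t] Epos[of t] by simp
    then show "B t (J u t) = h u t" by (simp add: h_def B_scale)
  qed simp
  moreover have "J u a = w0" by (simp add: J_def)
  ultimately show ?thesis unfolding B_def by blast
qed

text \<open>The endpoints go into the exceptional set. This suits the two-sided derivatives
  \<open>at t\<close>, which values on \<open>{a..b}\<close> determine only in the interior.\<close>

lemma AE_lebesgue_on_interval_iff:
  fixes a b :: real
  shows "(AE t in lebesgue_on {a..b}. Q t) \<longleftrightarrow> (\<exists>N. negligible N \<and> (\<forall>t\<in>{a<..<b} - N. Q t))"
proof -
  have "(AE t in lebesgue_on {a..b}. Q t) \<longleftrightarrow> (AE t in lebesgue. t \<in> {a..b} \<longrightarrow> Q t)"
    by (rule AE_restrict_space_iff) simp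
  also have "\<dots> \<longleftrightarrow> (\<exists>N. negligible N \<and> (\<forall>t\<in>{a<..<b} - N. Q t))"
  proof
    assume "AE t in lebesgue. t \<in> {a..b} \<longrightarrow> Q t"
    then obtain N where N: "N \<in> null_sets lebesgue" "{t. \<not> (t \<in> {a..b} \<longrightarrow> Q t)} \<subseteq> N"
      unfolding eventually_ae_filter by auto
    have "Q t" if "t \<in> {a<..<b} - N" for t
    proof -
      have "t \<in> {a..b}" "t \<notin> N" using that by auto
      then show ?thesis using N(2) by blast
    qed
    then show "\<exists>N. negligible N \<and> (\<forall>t\<in>{a<..<b} - N. Q t)"
      using N(1) negligible_iff_null_sets by blast
  next
    assume "\<exists>N. negligible N \<and> (\<forall>t\<in>{a<..<b} - N. Q t)"
    then obtain N where N: "negligible N" "\<And>t. t \<in> {a<..<b} - N \<Longrightarrow> Q t" by blast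
    show "AE t in lebesgue. t \<in> {a..b} \<longrightarrow> Q t"
    proof (rule AE_I')
      show "N \<union> {a, b} \<in> null_sets lebesgue"
        using N(1) by (simp flip: negligible_iff_null_sets)
      show "{t \<in> space lebesgue. \<not> (t \<in> {a..b} \<longrightarrow> Q t)} \<subseteq> N \<union> {a, b}"
        using N(2) by fastforce
    qed
  qed
  finally show ?thesis .
qed

lemma AE_lebesgue_on_interior: "AE t in lebesgue_on {a..b::real}. t \<in> {a<..<b}"
  unfolding AE_lebesgue_on_interval_iff by (intro exI[of _ "{}"]) simp

lemma abs_cont_on_AE_has_vector_derivative:
  fixes f :: "real \<Rightarrow> 'b::euclidean_space"
  assumes "abs_cont_on a b f" "a \<le> b"
  shows "AE t in lebesgue_on {a..b}. (f has_vector_derivative vector_derivative f (at t)) (at t)"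
  unfolding AE_lebesgue_on_interval_iff by (rule abs_cont_on_has_vector_derivative[OF assms])

lemma abs_cont_on_AE_zero_derivative:
  fixes f :: "real \<Rightarrow> 'b::euclidean_space"
  assumes "abs_cont_on a b f" and "AE t in lebesgue_on {a..b}. (f has_vector_derivative 0) (at t)"
    and "a \<le> t" "t \<le> b"
  shows "f t = f a"
  using assms(2) abs_cont_on_zero_derivative[OF assms(1) _ _ assms(3,4)]
  unfolding AE_lebesgue_on_interval_iff by blast

text \<open>Fields along a curve are prescribed only on a closed interval, while
  \<open>vector_derivative\<close> looks at a full neighbourhood. At interior times this causes no
  ambiguity.\<close>

lemma vector_derivative_cong_interval:
  assumes "t \<in> {a<..<b}" "\<And>s. s \<in> {a..b} \<Longrightarrow> f s = g s"
  shows "vector_derivative f (at t) = vector_derivative g (at t)"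
proof (rule vector_derivative_cong_eq)
  have "\<forall>\<^sub>F s in nhds t. s \<in> {a<..<b}"
    using assms(1) by (intro eventually_nhds_in_open) auto
  then show "\<forall>\<^sub>F s in nhds t. s \<in> UNIV \<longrightarrow> f s = g s"
    by (rule eventually_mono) (use assms(2) in auto)
qed auto

section \<open>Parallel sections along curves of subspaces\<close>

lemma orth_proj_unique:
  assumes "subspace S" "y \<in> S" "\<And>z. z \<in> S \<Longrightarrow> (v - y) \<bullet> z = 0"
  shows "orth_proj S v = y"
  unfolding orth_proj_def
proof (rule the_equality)
  show "y \<in> S \<and> (\<forall>z\<in>S. (v - y) \<bullet> z = 0)" using assms by blast
  fix y' assume y': "y' \<in> S \<and> (\<forall>z\<in>S. (v - y') \<bullet> z = 0)"
  have "y' - y \<in> S" using assms(1,2) y' by (simp add: subspace_diff)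
  then have "(v - y) \<bullet> (y' - y) = 0" "(v - y') \<bullet> (y' - y) = 0" using assms(3) y' by blast+
  then have "(y' - y) \<bullet> (y' - y) = 0" by (simp add: inner_diff_left)
  then show "y' = y" by simp
qed

lemma orth_proj:
  fixes S :: "'b::euclidean_space set"
  assumes "subspace S"
  shows orth_proj_in: "orth_proj S v \<in> S"
    and orth_proj_orthogonal: "z \<in> S \<Longrightarrow> (v - orth_proj S v) \<bullet> z = 0"
proof -
  obtain y w where yw: "y \<in> span S" "\<And>u. u \<in> span S \<Longrightarrow> orthogonal w u" "v = y + w"
    using orthogonal_subspace_decomp_exists[of S v] by blast
  have S: "span S = S" using assms by (simp add: span_eq_iff)
  have y: "y \<in> S" "\<And>z. z \<in> S \<Longrightarrow> (v - y) \<bullet> z = 0"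
    using yw(1,3) yw(2) unfolding S by (auto simp: orthogonal_def)
  have "orth_proj S v = y" by (rule orth_proj_unique[OF assms y])
  then show "orth_proj S v \<in> S" "z \<in> S \<Longrightarrow> (v - orth_proj S v) \<bullet> z = 0"
    using y by auto
qed

lemma orth_proj_inner:
  fixes S :: "'b::euclidean_space set"
  assumes "subspace S" "z \<in> S"
  shows "z \<bullet> orth_proj S v = z \<bullet> v"
proof -
  have "v \<bullet> z = orth_proj S v \<bullet> z"
    using orth_proj_orthogonal[OF assms, of v] by (simp add: inner_diff_left)
  then show ?thesis by (simp only: inner_commute[of z])
qed

lemma orth_proj_idem:
  assumes "subspace S" "v \<in> S"
  shows "orth_proj S v = v"
  by (rule orth_proj_unique) (use assms in auto)

lemma linear_orth_proj:
  fixes S :: "'b::euclidean_space set"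
  assumes S: "subspace S"
  shows "linear (orth_proj S)"
proof (rule linearI)
  fix u v :: 'b and c :: real
  show "orth_proj S (u + v) = orth_proj S u + orth_proj S v"
  proof (rule orth_proj_unique[OF S])
    fix z assume "z \<in> S"
    then have "(u - orth_proj S u) \<bullet> z = 0" "(v - orth_proj S v) \<bullet> z = 0"
      using orth_proj_orthogonal[OF S] by blast+
    then show "(u + v - (orth_proj S u + orth_proj S v)) \<bullet> z = 0"
      by (simp add: inner_diff_left inner_add_left)
  qed (simp add: S orth_proj_in subspace_add)
  show "orth_proj S (c *\<^sub>R v) = c *\<^sub>R orth_proj S v"
  proof (rule orth_proj_unique[OF S])
    fix z assume "z \<in> S"
    then show "(c *\<^sub>R v - c *\<^sub>R orth_proj S v) \<bullet> z = 0"
      using orth_proj_orthogonal[OF S] by (simp add: scaleR_diff_right[symmetric])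
  qed (simp add: S orth_proj_in subspace_scale)
qed

lemma orth_proj_eq_0_iff:
  fixes S :: "'b::euclidean_space set"
  assumes "subspace S"
  shows "orth_proj S v = 0 \<longleftrightarrow> (\<forall>z\<in>S. z \<bullet> v = 0)"
proof
  assume "orth_proj S v = 0"
  then show "\<forall>z\<in>S. z \<bullet> v = 0" using orth_proj_inner[OF assms, of _ v] by simp
next
  assume "\<forall>z\<in>S. z \<bullet> v = 0"
  then show "orth_proj S v = 0"
    by (intro orth_proj_unique assms) (auto simp: subspace_0 assms inner_commute)
qed

lemma orth_proj_complement:
  fixes S :: "'b::euclidean_space set"
  assumes S: "subspace S"
  shows "orth_proj (S\<^sup>\<bottom>) v = v - orth_proj S v"
proof (rule orth_proj_unique[OF subspace_orthogonal_comp])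
  show "v - orth_proj S v \<in> S\<^sup>\<bottom>"
    using orth_proj_orthogonal[OF S] by (auto simp: orthogonal_comp_def orthogonal_def inner_commute)
  show "(v - (v - orth_proj S v)) \<bullet> z = 0" if "z \<in> S\<^sup>\<bottom>" for z
    using orth_proj_in[OF S] that by (auto simp: orthogonal_comp_def orthogonal_def)
qed

lemma dim_orthogonal_complement:
  fixes S :: "'b::euclidean_space set"
  assumes "subspace S"
  shows "dim (S\<^sup>\<bottom>) = DIM('b) - dim S"
proof -
  have "S\<^sup>\<bottom> = {y \<in> UNIV. \<forall>x\<in>S. orthogonal x y}" by (auto simp: orthogonal_comp_def)
  then show ?thesis
    using dim_subspace_orthogonal_to_vectors[OF assms subspace_UNIV] by simp
qed

text \<open>Spanning is encoded as the expansion formula, the form in which frames are applied;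
  \<open>orthonormal_frameI\<close> derives it from a dimension count.\<close>

definition orthonormal_frame :: "'b::real_inner set \<Rightarrow> ('k::finite \<Rightarrow> 'b) \<Rightarrow> bool" where
  "orthonormal_frame S e \<longleftrightarrow> (\<forall>k. e k \<in> S) \<and> (\<forall>k l. e k \<bullet> e l = (if k = l then 1 else 0)) \<and>
     (\<forall>v\<in>S. v = (\<Sum>k\<in>UNIV. (e k \<bullet> v) *\<^sub>R e k))"

lemma orthonormal_frameD:
  assumes "orthonormal_frame S e"
  shows "e k \<in> S" "e k \<bullet> e l = (if k = l then 1 else 0)"
    and "v \<in> S \<Longrightarrow> (\<Sum>k\<in>UNIV. (e k \<bullet> v) *\<^sub>R e k) = v"
proof -
  note e = assms[unfolded orthonormal_frame_def]
  show "e k \<in> S" using e by blast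
  show "e k \<bullet> e l = (if k = l then 1 else 0)" using e by blast
  show "(\<Sum>k\<in>UNIV. (e k \<bullet> v) *\<^sub>R e k) = v" if "v \<in> S"
    by (rule sym, rule bspec[OF conjunct2[OF conjunct2[OF e]] that])
qed

lemma orthonormal_frameI:
  fixes e :: "'k::finite \<Rightarrow> 'b::euclidean_space"
  assumes S: "subspace S" "dim S = CARD('k)" and e: "\<And>k. e k \<in> S"
    and on: "\<And>k l. e k \<bullet> e l = (if k = l then 1 else 0)"
  shows "orthonormal_frame S e"
  unfolding orthonormal_frame_def
proof (intro conjI allI ballI e on)
  fix v assume v: "v \<in> S"
  have "inj e"
  proof (rule injI)
    fix k l assume "e k = e l"
    then have "e k \<bullet> e l = 1" using on[of l l] by simp
    then show "k = l" using on[of k l] by (simp split: if_splits)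
  qed
  have "independent (range e)"
  proof (rule pairwise_orthogonal_independent)
    show "pairwise orthogonal (range e)"
      unfolding pairwise_def orthogonal_def using on by auto
    show "0 \<notin> range e"
    proof
      assume "0 \<in> range e"
      then obtain k where "e k = 0" by auto
      then show False using on[of k k] by simp
    qed
  qed
  then have "S \<subseteq> span (range e)"
    using card_ge_dim_independent[of "range e" S] e S(2) card_image[OF \<open>inj e\<close>] by auto
  moreover have "range e \<subseteq> S" using e by blast
  ultimately have span: "span (range e) = S"
    using span_subspace[OF _ _ S(1)] by blast
  let ?r = "v - (\<Sum>k\<in>UNIV. (e k \<bullet> v) *\<^sub>R e k)"
  have "e l \<bullet> ?r = 0" for l
    by (simp add: inner_diff_right inner_sum_right on if_distrib cong: if_cong)
  then have "orthogonal ?r w" if "w \<in> range e" for w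
    using that by (auto simp: orthogonal_def inner_commute)
  moreover have "?r \<in> span (range e)"
    unfolding span using v e S(1) by (intro subspace_diff subspace_sum subspace_scale) auto
  ultimately have "orthogonal ?r ?r"
    using orthogonal_to_span by blast
  then show "v = (\<Sum>k\<in>UNIV. (e k \<bullet> v) *\<^sub>R e k)" by (simp add: orthogonal_self)
qed

lemma orthonormal_frame_exists:
  fixes S :: "'b::euclidean_space set"
  assumes S: "subspace S" "dim S = CARD('k::finite)"
  shows "\<exists>e :: 'k \<Rightarrow> 'b. orthonormal_frame S e"
proof -
  obtain B where B: "B \<subseteq> S" "pairwise orthogonal B" "\<And>x. x \<in> B \<Longrightarrow> norm x = 1"
      "independent B" "card B = dim S" "span B = S"
    using orthonormal_basis_subspace[OF S(1)] by blast
  have "finite B" using B(4) by (rule independent_imp_finite)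
  then obtain e :: "'k \<Rightarrow> 'b" where e: "bij_betw e UNIV B"
    using finite_same_card_bij[of "UNIV :: 'k set" B] B(5) S(2) by auto
  then have eB: "e k \<in> B" for k by (auto simp: bij_betw_def)
  have "orthonormal_frame S e"
  proof (rule orthonormal_frameI[OF S])
    show "e k \<in> S" for k using eB B(1) by blast
    show "e k \<bullet> e l = (if k = l then 1 else 0)" for k l
    proof (cases "k = l")
      case True
      then show ?thesis using B(3)[OF eB[of k]] by (simp add: norm_eq_1)
    next
      case False
      then have "e k \<noteq> e l" using e by (auto simp: bij_betw_def inj_on_def)
      then show ?thesis using False B(2) eB unfolding pairwise_def orthogonal_def by auto
    qed
  qed
  then show ?thesis by blast
qed

text \<open>The family \<open>T\<close> is left arbitrary. Tangent images and normal spaces along a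
  curve are both instances, so parallel transport is constructed once for the two bundles.\<close>

definition section_along :: "real \<Rightarrow> (real \<Rightarrow> 'b::real_inner set) \<Rightarrow> (real \<Rightarrow> 'b) \<Rightarrow> bool" where
  "section_along \<tau> T W \<longleftrightarrow> (\<forall>t\<in>{0..\<tau>}. W t \<in> T t) \<and> abs_cont_on 0 \<tau> W"

definition parallel_along :: "real \<Rightarrow> (real \<Rightarrow> 'b::real_inner set) \<Rightarrow> (real \<Rightarrow> 'b) \<Rightarrow> bool" where
  "parallel_along \<tau> T W \<longleftrightarrow> section_along \<tau> T W \<and>
     (AE t in lebesgue_on {0..\<tau>}. orth_proj (T t) (vector_derivative W (at t)) = 0)"

lemmas has_vector_derivative_inner =
  bounded_bilinear.has_vector_derivative[OF bounded_bilinear_inner]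

text \<open>Almost everywhere the derivative of each field is orthogonal to \<open>T t\<close>,
  which contains the other field, so both terms of the product rule vanish.\<close>

lemma parallel_along_inner_const:
  fixes W1 W2 :: "real \<Rightarrow> 'b::euclidean_space"
  assumes T: "\<And>t. t \<in> {0..\<tau>} \<Longrightarrow> subspace (T t)"
    and W: "parallel_along \<tau> T W1" "parallel_along \<tau> T W2" and t: "t \<in> {0..\<tau>}"
  shows "W1 t \<bullet> W2 t = W1 0 \<bullet> W2 0"
proof -
  have "0 \<le> \<tau>" using t by simp
  have AC: "abs_cont_on 0 \<tau> W1" "abs_cont_on 0 \<tau> W2"
    using W by (auto simp: parallel_along_def section_along_def)
  have in_T: "W1 t \<in> T t" "W2 t \<in> T t" if "t \<in> {0..\<tau>}" for t
    using W that by (auto simp: parallel_along_def section_along_def)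
  have "AE t in lebesgue_on {0..\<tau>}. ((\<lambda>t. W1 t \<bullet> W2 t) has_vector_derivative 0) (at t)"
    using AE_lebesgue_on_interior abs_cont_on_AE_has_vector_derivative[OF AC(1) \<open>0 \<le> \<tau>\<close>]
      abs_cont_on_AE_has_vector_derivative[OF AC(2) \<open>0 \<le> \<tau>\<close>]
      W(1)[unfolded parallel_along_def, THEN conjunct2] W(2)[unfolded parallel_along_def, THEN conjunct2]
  proof eventually_elim
    case (elim t)
    then have t: "t \<in> {0..\<tau>}" by auto
    have "W1 t \<bullet> vector_derivative W2 (at t) = 0" "W2 t \<bullet> vector_derivative W1 (at t) = 0"
      using elim(4,5) in_T[OF t] orth_proj_eq_0_iff[OF T[OF t]] by blast+
    then show ?case
      using has_vector_derivative_inner[OF elim(2,3)] by (simp add: inner_commute)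
  qed
  from abs_cont_on_AE_zero_derivative[OF abs_cont_on_inner[OF AC] this] t show ?thesis
    unfolding atLeastAtMost_iff by blast
qed

text \<open>The solution of \<open>w' = P' w\<close>, where \<open>P t\<close> is the projection onto \<open>T t\<close>, stays in \<open>T\<close>: the vector
  \<open>z = w - P w\<close> is orthogonal to \<open>T\<close> while \<open>z' = - P w'\<close> lies in \<open>T\<close>, so the norm of \<open>z\<close> is constant.
  Then \<open>w = P w\<close> yields \<open>w' = P w' + P' w = P w' + w'\<close>, that is, \<open>P w' = 0\<close>.\<close>

lemma parallel_along_exists:
  fixes w0 :: "'b::euclidean_space"
  assumes "0 \<le> \<tau>" and T: "\<And>t. t \<in> {0..\<tau>} \<Longrightarrow> subspace (T t)"
    and AC: "\<And>v. abs_cont_on 0 \<tau> (\<lambda>t. orth_proj (T t) v)" and w0: "w0 \<in> T 0"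
  shows "\<exists>W. parallel_along \<tau> T W \<and> W 0 = w0"
proof -
  define P where "P t = orth_proj (T t)" for t
  have "\<exists>g. indefinite_integral_on 0 \<tau> (\<lambda>t. P t v) g" for v
    unfolding P_def by (rule abs_cont_on_imp_indefinite_integral[OF AC \<open>0 \<le> \<tau>\<close>])
  then obtain g where g: "\<And>v. indefinite_integral_on 0 \<tau> (\<lambda>t. P t v) (g v)" by metis
  \<comment> \<open>Almost everywhere \<open>B t u\<close> is the derivative at \<open>t\<close> of
    \<open>P\<close> applied to the fixed vector \<open>u\<close>. The densities \<open>g v\<close>
    stand in for derivatives because they are defined at every time.\<close>
  define B where "B t u = (\<Sum>i\<in>Basis. (u \<bullet> i) *\<^sub>R g i t)" for t u
  have "g i absolutely_integrable_on {0..\<tau>}" for i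
    using g[of i] by (simp add: indefinite_integral_on_def)
  then obtain w where w: "w 0 = w0" "indefinite_integral_on 0 \<tau> w (\<lambda>t. B t (w t))"
    using linear_ode_solution[OF \<open>0 \<le> \<tau>\<close>, of g w0] unfolding B_def by blast
  have wAC: "abs_cont_on 0 \<tau> w" by (rule indefinite_integral_imp_abs_cont_on[OF w(2)])
  have lin: "linear (P t)" if "t \<in> {0..\<tau>}" for t
    unfolding P_def by (rule linear_orth_proj[OF T[OF that]])
  have P_sum: "P t u = (\<Sum>i\<in>Basis. (u \<bullet> i) *\<^sub>R P t i)" if "t \<in> {0..\<tau>}" for t u
  proof -
    have "P t u = P t (\<Sum>i\<in>Basis. (u \<bullet> i) *\<^sub>R i)" by (simp add: euclidean_representation)
    also have "\<dots> = (\<Sum>i\<in>Basis. (u \<bullet> i) *\<^sub>R P t i)"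
      using lin[OF that] by (simp add: linear_sum linear_scale)
    finally show ?thesis .
  qed
  \<comment> \<open>For times in \<open>{0..\<tau>}\<close> this is \<open>P t (w t)\<close>.
    Expanding \<open>w t\<close> reduces absolute continuity and differentiability to the curves
    \<open>P t i\<close> with \<open>i\<close> fixed.\<close>
  define S where "S t = (\<Sum>i\<in>Basis. (w t \<bullet> i) *\<^sub>R P t i)" for t
  have PAC: "abs_cont_on 0 \<tau> (\<lambda>t. P t i)" for i unfolding P_def by (rule AC)
  have SAC: "abs_cont_on 0 \<tau> S"
    unfolding S_def[abs_def]
    by (intro abs_cont_on_sum abs_cont_on_scaleR abs_cont_on_inner abs_cont_on_const wAC PAC)
  have "AE t in lebesgue_on {0..\<tau>}. ((\<lambda>t. P t i) has_vector_derivative g i t) (at t)" for i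
    unfolding AE_lebesgue_on_interval_iff by (rule indefinite_integral_has_vector_derivative[OF g])
  then have AEg: "AE t in lebesgue_on {0..\<tau>}. \<forall>i\<in>Basis. ((\<lambda>t. P t i) has_vector_derivative g i t) (at t)"
    by (intro AE_finite_allI) auto
  have "AE t in lebesgue_on {0..\<tau>}. (w has_vector_derivative B t (w t)) (at t)"
    unfolding AE_lebesgue_on_interval_iff by (rule indefinite_integral_has_vector_derivative[OF w(2)])
  then have deriv: "AE t in lebesgue_on {0..\<tau>}. t \<in> {0<..<\<tau>} \<and> (w has_vector_derivative B t (w t)) (at t) \<and>
      (S has_vector_derivative (P t (B t (w t)) + B t (w t))) (at t)"
    using AEg AE_lebesgue_on_interior
  proof eventually_elim
    case (elim t)
    have "(S has_vector_derivative (\<Sum>i\<in>Basis. (w t \<bullet> i) *\<^sub>R g i t + (B t (w t) \<bullet> i) *\<^sub>R P t i)) (at t)"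
      unfolding S_def[abs_def]
    proof (rule has_vector_derivative_sum)
      fix i :: 'b assume i: "i \<in> Basis"
      have "((\<lambda>t. w t \<bullet> i) has_vector_derivative (B t (w t) \<bullet> i)) (at t)"
        by (rule bounded_linear.has_vector_derivative[OF bounded_linear_inner_left elim(1)])
      from bounded_bilinear.has_vector_derivative[OF bounded_bilinear_scaleR this bspec[OF elim(2) i]]
      show "((\<lambda>t. (w t \<bullet> i) *\<^sub>R P t i) has_vector_derivative
          ((w t \<bullet> i) *\<^sub>R g i t + (B t (w t) \<bullet> i) *\<^sub>R P t i)) (at t)" .
    qed
    moreover have "(\<Sum>i\<in>Basis. (w t \<bullet> i) *\<^sub>R g i t + (B t (w t) \<bullet> i) *\<^sub>R P t i) = P t (B t (w t)) + B t (w t)"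
      using elim(3) P_sum[of t "B t (w t)"] by (simp add: sum.distrib B_def add.commute)
    ultimately show ?case using elim by simp
  qed
  define z where "z t = w t - S t" for t
  have zAC: "abs_cont_on 0 \<tau> z" unfolding z_def[abs_def] by (intro abs_cont_on_diff wAC SAC)
  have S_eq: "S t = P t (w t)" if "t \<in> {0..\<tau>}" for t
    unfolding S_def by (rule P_sum[OF that, symmetric])
  have z_orth: "z t \<bullet> u = 0" if "t \<in> {0..\<tau>}" "u \<in> T t" for t u
    unfolding z_def S_eq[OF that(1)] P_def by (rule orth_proj_orthogonal[OF T[OF that(1)] that(2)])
  have "AE t in lebesgue_on {0..\<tau>}. ((\<lambda>t. z t \<bullet> z t) has_vector_derivative 0) (at t)"
    using deriv
  proof eventually_elim
    case (elim t)
    have t: "t \<in> {0..\<tau>}" using elim[THEN conjunct1] by simp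
    have "(z has_vector_derivative - P t (B t (w t))) (at t)"
      unfolding z_def[abs_def] using has_vector_derivative_diff[OF elim[THEN conjunct2, THEN conjunct1]
          elim[THEN conjunct2, THEN conjunct2]] by simp
    from has_vector_derivative_inner[OF this this]
    have "((\<lambda>t. z t \<bullet> z t) has_vector_derivative
        (z t \<bullet> - P t (B t (w t)) + - P t (B t (w t)) \<bullet> z t)) (at t)" .
    moreover have "z t \<bullet> P t (B t (w t)) = 0"
      unfolding P_def by (rule z_orth[OF t orth_proj_in[OF T[OF t]]])
    ultimately show ?case by (simp only: inner_minus_left inner_minus_right inner_commute[of _ "z t"])
        simp
  qed
  note AE_z = this
  have z_const: "z t \<bullet> z t = z 0 \<bullet> z 0" if "t \<in> {0..\<tau>}" for t
    by (rule abs_cont_on_AE_zero_derivative[OF abs_cont_on_inner[OF zAC zAC] AE_z]) (use that in auto)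
  have z0: "z 0 = 0"
  proof -
    have "S 0 = w0"
      using S_eq[of 0] \<open>0 \<le> \<tau>\<close> orth_proj_idem[OF T[of 0] w0] w(1) unfolding P_def by simp
    then show ?thesis by (simp add: z_def w(1))
  qed
  have wS: "w t = S t" if "t \<in> {0..\<tau>}" for t
  proof -
    have "z t \<bullet> z t = 0" unfolding z_const[OF that] z0 by simp
    then show ?thesis by (simp add: z_def)
  qed
  have "section_along \<tau> T w"
    unfolding section_along_def
  proof (intro conjI ballI wAC)
    show "w t \<in> T t" if "t \<in> {0..\<tau>}" for t
      by (subst trans[OF wS[OF that] S_eq[OF that]]) (simp add: P_def orth_proj_in[OF T[OF that]])
  qed
  moreover have "AE t in lebesgue_on {0..\<tau>}. orth_proj (T t) (vector_derivative w (at t)) = 0"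
    using deriv
  proof eventually_elim
    case (elim t)
    have "vector_derivative w (at t) = B t (w t)"
      by (rule vector_derivative_at[OF elim[THEN conjunct2, THEN conjunct1]])
    moreover have "vector_derivative S (at t) = P t (B t (w t)) + B t (w t)"
      by (rule vector_derivative_at[OF elim[THEN conjunct2, THEN conjunct2]])
    moreover have "vector_derivative w (at t) = vector_derivative S (at t)"
      by (rule vector_derivative_cong_interval[OF elim[THEN conjunct1] wS])
    ultimately show ?case by (simp add: P_def)
  qed
  ultimately show ?thesis using w(1) unfolding parallel_along_def by blast
qed

definition parallel_frame_along ::
    "real \<Rightarrow> (real \<Rightarrow> 'b::real_inner set) \<Rightarrow> ('k::finite \<Rightarrow> real \<Rightarrow> 'b) \<Rightarrow> bool" where
  "parallel_frame_along \<tau> T E \<longleftrightarrow> (\<forall>k. parallel_along \<tau> T (E k)) \<and>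
     (\<forall>t\<in>{0..\<tau>}. orthonormal_frame (T t) (\<lambda>k. E k t))"

lemma parallel_frame_along_exists:
  fixes e :: "'k::finite \<Rightarrow> 'b::euclidean_space"
  assumes "0 \<le> \<tau>" and T: "\<And>t. t \<in> {0..\<tau>} \<Longrightarrow> subspace (T t)" "\<And>t. t \<in> {0..\<tau>} \<Longrightarrow> dim (T t) = CARD('k)"
    and AC: "\<And>v. abs_cont_on 0 \<tau> (\<lambda>t. orth_proj (T t) v)" and e: "orthonormal_frame (T 0) e"
  shows "\<exists>E. parallel_frame_along \<tau> T E \<and> (\<forall>k. E k 0 = e k)"
proof -
  have "\<exists>W. parallel_along \<tau> T W \<and> W 0 = e k" for k
    by (rule parallel_along_exists[OF \<open>0 \<le> \<tau>\<close> T(1) AC orthonormal_frameD(1)[OF e]])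
  then obtain E where E: "\<And>k. parallel_along \<tau> T (E k)" "\<And>k. E k 0 = e k" by metis
  have "orthonormal_frame (T t) (\<lambda>k. E k t)" if t: "t \<in> {0..\<tau>}" for t
  proof (rule orthonormal_frameI[OF T(1)[OF t] T(2)[OF t]])
    show "E k t \<in> T t" for k
      using E(1)[of k] t by (auto simp: parallel_along_def section_along_def)
    show "E k t \<bullet> E l t = (if k = l then 1 else 0)" for k l
      using parallel_along_inner_const[OF T(1) E(1)[of k] E(1)[of l] t] E(2) orthonormal_frameD(2)[OF e]
      by simp
  qed
  then show ?thesis using E unfolding parallel_frame_along_def by blast
qed

text \<open>On the ambient space the map vanishes on vectors orthogonal to all \<open>f l\<close>.
  This matches \<open>ac_curve_P\<close>, where a normal isometry is extended by 0 on the tangent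
  space.\<close>

definition frame_map :: "('k::finite \<Rightarrow> 'b::real_inner) \<Rightarrow> ('k \<Rightarrow> 'b) \<Rightarrow> real ^ 'k ^ 'k \<Rightarrow> 'b \<Rightarrow> 'b" where
  "frame_map f f' C v = (\<Sum>k\<in>UNIV. \<Sum>l\<in>UNIV. (C $ k $ l * (f l \<bullet> v)) *\<^sub>R f' k)"

lemma parallel_frame_alongD:
  assumes "parallel_frame_along \<tau> T E"
  shows "abs_cont_on 0 \<tau> (E k)" "t \<in> {0..\<tau>} \<Longrightarrow> orthonormal_frame (T t) (\<lambda>k. E k t)"
    and "AE t in lebesgue_on {0..\<tau>}. orth_proj (T t) (vector_derivative (E k) (at t)) = 0"
  using assms unfolding parallel_frame_along_def parallel_along_def section_along_def by blast+

lemma abs_cont_on_frame_map: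
  fixes W :: "real \<Rightarrow> 'b::euclidean_space"
  assumes E: "parallel_frame_along \<tau> T E" and E': "parallel_frame_along \<tau> T' E'" and W: "abs_cont_on 0 \<tau> W"
  shows "abs_cont_on 0 \<tau> (\<lambda>t. frame_map (\<lambda>l. E l t) (\<lambda>k. E' k t) C (W t))"
  unfolding frame_map_def
  by (intro abs_cont_on_sum abs_cont_on_scaleR abs_cont_on_mult abs_cont_on_const abs_cont_on_inner W
      parallel_frame_alongD(1)[OF E] parallel_frame_alongD(1)[OF E'])

text \<open>The derivative of \<open>E l\<close> is orthogonal to \<open>W t\<close>, so a
  coefficient \<open>E l t \<bullet> W t\<close> is differentiated through \<open>W\<close> alone;
  the derivative of \<open>E' k\<close> is killed by the projection onto \<open>T' t\<close>. With
  \<open>C\<close> constant nothing else remains. Conditions (II) and (III) are both read off from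
  this.\<close>

lemma orth_proj_frame_map_derivative:
  fixes W :: "real \<Rightarrow> 'b::euclidean_space"
  assumes "0 \<le> \<tau>" and T: "\<And>t. t \<in> {0..\<tau>} \<Longrightarrow> subspace (T t)" and T': "\<And>t. t \<in> {0..\<tau>} \<Longrightarrow> subspace (T' t)"
    and E: "parallel_frame_along \<tau> T E" and E': "parallel_frame_along \<tau> T' E'" and W: "section_along \<tau> T W"
  shows "AE t in lebesgue_on {0..\<tau>}.
    orth_proj (T' t) (vector_derivative (\<lambda>s. frame_map (\<lambda>l. E l s) (\<lambda>k. E' k s) C (W s)) (at t)) =
    frame_map (\<lambda>l. E l t) (\<lambda>k. E' k t) C (orth_proj (T t) (vector_derivative W (at t)))"
proof -
  have WAC: "abs_cont_on 0 \<tau> W" using W by (simp add: section_along_def)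
  have AE_E: "AE t in lebesgue_on {0..\<tau>}. \<forall>k. (E k has_vector_derivative vector_derivative (E k) (at t)) (at t) \<and>
      orth_proj (T t) (vector_derivative (E k) (at t)) = 0"
    using abs_cont_on_AE_has_vector_derivative[OF parallel_frame_alongD(1)[OF E] \<open>0 \<le> \<tau>\<close>]
      parallel_frame_alongD(3)[OF E] by (simp add: AE_all_countable)
  have AE_E': "AE t in lebesgue_on {0..\<tau>}. \<forall>k. (E' k has_vector_derivative vector_derivative (E' k) (at t)) (at t) \<and>
      orth_proj (T' t) (vector_derivative (E' k) (at t)) = 0"
    using abs_cont_on_AE_has_vector_derivative[OF parallel_frame_alongD(1)[OF E'] \<open>0 \<le> \<tau>\<close>]
      parallel_frame_alongD(3)[OF E'] by (simp add: AE_all_countable)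
  show ?thesis
    using AE_lebesgue_on_interior abs_cont_on_AE_has_vector_derivative[OF WAC \<open>0 \<le> \<tau>\<close>] AE_E AE_E'
  proof eventually_elim
    case (elim t)
    then have t: "t \<in> {0..\<tau>}" by auto
    define D where "D = vector_derivative W (at t)"
    define D' where "D' k = vector_derivative (E' k) (at t)" for k
    note frame = parallel_frame_alongD(2)[OF E t] and frame' = parallel_frame_alongD(2)[OF E' t]
    have WT: "W t \<in> T t" using W t by (simp add: section_along_def)
    have "((\<lambda>t. E l t \<bullet> W t) has_vector_derivative (E l t \<bullet> D)) (at t)" for l
    proof -
      have "vector_derivative (E l) (at t) \<bullet> W t = 0"
        using elim(3) orth_proj_eq_0_iff[OF T[OF t]] WT by (metis inner_commute)
      then show ?thesis
        using has_vector_derivative_inner[OF elim(3)[rule_format, of l, THEN conjunct1] elim(2)]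
        by (simp add: D_def)
    qed
    then have coeff: "((\<lambda>t. C $ k $ l * (E l t \<bullet> W t)) has_vector_derivative (C $ k $ l * (E l t \<bullet> D))) (at t)" for k l
      by (rule bounded_linear.has_vector_derivative[OF bounded_linear_mult_right])
    have "((\<lambda>s. frame_map (\<lambda>l. E l s) (\<lambda>k. E' k s) C (W s)) has_vector_derivative
        (\<Sum>k\<in>UNIV. \<Sum>l\<in>UNIV. (C $ k $ l * (E l t \<bullet> W t)) *\<^sub>R D' k + (C $ k $ l * (E l t \<bullet> D)) *\<^sub>R E' k t)) (at t)"
      unfolding frame_map_def
    proof (intro has_vector_derivative_sum)
      fix k l
      have "(E' k has_vector_derivative D' k) (at t)" using elim(4) by (simp add: D'_def)
      from bounded_bilinear.has_vector_derivative[OF bounded_bilinear_scaleR coeff this]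
      show "((\<lambda>s. (C $ k $ l * (E l s \<bullet> W s)) *\<^sub>R E' k s) has_vector_derivative
          ((C $ k $ l * (E l t \<bullet> W t)) *\<^sub>R D' k + (C $ k $ l * (E l t \<bullet> D)) *\<^sub>R E' k t)) (at t)" .
    qed
    then have "orth_proj (T' t) (vector_derivative (\<lambda>s. frame_map (\<lambda>l. E l s) (\<lambda>k. E' k s) C (W s)) (at t)) =
        orth_proj (T' t) (\<Sum>k\<in>UNIV. \<Sum>l\<in>UNIV. (C $ k $ l * (E l t \<bullet> W t)) *\<^sub>R D' k + (C $ k $ l * (E l t \<bullet> D)) *\<^sub>R E' k t)"
      by (simp add: vector_derivative_at)
    also have "\<dots> = (\<Sum>k\<in>UNIV. \<Sum>l\<in>UNIV. (C $ k $ l * (E l t \<bullet> D)) *\<^sub>R E' k t)"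
    proof -
      have "orth_proj (T' t) (D' k) = 0" for k using elim(4) by (simp add: D'_def)
      moreover have "orth_proj (T' t) (E' k t) = E' k t" for k
        by (rule orth_proj_idem[OF T'[OF t] orthonormal_frameD(1)[OF frame']])
      ultimately show ?thesis
        using linear_orth_proj[OF T'[OF t]] by (simp add: linear_sum linear_add linear_scale)
    qed
    also have "\<dots> = frame_map (\<lambda>l. E l t) (\<lambda>k. E' k t) C (orth_proj (T t) D)"
      unfolding frame_map_def using orth_proj_inner[OF T[OF t] orthonormal_frameD(1)[OF frame]] by simp
    finally show ?case by (simp add: D_def)
  qed
qed

section \<open>Orientation and dependence of projections on the subspace\<close>

text \<open>For injective \<open>s\<close> this is, up to the order of indices, the block diagonal
  matrix with blocks \<open>G\<close> and the identity; \<open>s\<close> will be \<open>Inl\<close>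
  or \<open>Inr\<close>.\<close>

definition matrix_extend :: "('m::finite \<Rightarrow> 'k::finite) \<Rightarrow> real ^ 'm ^ 'm \<Rightarrow> real ^ 'k ^ 'k" where
  "matrix_extend s G =
     (\<chi> i j. if i \<in> range s \<and> j \<in> range s then G $ inv s i $ inv s j else of_bool (i = j))"

lemma det_transvection:
  fixes m n :: "'m::finite"
  assumes "m \<noteq> n"
  shows "det ((\<chi> i j. if i = m \<and> j = n then c else of_bool (i = j)) :: real ^ 'm ^ 'm) = 1"
proof -
  have "((\<chi> i j. if i = m \<and> j = n then c else of_bool (i = j)) :: real ^ 'm ^ 'm) =
      (\<chi> k. if k = m then row m (mat 1) + c *s row n (mat 1) else row k (mat 1))"
    using assms by (auto simp: vec_eq_iff row_def mat_def)
  then show ?thesis using det_row_operation[OF assms, of "mat 1 :: real ^ 'm ^ 'm" c] by simp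
qed

lemma det_transposed_mat_1:
  fixes m n :: "'m::finite"
  assumes "m \<noteq> n"
  shows "det ((\<chi> i j. mat 1 $ i $ Transposition.transpose m n j) :: real ^ 'm ^ 'm) = - 1"
  using det_permute_columns[of "Transposition.transpose m n" "mat 1 :: real ^ 'm ^ 'm"] assms
  by (simp add: permutes_swap_id sign_swap_id)

lemma matrix_extend_mult:
  fixes A B :: "real ^ 'm::finite ^ 'm" and s :: "'m \<Rightarrow> 'k::finite"
  assumes "inj s"
  shows "matrix_extend s (A ** B) = matrix_extend s A ** matrix_extend s B"
proof -
  have "(\<Sum>x\<in>UNIV. matrix_extend s A $ i $ x * matrix_extend s B $ x $ j) = matrix_extend s (A ** B) $ i $ j" for i j
  proof (cases "i \<in> range s")
    case True
    have "(\<Sum>x\<in>UNIV. matrix_extend s A $ i $ x * matrix_extend s B $ x $ j) =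
        (\<Sum>x\<in>range s. matrix_extend s A $ i $ x * matrix_extend s B $ x $ j)"
      using True by (intro sum.mono_neutral_right) (auto simp: matrix_extend_def)
    also have "\<dots> = (\<Sum>a\<in>UNIV. A $ inv s i $ a * matrix_extend s B $ s a $ j)"
      using True assms by (simp add: sum.reindex matrix_extend_def)
    also have "\<dots> = matrix_extend s (A ** B) $ i $ j"
      using True assms by (auto simp: matrix_extend_def matrix_matrix_mult_def intro!: sum.neutral)
    finally show ?thesis .
  next
    case False
    have "(\<Sum>x\<in>UNIV. matrix_extend s A $ i $ x * matrix_extend s B $ x $ j) =
        (\<Sum>x\<in>UNIV. if x = i then matrix_extend s B $ i $ j else 0)"
      using False by (intro sum.cong) (auto simp: matrix_extend_def)
    then show ?thesis using False by (simp add: matrix_extend_def)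
  qed
  then show ?thesis by (simp add: vec_eq_iff matrix_matrix_mult_def)
qed

text \<open>Padding by the identity is multiplicative, and zero rows, diagonal matrices,
  transpositions and transvections keep their type. Induction over such factors avoids sums over
  permutations.\<close>

lemma det_matrix_extend:
  fixes G :: "real ^ 'm::finite ^ 'm" and s :: "'m \<Rightarrow> 'k::finite"
  assumes s: "inj s"
  shows "det (matrix_extend s G) = det G"
proof (induction G rule: induct_matrix_elementary)
  case (1 A B)
  then show ?case by (simp add: matrix_extend_mult[OF s] det_mul)
next
  case (2 A i)
  have "row (s i) (matrix_extend s A) = 0"
    using "2" s by (auto simp: vec_eq_iff row_def matrix_extend_def)
  then show ?case using "2" by (simp add: det_zero_row)
next
  case (3 A)
  have "matrix_extend s A $ i $ j = 0" if "i \<noteq> j" for i j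
    using that s by (auto simp: matrix_extend_def intro!: "3")
  then have "det (matrix_extend s A) = (\<Prod>i\<in>UNIV. matrix_extend s A $ i $ i)"
    by (rule det_diagonal)
  also have "\<dots> = (\<Prod>i\<in>range s. matrix_extend s A $ i $ i)"
    by (intro prod.mono_neutral_right) (auto simp: matrix_extend_def)
  also have "\<dots> = (\<Prod>a\<in>UNIV. A $ a $ a)"
    using s by (simp add: prod.reindex matrix_extend_def)
  finally show ?case using det_diagonal[OF "3"] by simp
next
  case (4 m n)
  have "matrix_extend s (\<chi> i j. mat 1 $ i $ Transposition.transpose m n j) =
      (\<chi> i j. mat 1 $ i $ Transposition.transpose (s m) (s n) j)"
    using s by (auto simp: vec_eq_iff matrix_extend_def mat_def Transposition.transpose_def inj_eq)
  moreover have "s m \<noteq> s n" using "4" s by (simp add: inj_eq)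
  ultimately show ?case by (simp add: det_transposed_mat_1 "4")
next
  case (5 m n c)
  have "matrix_extend s (\<chi> i j. if i = m \<and> j = n then c else of_bool (i = j)) =
      (\<chi> i j. if i = s m \<and> j = s n then c else of_bool (i = j))"
    using s by (auto simp: vec_eq_iff matrix_extend_def inj_eq)
  moreover have "s m \<noteq> s n" using "5" s by (simp add: inj_eq)
  ultimately show ?case by (simp add: det_transvection "5")
qed

definition joint_matrix ::
    "('n::finite \<Rightarrow> real ^ ('n + 'v::finite)) \<Rightarrow> ('v \<Rightarrow> real ^ ('n + 'v)) \<Rightarrow> real ^ ('n + 'v) ^ ('n + 'v)" where
  "joint_matrix e f = (\<chi> i j. (case j of Inl k \<Rightarrow> e k | Inr l \<Rightarrow> f l) $ i)"

lemma sum_UNIV_Plus: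
  "(\<Sum>x\<in>UNIV. g x) = (\<Sum>a\<in>UNIV. g (Inl a)) + (\<Sum>b\<in>UNIV. g (Inr b))"
  for g :: "'n::finite + 'v::finite \<Rightarrow> 'b::comm_monoid_add"
  unfolding UNIV_Plus_UNIV[symmetric] by (subst sum.Plus) (auto simp: comp_def)

text \<open>Changing the first group of columns by \<open>G\<close> is multiplication from the right
  by the block matrix with blocks \<open>G\<close> and the identity.\<close>

lemma det_joint_matrix_left:
  assumes "\<And>k. e' k = (\<Sum>a\<in>UNIV. G $ a $ k *\<^sub>R e a)"
  shows "det (joint_matrix e' f) = det (joint_matrix e f) * det G"
proof -
  have "joint_matrix e' f $ i $ j = (joint_matrix e f ** matrix_extend Inl G) $ i $ j" for i j
  proof (cases j)
    case (Inl k)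
    then show ?thesis
      by (simp add: joint_matrix_def matrix_matrix_mult_def sum_UNIV_Plus matrix_extend_def assms
          mult.commute image_iff)
  next
    case (Inr l)
    then show ?thesis
      by (simp add: joint_matrix_def matrix_matrix_mult_def sum_UNIV_Plus matrix_extend_def image_iff)
  qed
  then have "joint_matrix e' f = joint_matrix e f ** matrix_extend Inl G" by (simp add: vec_eq_iff)
  then show ?thesis by (simp add: det_mul det_matrix_extend)
qed

lemma det_joint_matrix_right:
  assumes "\<And>l. f' l = (\<Sum>b\<in>UNIV. H $ b $ l *\<^sub>R f b)"
  shows "det (joint_matrix e f') = det (joint_matrix e f) * det H"
proof -
  have "joint_matrix e f' $ i $ j = (joint_matrix e f ** matrix_extend Inr H) $ i $ j" for i j
  proof (cases j)
    case (Inl k)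
    then show ?thesis
      by (simp add: joint_matrix_def matrix_matrix_mult_def sum_UNIV_Plus matrix_extend_def image_iff)
  next
    case (Inr l)
    then show ?thesis
      by (simp add: joint_matrix_def matrix_matrix_mult_def sum_UNIV_Plus matrix_extend_def assms
          mult.commute image_iff)
  qed
  then have "joint_matrix e f' = joint_matrix e f ** matrix_extend Inr H" by (simp add: vec_eq_iff)
  then show ?thesis by (simp add: det_mul det_matrix_extend)
qed

text \<open>In a linear relation between the columns, the inner product with \<open>f l\<close>
  removes the part in \<open>S\<close> and isolates the coefficient of \<open>f l\<close>. What
  remains is a relation among the \<open>e k\<close>.\<close>

lemma det_joint_matrix_nonzero:
  fixes e :: "'n::finite \<Rightarrow> real ^ ('n + 'v::finite)"
  assumes e: "\<And>k. e k \<in> S" "\<And>a. (\<Sum>k\<in>UNIV. a k *\<^sub>R e k) = 0 \<Longrightarrow> (\<forall>k. a k = 0)"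
    and S: "subspace S" and f: "orthonormal_frame (S\<^sup>\<bottom>) f"
  shows "det (joint_matrix e f) \<noteq> 0"
proof -
  let ?A = "joint_matrix e f"
  have "z = 0" if "?A *v z = 0" for z
  proof -
    let ?u = "\<Sum>k\<in>UNIV. z $ Inl k *\<^sub>R e k" and ?w = "\<Sum>l\<in>UNIV. z $ Inr l *\<^sub>R f l"
    have "?A *v z = ?u + ?w"
      by (simp add: vec_eq_iff matrix_vector_mult_def joint_matrix_def sum_UNIV_Plus mult.commute)
    then have sum: "?u + ?w = 0" using that by simp
    have u: "?u \<in> S" using e(1) S by (intro subspace_sum subspace_scale) auto
    have fS: "f l \<in> S\<^sup>\<bottom>" for l using f by (rule orthonormal_frameD)
    have coeff: "f l \<bullet> ?w = z $ Inr l" for l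
      by (simp add: inner_sum_right orthonormal_frameD(2)[OF f] if_distrib cong: if_cong)
    have "f l \<bullet> ?u = 0" for l
      using fS[of l] u by (auto simp: orthogonal_comp_def orthogonal_def inner_commute)
    then have "f l \<bullet> (?u + ?w) = z $ Inr l" for l using coeff by (simp add: inner_add_right)
    then have r: "z $ Inr l = 0" for l unfolding sum by simp
    then have "?u = 0" using sum by simp
    then have "z $ Inl k = 0" for k using e(2)[of "\<lambda>k. z $ Inl k"] by simp
    then have "z $ i = 0" for i using r by (cases i) auto
    then show "z = 0" by (simp add: vec_eq_iff)
  qed
  then have "\<exists>B. B ** ?A = mat 1" unfolding matrix_left_invertible_ker by blast
  then have "invertible ?A" by (simp add: invertible_left_inverse)
  then show ?thesis by (simp add: invertible_det_nz)
qed

lemma continuous_on_det: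
  fixes A :: "real \<Rightarrow> real ^ 'k::finite ^ 'k"
  assumes "\<And>i j. continuous_on S (\<lambda>t. A t $ i $ j)"
  shows "continuous_on S (\<lambda>t. det (A t))"
  unfolding det_def by (intro continuous_intros assms)

lemma continuous_nonzero_same_sign:
  fixes f :: "real \<Rightarrow> real"
  assumes "continuous_on {u..v} f" "\<And>t. t \<in> {u..v} \<Longrightarrow> f t \<noteq> 0" "u \<le> v"
  shows "0 < f u \<longleftrightarrow> 0 < f v"
proof (rule ccontr)
  assume "\<not> ?thesis"
  moreover have "f u \<noteq> 0" "f v \<noteq> 0" using assms(2,3) by auto
  ultimately have "f u \<le> 0 \<and> 0 \<le> f v \<or> f v \<le> 0 \<and> 0 \<le> f u" by linarith
  then obtain t where "u \<le> t" "t \<le> v" "f t = 0"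
    using IVT'[of f u 0 v, OF _ _ assms(3,1)] IVT2'[of f v 0 u, OF _ _ assms(3,1)] by blast
  then show False using assms(2) by auto
qed

text \<open>The sum of the total variations serves as \<open>V\<close>. A single scalar majorant
  allows increments of a linear map to be bounded uniformly in its argument.\<close>

lemma abs_cont_on_common_majorant:
  fixes f :: "'i::finite \<Rightarrow> real \<Rightarrow> 'b::real_normed_vector"
  assumes f: "\<And>i. abs_cont_on a b (f i)"
  shows "\<exists>V :: real \<Rightarrow> real. abs_cont_on a b V \<and>
    (\<forall>u v. a \<le> u \<longrightarrow> u \<le> v \<longrightarrow> v \<le> b \<longrightarrow> (\<Sum>i\<in>UNIV. norm (f i v - f i u)) \<le> norm (V v - V u))"
proof (intro exI conjI allI impI)
  let ?V = "\<lambda>t. \<Sum>i\<in>UNIV. total_variation (f i) a t"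
  show "abs_cont_on a b ?V" by (intro abs_cont_on_sum abs_cont_on_total_variation f)
  fix u v assume uv: "a \<le> u" "u \<le> v" "v \<le> b"
  have "norm (f i v - f i u) \<le> total_variation (f i) a v - total_variation (f i) a u" for i
    using total_variation_superadditive[OF f uv, of i] by linarith
  then have "(\<Sum>i\<in>UNIV. norm (f i v - f i u)) \<le> ?V v - ?V u"
    unfolding sum_subtractf[symmetric] by (intro sum_mono)
  then show "(\<Sum>i\<in>UNIV. norm (f i v - f i u)) \<le> norm (?V v - ?V u)" by simp
qed

section \<open>Dependence of projections on the subspace\<close>

lemma orth_proj_norm_le:
  fixes S :: "'b::euclidean_space set"
  assumes "subspace S"
  shows "norm (orth_proj S v) \<le> norm v" and "norm (v - orth_proj S v) \<le> norm v"
proof -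
  let ?y = "orth_proj S v"
  have "(v - ?y) \<bullet> ?y = 0" by (rule orth_proj_orthogonal[OF assms orth_proj_in[OF assms]])
  then have "v \<bullet> v = ?y \<bullet> ?y + (v - ?y) \<bullet> (v - ?y)"
    by (simp add: inner_diff_left inner_diff_right inner_commute)
  then show "norm ?y \<le> norm v" "norm (v - ?y) \<le> norm v"
    using inner_ge_zero[of ?y] inner_ge_zero[of "v - ?y"] unfolding norm_le by linarith+
qed

lemma orth_proj_nearest:
  fixes S :: "'b::euclidean_space set"
  assumes S: "subspace S" and "y \<in> S"
  shows "norm (v - orth_proj S v) \<le> norm (v - y)"
proof -
  have "orth_proj S (v - y) = orth_proj S v - y"
    using linear_diff[OF linear_orth_proj[OF S], of v y] orth_proj_idem[OF assms] by simp
  then have eq: "v - orth_proj S v = (v - y) - orth_proj S (v - y)" by simp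
  show ?thesis unfolding eq by (rule orth_proj_norm_le(2)[OF S])
qed

text \<open>The hypotheses bound the gap between two subspaces in both directions. With
  \<open>P\<close>, \<open>P'\<close> the projections and \<open>r = w - P w\<close>, the difference
  is \<open>(P w - P' (P w)) - P' r\<close>. The first term is controlled by \<open>near\<close>.
  For the second, the squared norm of \<open>P' r\<close> equals its inner product with
  \<open>r\<close>, and \<open>r\<close> is orthogonal to \<open>S\<close>, so \<open>near'\<close>
  bounds it.\<close>

lemma orth_proj_diff_le:
  fixes S S' :: "'b::euclidean_space set"
  assumes S: "subspace S" and S': "subspace S'" and "0 \<le> \<delta>"
    and near: "\<And>y. y \<in> S \<Longrightarrow> \<exists>y'\<in>S'. norm (y - y') \<le> \<delta> * norm y"
    and near': "\<And>y'. y' \<in> S' \<Longrightarrow> \<exists>y\<in>S. norm (y' - y) \<le> \<delta> * norm y'"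
  shows "norm (orth_proj S w - orth_proj S' w) \<le> 2 * \<delta> * norm w"
proof -
  let ?P = "orth_proj S" and ?P' = "orth_proj S'"
  define r where "r = w - ?P w"
  have "norm (?P w - ?P' (?P w)) \<le> \<delta> * norm (?P w)"
    using near[OF orth_proj_in[OF S, of w]] orth_proj_nearest[OF S', of _ "?P w"] order_trans by blast
  also have "\<dots> \<le> \<delta> * norm w"
    using orth_proj_norm_le(1)[OF S, of w] \<open>0 \<le> \<delta>\<close> by (rule mult_left_mono)
  finally have 1: "norm (?P w - ?P' (?P w)) \<le> \<delta> * norm w" .
  have 2: "norm (?P' r) \<le> \<delta> * norm r"
  proof (cases "?P' r = 0")
    case False
    have "norm (?P' r) * norm (?P' r) = ?P' r \<bullet> r"
      using orth_proj_inner[OF S' orth_proj_in[OF S', of r], of r]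
      by (simp add: power2_norm_eq_inner[symmetric] power2_eq_square)
    also have "\<dots> = (?P' r - ?P (?P' r)) \<bullet> r"
    proof -
      have "r \<bullet> ?P (?P' r) = 0"
        unfolding r_def by (rule orth_proj_orthogonal[OF S orth_proj_in[OF S]])
      then show ?thesis by (simp add: inner_diff_right inner_commute[of _ r])
    qed
    also have "\<dots> \<le> norm (?P' r - ?P (?P' r)) * norm r" by (rule norm_cauchy_schwarz)
    also have "\<dots> \<le> (\<delta> * norm (?P' r)) * norm r"
      using near'[OF orth_proj_in[OF S', of r]] orth_proj_nearest[OF S, of _ "?P' r"] order_trans
      by (intro mult_right_mono) (blast, simp)
    finally have "norm (?P' r) * norm (?P' r) \<le> norm (?P' r) * (\<delta> * norm r)" by (simp add: mult_ac)
    then show ?thesis using False by (simp add: mult_le_cancel_left)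
  qed (use \<open>0 \<le> \<delta>\<close> in simp)
  have "norm r \<le> norm w" unfolding r_def by (rule orth_proj_norm_le(2)[OF S])
  then have "\<delta> * norm r \<le> \<delta> * norm w" using \<open>0 \<le> \<delta>\<close> by (rule mult_left_mono)
  moreover have "?P w - ?P' w = (?P w - ?P' (?P w)) - ?P' r"
    by (simp add: r_def linear_diff[OF linear_orth_proj[OF S']])
  then have "norm (?P w - ?P' w) \<le> norm (?P w - ?P' (?P w)) + norm (?P' r)"
    by (metis norm_triangle_ineq4)
  ultimately show ?thesis using 1 2 by linarith
qed

text \<open>The map \<open>A\<close> is linear on \<open>S\<close> only, which rules out
  \<open>linear_sum\<close>; the expansion is built by induction over finite sets, with all partial
  sums in \<open>S\<close>.\<close>

lemma frame_expansion:
  fixes A :: "'b::real_inner \<Rightarrow> 'c::real_vector"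
  assumes S: "subspace S" and A: "\<And>u v a b. u \<in> S \<Longrightarrow> v \<in> S \<Longrightarrow> A (a *\<^sub>R u + b *\<^sub>R v) = a *\<^sub>R A u + b *\<^sub>R A v"
    and e: "orthonormal_frame S e" and v: "v \<in> S"
  shows "A v = (\<Sum>k\<in>UNIV. (e k \<bullet> v) *\<^sub>R A (e k))"
proof -
  note eS = orthonormal_frameD(1)[OF e]
  have "A (\<Sum>k\<in>K. (e k \<bullet> v) *\<^sub>R e k) = (\<Sum>k\<in>K. (e k \<bullet> v) *\<^sub>R A (e k))" if "finite K" for K
    using that
  proof induction
    case empty
    show ?case using A[OF subspace_0[OF S] subspace_0[OF S], of 0 0] by simp
  next
    case (insert k K)
    have "(\<Sum>k\<in>K. (e k \<bullet> v) *\<^sub>R e k) \<in> S"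
      by (intro subspace_sum subspace_scale S eS)
    from A[OF eS[of k] this, of "e k \<bullet> v" 1] insert show ?case by simp
  qed
  from this[of UNIV] show ?thesis by (simp add: orthonormal_frameD(3)[OF e v])
qed

section \<open>Imbedded manifolds\<close>

lemma smooth_onD:
  assumes "smooth_on S f"
  shows "y \<in> S \<Longrightarrow> (f has_derivative frechet_derivative f (at y)) (at y)"
    and "continuous_on S (\<lambda>y. frechet_derivative f (at y) v)"
    and "smooth_on S (\<lambda>y. frechet_derivative f (at y) v)"
proof -
  have Ck: "Ck_on (Suc k) S f" for k using assms unfolding smooth_on_def by blast
  show "(f has_derivative frechet_derivative f (at y)) (at y)" if "y \<in> S"
    using Ck[of 0] that unfolding Ck_on.simps by (simp add: frechet_derivative_works)
  have D: "Ck_on k S (\<lambda>y. frechet_derivative f (at y) v)" for k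
    using Ck[of k] unfolding Ck_on.simps by blast
  show "continuous_on S (\<lambda>y. frechet_derivative f (at y) v)" using D[of 0] by simp
  show "smooth_on S (\<lambda>y. frechet_derivative f (at y) v)" unfolding smooth_on_def using D by blast
qed

lemma abs_cont_on_compose_smooth:
  fixes g :: "'a::euclidean_space \<Rightarrow> 'b::real_normed_vector"
  assumes "open S" "smooth_on S g" "abs_cont_on a b f" "a \<le> b" "f ` {a..b} \<subseteq> S"
  shows "abs_cont_on a b (\<lambda>t. g (f t))"
  using abs_cont_on_compose_C1[OF assms(1) smooth_onD(1)[OF assms(2)] smooth_onD(2)[OF assms(2)] assms(3-5)]
  by simp

locale imbedded_manifold =
  fixes M :: "('p::{t2_space, second_countable_topology}, 'n::finite) riemannian"
    and \<iota> :: "'p \<Rightarrow> real ^ ('n + 'v::finite)"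
  assumes manifold: "oriented_riemannian_manifold M" and imbedding: "isometric_imbedding M \<iota>"
begin

section \<open>Charts, transition maps and coordinate Jacobians\<close>

definition local_imbedding :: "('p, 'n) chart \<Rightarrow> real ^ 'n \<Rightarrow> real ^ ('n + 'v)" where
  "local_imbedding c = \<iota> \<circ> inv_into (fst c) (snd c)"

definition jacobian :: "('p, 'n) chart \<Rightarrow> real ^ 'n \<Rightarrow> real ^ 'n \<Rightarrow> real ^ ('n + 'v)" where
  "jacobian c y = frechet_derivative (local_imbedding c) (at y)"

lemma atlas: "oriented_smooth_atlas (atlas M)"
  using manifold by (simp add: oriented_riemannian_manifold_def)

lemma metric: "riemannian_metric M"
  using manifold by (simp add: oriented_riemannian_manifold_def)

lemma charts_at_iff: "c \<in> charts_at M p \<longleftrightarrow> c \<in> atlas M \<and> p \<in> fst c"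
  by (simp add: charts_at_def)

lemma chart_exists: "\<exists>c. c \<in> charts_at M p"
proof -
  have "p \<in> (\<Union>c\<in>atlas M. fst c)" using atlas unfolding oriented_smooth_atlas_def by simp
  then show ?thesis by (auto simp: charts_at_iff)
qed

lemma is_chart: "c \<in> atlas M \<Longrightarrow> is_chart c"
  using atlas unfolding oriented_smooth_atlas_def by blast

lemma chart_homeomorphism:
  assumes "c \<in> atlas M"
  shows "open (fst c)" "open (snd c ` fst c)"
    and "homeomorphism (fst c) (snd c ` fst c) (snd c) (inv_into (fst c) (snd c))"
  using is_chart[OF assms] unfolding is_chart_def by blast+

lemma chart_inverse:
  assumes "c \<in> atlas M" "p \<in> fst c"
  shows "inv_into (fst c) (snd c) (snd c p) = p"
  using homeomorphism_apply1[OF chart_homeomorphism(3)[OF assms(1)] assms(2)] .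

lemma open_chart_overlap:
  assumes "c \<in> atlas M" "d \<in> atlas M"
  shows "open (snd c ` (fst c \<inter> fst d))"
proof -
  have "openin (top_of_set (fst c)) (fst c \<inter> fst d)"
    using chart_homeomorphism(1)[OF assms(2)] by (simp add: openin_open_Int)
  then have "openin (top_of_set (snd c ` fst c)) (snd c ` (fst c \<inter> fst d))"
    by (rule homeomorphism_imp_open_map[OF chart_homeomorphism(3)[OF assms(1)]])
  then show ?thesis
    using chart_homeomorphism(2)[OF assms(1)] openin_open_eq by blast
qed

lemma transition_apply:
  assumes "c \<in> atlas M" "p \<in> fst c"
  shows "transition c d (snd c p) = snd d p"
  using chart_inverse[OF assms] by (simp add: transition_def)

lemma transition_has_derivative:
  assumes "c \<in> charts_at M p" "d \<in> charts_at M p"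
  shows "(transition c d has_derivative frechet_derivative (transition c d) (at (snd c p))) (at (snd c p))"
proof -
  have "smooth_on (snd c ` (fst c \<inter> fst d)) (transition c d)"
    using atlas assms unfolding oriented_smooth_atlas_def charts_at_iff by blast
  then show ?thesis using smooth_onD(1) assms unfolding charts_at_iff by blast
qed

lemma det_transition_pos:
  assumes "c \<in> charts_at M p" "d \<in> charts_at M p"
  shows "0 < det (matrix (frechet_derivative (transition c d) (at (snd c p))))"
  using atlas assms unfolding oriented_smooth_atlas_def charts_at_iff by blast

lemma local_imbedding_smooth: "c \<in> atlas M \<Longrightarrow> smooth_on (snd c ` fst c) (local_imbedding c)"
  using imbedding unfolding isometric_imbedding_def local_imbedding_def by blast

lemma local_imbedding_has_derivative:
  assumes "c \<in> charts_at M p"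
  shows "(local_imbedding c has_derivative jacobian c (snd c p)) (at (snd c p))"
  unfolding jacobian_def using smooth_onD(1)[OF local_imbedding_smooth] assms
  unfolding charts_at_iff by blast

lemma linear_jacobian: "c \<in> charts_at M p \<Longrightarrow> linear (jacobian c (snd c p))"
  using local_imbedding_has_derivative has_derivative_linear by blast

text \<open>Here \<open>h\<close> and \<open>k\<close> are the expressions of one function in the
  charts \<open>d\<close> and \<open>c\<close>. The cocycle rule for transition maps and the
  transformation rule for Jacobians are both instances.\<close>

lemma chain_rule_transition:
  assumes c: "c \<in> charts_at M p" and d: "d \<in> charts_at M p"
    and h: "(h has_derivative h') (at (snd d p))" and k: "(k has_derivative k') (at (snd c p))"
    and eq: "\<And>q. q \<in> fst c \<Longrightarrow> q \<in> fst d \<Longrightarrow> h (snd d q) = k (snd c q)"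
  shows "k' w = h' (frechet_derivative (transition c d) (at (snd c p)) w)"
proof -
  let ?D = "frechet_derivative (transition c d) (at (snd c p))"
  have cd: "c \<in> atlas M" "d \<in> atlas M" "p \<in> fst c" "p \<in> fst d" using c d by (auto simp: charts_at_iff)
  have "(h has_derivative h') (at (transition c d (snd c p)))"
    using h transition_apply[OF cd(1,3)] by simp
  from diff_chain_at[OF transition_has_derivative[OF c d] this]
  have "(h \<circ> transition c d has_derivative h' \<circ> ?D) (at (snd c p))" .
  moreover have "open (snd c ` (fst c \<inter> fst d))" by (rule open_chart_overlap[OF cd(1,2)])
  moreover have "snd c p \<in> snd c ` (fst c \<inter> fst d)" using cd by blast
  moreover have "(h \<circ> transition c d) y = k y" if y: "y \<in> snd c ` (fst c \<inter> fst d)" for y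
  proof -
    obtain q where q: "q \<in> fst c" "q \<in> fst d" "y = snd c q" using y by blast
    show ?thesis unfolding comp_apply q(3) transition_apply[OF cd(1) q(1)] by (rule eq[OF q(1,2)])
  qed
  ultimately have "(k has_derivative h' \<circ> ?D) (at (snd c p))"
    by (rule has_derivative_transform_within_open)
  from has_derivative_unique[OF this k] show ?thesis by (metis comp_apply)
qed

lemma transition_cocycle:
  assumes c: "c \<in> charts_at M p" and d: "d \<in> charts_at M p" and e: "e \<in> charts_at M p"
  shows "frechet_derivative (transition c e) (at (snd c p)) w =
    frechet_derivative (transition d e) (at (snd d p)) (frechet_derivative (transition c d) (at (snd c p)) w)"
proof (rule chain_rule_transition[OF c d transition_has_derivative[OF d e] transition_has_derivative[OF c e]])
  show "transition d e (snd d q) = transition c e (snd c q)" if "q \<in> fst c" "q \<in> fst d" for q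
    using that c d by (simp add: charts_at_iff transition_apply)
qed

lemma jacobian_transition:
  assumes c: "c \<in> charts_at M p" and d: "d \<in> charts_at M p"
  shows "jacobian c (snd c p) w =
    jacobian d (snd d p) (frechet_derivative (transition c d) (at (snd c p)) w)"
proof (rule chain_rule_transition[OF c d local_imbedding_has_derivative[OF d] local_imbedding_has_derivative[OF c]])
  show "local_imbedding d (snd d q) = local_imbedding c (snd c q)" if "q \<in> fst c" "q \<in> fst d" for q
    using that c d by (simp add: charts_at_iff chart_inverse local_imbedding_def)
qed

lemma transition_self:
  assumes c: "c \<in> charts_at M p"
  shows "frechet_derivative (transition c c) (at (snd c p)) w = w"
proof -
  have cM: "c \<in> atlas M" "p \<in> fst c" using c by (auto simp: charts_at_iff)
  have "((\<lambda>y. y) has_derivative (\<lambda>y. y)) (at (snd c p))" by (rule has_derivative_ident)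
  then have "(transition c c has_derivative (\<lambda>y. y)) (at (snd c p))"
  proof (rule has_derivative_transform_within_open)
    show "open (snd c ` fst c)" by (rule chart_homeomorphism(2)[OF cM(1)])
    show "snd c p \<in> snd c ` fst c" using cM(2) by blast
    show "y = transition c c y" if y: "y \<in> snd c ` fst c" for y
    proof -
      obtain q where q: "q \<in> fst c" "y = snd c q" using y by blast
      show ?thesis unfolding q(2) transition_apply[OF cM(1) q(1)] ..
    qed
  qed
  from has_derivative_unique[OF this transition_has_derivative[OF c c]]
  show ?thesis by metis
qed

section \<open>Tangent vectors and the differential of the imbedding\<close>

lemma coord_vec_tangent:
  assumes "c \<in> charts_at M p"
  shows "coord_vec M c p w \<in> tangent_space_at M p"
  unfolding tangent_space_at_def
proof (intro CollectI conjI allI impI ballI)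
  show "coord_vec M c p w d = 0" if "d \<notin> charts_at M p" for d
    using that by (simp add: coord_vec_def)
  show "coord_vec M c p w e = frechet_derivative (transition d e) (at (snd d p)) (coord_vec M c p w d)"
    if "d \<in> charts_at M p" "e \<in> charts_at M p" for d e
    unfolding coord_vec_def if_P[OF that(1)] if_P[OF that(2)] by (rule transition_cocycle[OF assms that])
qed

lemma coord_vec_self:
  assumes "c \<in> charts_at M p"
  shows "coord_vec M c p w c = w"
  using assms by (simp add: coord_vec_def transition_self)

lemma tangent_transition:
  assumes "v \<in> tangent_space_at M p" "c \<in> charts_at M p" "d \<in> charts_at M p"
  shows "v d = frechet_derivative (transition c d) (at (snd c p)) (v c)"
  using assms unfolding tangent_space_at_def by blast

lemma tangent_outside: "v \<in> tangent_space_at M p \<Longrightarrow> c \<notin> charts_at M p \<Longrightarrow> v c = 0"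
  unfolding tangent_space_at_def by blast

lemma lincomb_tangent:
  assumes u: "u \<in> tangent_space_at M p" and v: "v \<in> tangent_space_at M p"
  shows "lincomb a u b v \<in> tangent_space_at M p"
  unfolding tangent_space_at_def
proof (intro CollectI conjI allI impI ballI)
  show "lincomb a u b v c = 0" if "c \<notin> charts_at M p" for c
    using tangent_outside[OF u that] tangent_outside[OF v that] by (simp add: lincomb_def)
  fix c d assume c: "c \<in> charts_at M p" and d: "d \<in> charts_at M p"
  have "linear (frechet_derivative (transition c d) (at (snd c p)))"
    using transition_has_derivative[OF c d] has_derivative_linear by blast
  then show "lincomb a u b v d = frechet_derivative (transition c d) (at (snd c p)) (lincomb a u b v c)"
    using tangent_transition[OF u c d] tangent_transition[OF v c d]
    by (simp add: lincomb_def linear_add linear_scale)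
qed

lemma zero_tangent: "(\<lambda>c. 0) \<in> tangent_space_at M p"
  unfolding tangent_space_at_def
proof (intro CollectI conjI ballI allI impI)
  fix c d assume "c \<in> charts_at M p" "d \<in> charts_at M p"
  then have "linear (frechet_derivative (transition c d) (at (snd c p)))"
    using transition_has_derivative has_derivative_linear by blast
  then show "0 = frechet_derivative (transition c d) (at (snd c p)) 0" by (simp add: linear_0)
qed simp

text \<open>\<open>differential\<close> evaluates in a chart picked by \<open>SOME\<close>. The
  transformation rules of vectors and of Jacobians cancel, so any chart gives the same
  value.\<close>

lemma differential_chart:
  assumes v: "v \<in> tangent_space_at M p" and c: "c \<in> charts_at M p"
  shows "differential M \<iota> p v = jacobian c (snd c p) (v c)"
proof -
  define d where "d = (SOME c. c \<in> charts_at M p)"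
  have d: "d \<in> charts_at M p" unfolding d_def using c by (rule someI)
  have "differential M \<iota> p v = jacobian d (snd d p) (v d)"
    unfolding differential_def Let_def d_def[symmetric] jacobian_def local_imbedding_def ..
  then show ?thesis
    using tangent_transition[OF v c d] jacobian_transition[OF c d] by simp
qed

lemma differential_lincomb:
  assumes u: "u \<in> tangent_space_at M p" and v: "v \<in> tangent_space_at M p"
  shows "differential M \<iota> p (lincomb a u b v) = a *\<^sub>R differential M \<iota> p u + b *\<^sub>R differential M \<iota> p v"
proof -
  obtain c where c: "c \<in> charts_at M p" using chart_exists by blast
  show ?thesis
    using linear_jacobian[OF c] unfolding differential_chart[OF lincomb_tangent[OF u v] c]
      differential_chart[OF u c] differential_chart[OF v c]
    by (simp add: lincomb_def linear_add linear_scale)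
qed

lemma differential_inner:
  assumes "u \<in> tangent_space_at M p" "v \<in> tangent_space_at M p"
  shows "differential M \<iota> p u \<bullet> differential M \<iota> p v = metric M p u v"
  using imbedding assms unfolding isometric_imbedding_def by blast

text \<open>The immersion property comes from the metric: a nonzero tangent vector has positive
  length, and the differential preserves lengths.\<close>

lemma differential_eq_0:
  assumes "u \<in> tangent_space_at M p" "differential M \<iota> p u = 0"
  shows "u = (\<lambda>c. 0)"
proof (rule ccontr)
  assume "u \<noteq> (\<lambda>c. 0)"
  then have "0 < metric M p u u" using metric assms(1) unfolding riemannian_metric_def by blast
  then show False using differential_inner[OF assms(1,1)] assms(2) by simp
qed

lemma differential_inject:
  assumes u: "u \<in> tangent_space_at M p" and v: "v \<in> tangent_space_at M p"
    and eq: "differential M \<iota> p u = differential M \<iota> p v"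
  shows "u = v"
proof -
  have "differential M \<iota> p (lincomb 1 u (- 1) v) = 0"
    unfolding differential_lincomb[OF u v] eq by simp
  then have "lincomb 1 u (- 1) v = (\<lambda>c. 0)" by (rule differential_eq_0[OF lincomb_tangent[OF u v]])
  then have "u c - v c = 0" for c unfolding lincomb_def by (metis add.right_inverse scaleR_one scaleR_minus1_left diff_conv_add_uminus)
  then show ?thesis by (simp add: fun_eq_iff)
qed

lemma jacobian_inject:
  assumes c: "c \<in> charts_at M p" and "jacobian c (snd c p) w = 0"
  shows "w = 0"
proof -
  have "differential M \<iota> p (coord_vec M c p w) = 0"
    using differential_chart[OF coord_vec_tangent[OF c] c] coord_vec_self[OF c] assms(2) by simp
  then have "coord_vec M c p w = (\<lambda>c. 0)" by (rule differential_eq_0[OF coord_vec_tangent[OF c]])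
  then show ?thesis using coord_vec_self[OF c] by metis
qed

lemma tangent_image_chart:
  assumes c: "c \<in> charts_at M p"
  shows "tangent_image M \<iota> p = range (jacobian c (snd c p))"
proof
  show "tangent_image M \<iota> p \<subseteq> range (jacobian c (snd c p))"
    unfolding tangent_image_def using differential_chart[OF _ c] by blast
  show "range (jacobian c (snd c p)) \<subseteq> tangent_image M \<iota> p"
  proof
    fix y assume "y \<in> range (jacobian c (snd c p))"
    then obtain w where "y = jacobian c (snd c p) w" by blast
    then have "y = differential M \<iota> p (coord_vec M c p w)"
      using differential_chart[OF coord_vec_tangent[OF c] c] coord_vec_self[OF c] by simp
    then show "y \<in> tangent_image M \<iota> p"
      unfolding tangent_image_def using coord_vec_tangent[OF c] by blast
  qed
qed

section \<open>Tangent images, normal spaces and covariant derivatives\<close>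

lemma subspace_tangent_image: "subspace (tangent_image M \<iota> p)"
proof -
  obtain c where c: "c \<in> charts_at M p" using chart_exists by blast
  show ?thesis unfolding tangent_image_chart[OF c]
    by (rule linear_subspace_image[OF linear_jacobian[OF c] subspace_UNIV])
qed

lemma dim_tangent_image: "dim (tangent_image M \<iota> p) = CARD('n)"
proof -
  obtain c where c: "c \<in> charts_at M p" using chart_exists by blast
  have "inj (jacobian c (snd c p))"
    using linear_injective_0[OF linear_jacobian[OF c]] jacobian_inject[OF c] by blast
  then have "dim (range (jacobian c (snd c p))) = dim (UNIV :: (real ^ 'n) set)"
    using dim_image_eq[OF linear_jacobian[OF c], of UNIV] by simp
  then show ?thesis unfolding tangent_image_chart[OF c] by simp
qed

lemma normal_space_eq: "normal_space_at M \<iota> p = (tangent_image M \<iota> p)\<^sup>\<bottom>"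
  by (simp add: normal_space_at_def)

lemma subspace_normal_space: "subspace (normal_space_at M \<iota> p)"
  unfolding normal_space_eq by (rule subspace_orthogonal_comp)

lemma dim_normal_space: "dim (normal_space_at M \<iota> p) = CARD('v)"
  unfolding normal_space_eq dim_orthogonal_complement[OF subspace_tangent_image] dim_tangent_image by simp

definition lift :: "'p \<Rightarrow> real ^ ('n + 'v) \<Rightarrow> ('p, 'n) tvec" where
  "lift p = inv_into (tangent_space_at M p) (differential M \<iota> p)"

lemma lift:
  assumes "y \<in> tangent_image M \<iota> p"
  shows lift_tangent: "lift p y \<in> tangent_space_at M p" and differential_lift: "differential M \<iota> p (lift p y) = y"
  using assms unfolding lift_def tangent_image_def by (rule inv_into_into, rule f_inv_into_f)

lemma lift_differential:
  assumes "u \<in> tangent_space_at M p"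
  shows "lift p (differential M \<iota> p u) = u"
proof (rule differential_inject[OF _ assms])
  have "differential M \<iota> p u \<in> tangent_image M \<iota> p" unfolding tangent_image_def using assms by blast
  then show "lift p (differential M \<iota> p u) \<in> tangent_space_at M p"
    "differential M \<iota> p (lift p (differential M \<iota> p u)) = differential M \<iota> p u"
    by (rule lift_tangent, rule differential_lift)
qed

lemma lift_lincomb:
  assumes "y \<in> tangent_image M \<iota> p" "z \<in> tangent_image M \<iota> p"
  shows "lift p (a *\<^sub>R y + b *\<^sub>R z) = lincomb a (lift p y) b (lift p z)"
  using lift_differential[OF lincomb_tangent[OF lift_tangent[OF assms(1)] lift_tangent[OF assms(2)]], of a b]
  unfolding differential_lincomb[OF lift_tangent[OF assms(1)] lift_tangent[OF assms(2)]]
    differential_lift[OF assms(1)] differential_lift[OF assms(2)] .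

text \<open>The definite description in \<open>cov_deriv\<close> is justified by \<open>lift\<close>
  for existence and by injectivity of the differential for uniqueness. Both hold at every time,
  whatever value \<open>vector_derivative\<close> takes there.\<close>

lemma cov_deriv:
  shows cov_deriv_tangent: "cov_deriv M \<iota> x Z t \<in> tangent_space_at M (x t)"
    and differential_cov_deriv: "differential M \<iota> (x t) (cov_deriv M \<iota> x Z t) = orth_proj (tangent_image M \<iota> (x t))
      (vector_derivative (\<lambda>s. differential M \<iota> (x s) (Z s)) (at t))"
proof -
  let ?y = "orth_proj (tangent_image M \<iota> (x t)) (vector_derivative (\<lambda>s. differential M \<iota> (x s) (Z s)) (at t))"
  let ?Q = "\<lambda>w. w \<in> tangent_space_at M (x t) \<and> differential M \<iota> (x t) w = ?y"
  have y: "?y \<in> tangent_image M \<iota> (x t)" by (rule orth_proj_in[OF subspace_tangent_image])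
  have "?Q (THE w. ?Q w)"
  proof (rule theI[where a = "lift (x t) ?y"])
    show "?Q (lift (x t) ?y)" using lift_tangent[OF y] differential_lift[OF y] by simp
    show "w = lift (x t) ?y" if "?Q w" for w
      using differential_inject[of w "x t" "lift (x t) ?y"] that lift_tangent[OF y] differential_lift[OF y] by simp
  qed
  then show "cov_deriv M \<iota> x Z t \<in> tangent_space_at M (x t)"
    "differential M \<iota> (x t) (cov_deriv M \<iota> x Z t) = ?y"
    unfolding cov_deriv_def by blast+
qed

lemma cov_deriv_eq_0_iff:
  "cov_deriv M \<iota> x Z t = (\<lambda>c. 0) \<longleftrightarrow>
    orth_proj (tangent_image M \<iota> (x t)) (vector_derivative (\<lambda>s. differential M \<iota> (x s) (Z s)) (at t)) = 0"
proof -
  have "differential M \<iota> (x t) (\<lambda>c. 0) = 0"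
    using differential_lincomb[OF zero_tangent zero_tangent, where a = 0 and b = 0 and p = "x t"]
    unfolding lincomb_def scaleR_zero_left add_0_left .
  then show ?thesis
    unfolding differential_cov_deriv[symmetric] using differential_eq_0[OF cov_deriv_tangent] by auto
qed

text \<open>Orientation of normal frames can be tested on the coordinate frame of a single chart: in
  coordinates, a positively oriented tangent frame is a matrix of positive determinant.\<close>

lemma pos_normal_frame_iff:
  assumes c: "c \<in> charts_at M p"
  shows "pos_normal_frame M \<iota> p f \<longleftrightarrow> (\<forall>l. f l \<in> normal_space_at M \<iota> p) \<and>
    0 < det (joint_matrix (\<lambda>k. jacobian c (snd c p) (axis k 1)) f)"
proof -
  let ?J = "jacobian c (snd c p)"
  have joint: "det (joint_matrix (\<lambda>k. differential M \<iota> p (e k)) f) =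
      det (joint_matrix (\<lambda>k. ?J (axis k 1)) f) * det (\<chi> i j. e j c $ i)"
    if e: "pos_tangent_frame M p e" for e
  proof (rule det_joint_matrix_left)
    fix k
    have ek: "e k \<in> tangent_space_at M p" using e by (simp add: pos_tangent_frame_def)
    have "e k c = (\<Sum>a\<in>UNIV. e k c $ a *\<^sub>R axis a 1)"
      by (rule basis_expansion[of "e k c", unfolded scalar_mult_eq_scaleR, symmetric])
    from arg_cong[OF this, of ?J]
    have "?J (e k c) = (\<Sum>a\<in>UNIV. e k c $ a *\<^sub>R ?J (axis a 1))"
      unfolding linear_sum[OF linear_jacobian[OF c]] linear_scale[OF linear_jacobian[OF c]] .
    then show "differential M \<iota> p (e k) = (\<Sum>a\<in>UNIV. (\<chi> i j. e j c $ i) $ a $ k *\<^sub>R ?J (axis a 1))"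
      unfolding differential_chart[OF ek c] by simp
  qed
  have pos: "0 < det (\<chi> i j. e j c $ i)" if "pos_tangent_frame M p e" for e
    using that c unfolding pos_tangent_frame_def by blast
  \<comment> \<open>The coordinate frame is positively oriented. Without one such frame the
    quantifier over \<open>e\<close> in \<open>pos_normal_frame\<close> could hold vacuously and
    determine no sign.\<close>
  define e0 where "e0 k = coord_vec M c p (axis k 1)" for k :: 'n
  have "pos_tangent_frame M p e0"
    unfolding pos_tangent_frame_def
  proof (intro conjI allI ballI)
    show "e0 j \<in> tangent_space_at M p" for j unfolding e0_def by (rule coord_vec_tangent[OF c])
    fix d assume d: "d \<in> charts_at M p"
    have "(\<chi> i j. e0 j d $ i) = matrix (frechet_derivative (transition c d) (at (snd c p)))"
      using d by (simp add: vec_eq_iff matrix_def e0_def coord_vec_def)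
    then show "0 < det (\<chi> i j. e0 j d $ i)" using det_transition_pos[OF c d] by simp
  qed
  moreover have "pos_normal_frame M \<iota> p f \<longleftrightarrow> (\<forall>l. f l \<in> normal_space_at M \<iota> p) \<and>
     (\<forall>e. pos_tangent_frame M p e \<longrightarrow> 0 < det (joint_matrix (\<lambda>k. differential M \<iota> p (e k)) f))"
    unfolding pos_normal_frame_def joint_matrix_def ..
  moreover have "0 < det (joint_matrix (\<lambda>k. differential M \<iota> p (e k)) f) \<longleftrightarrow>
      0 < det (joint_matrix (\<lambda>k. ?J (axis k 1)) f)" if "pos_tangent_frame M p e" for e
    unfolding joint[OF that] using pos[OF that] by (simp add: zero_less_mult_iff)
  ultimately show ?thesis by blast
qed

lemma det_joint_jacobian_nonzero:
  assumes c: "c \<in> charts_at M p" and f: "orthonormal_frame (normal_space_at M \<iota> p) f"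
  shows "det (joint_matrix (\<lambda>k. jacobian c (snd c p) (axis k 1)) f) \<noteq> 0"
proof (rule det_joint_matrix_nonzero[OF _ _ subspace_tangent_image f[unfolded normal_space_eq]])
  show "jacobian c (snd c p) (axis k 1) \<in> tangent_image M \<iota> p" for k
    unfolding tangent_image_chart[OF c] by blast
  fix a :: "'n \<Rightarrow> real" assume a: "(\<Sum>k\<in>UNIV. a k *\<^sub>R jacobian c (snd c p) (axis k 1)) = 0"
  have "jacobian c (snd c p) (\<Sum>k\<in>UNIV. a k *\<^sub>R axis k 1) = 0"
    using a linear_jacobian[OF c] by (simp add: linear_sum linear_scale)
  then have "(\<Sum>k\<in>UNIV. a k *\<^sub>R axis k 1) = (0 :: real ^ 'n)" by (rule jacobian_inject[OF c])
  moreover have "(\<Sum>k\<in>UNIV. a k *\<^sub>R axis k 1) $ i = a i" for i :: 'n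
    by (simp add: axis_def if_distrib cong: if_cong)
  ultimately show "\<forall>k. a k = 0" by simp
qed

text \<open>The inner products with \<epsilon> are the coordinates of \<open>f\<close>, so this
  determinant is the factor by which the joint determinant changes from \<epsilon> to
  \<open>f\<close>.\<close>

lemma pos_normal_frame_change:
  assumes \<epsilon>: "orthonormal_frame (normal_space_at M \<iota> p) \<epsilon>" "pos_normal_frame M \<iota> p \<epsilon>"
    and f: "\<And>l. f l \<in> normal_space_at M \<iota> p"
  shows "pos_normal_frame M \<iota> p f \<longleftrightarrow> 0 < det (\<chi> k l. \<epsilon> k \<bullet> f l)"
proof -
  obtain c where c: "c \<in> charts_at M p" using chart_exists by blast
  have "f l = (\<Sum>b\<in>UNIV. (\<chi> k l. \<epsilon> k \<bullet> f l) $ b $ l *\<^sub>R \<epsilon> b)" for l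
    using orthonormal_frameD(3)[OF \<epsilon>(1) f] by simp
  from det_joint_matrix_right[OF this] show ?thesis
    using \<epsilon>(2) f unfolding pos_normal_frame_iff[OF c] by (simp add: zero_less_mult_iff)
qed

lemma pos_orthonormal_normal_frame_exists:
  "\<exists>f. orthonormal_frame (normal_space_at M \<iota> p) f \<and> pos_normal_frame M \<iota> p f"
proof -
  obtain c where c: "c \<in> charts_at M p" using chart_exists by blast
  obtain f :: "'v \<Rightarrow> real ^ ('n + 'v)" where f: "orthonormal_frame (normal_space_at M \<iota> p) f"
    using orthonormal_frame_exists[OF subspace_normal_space dim_normal_space] by blast
  let ?d = "\<lambda>f. det (joint_matrix (\<lambda>k. jacobian c (snd c p) (axis k 1)) f)"
  show ?thesis
  proof (cases "0 < ?d f")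
    case True
    then show ?thesis using f orthonormal_frameD(1)[OF f] unfolding pos_normal_frame_iff[OF c] by blast
  next
    case False
    \<comment> \<open>Only the vector at one arbitrarily chosen index is reversed, which changes the
      sign of the joint determinant.\<close>
    define s where "s l = (if l = (SOME l. True) then - 1 else 1 :: real)" for l :: 'v
    define f' where "f' l = s l *\<^sub>R f l" for l
    have f'N: "f' l \<in> normal_space_at M \<iota> p" for l
      unfolding f'_def by (intro subspace_scale subspace_normal_space orthonormal_frameD(1)[OF f])
    have f': "orthonormal_frame (normal_space_at M \<iota> p) f'"
    proof (rule orthonormal_frameI[OF subspace_normal_space dim_normal_space f'N])
      show "f' k \<bullet> f' l = (if k = l then 1 else 0)" for k l
        using orthonormal_frameD(2)[OF f, of k l] by (simp add: f'_def s_def)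
    qed
    have "f' l = (\<Sum>b\<in>UNIV. (\<chi> k l. if k = l then s l else 0) $ b $ l *\<^sub>R f b)" for l
      by (simp add: f'_def if_distrib[of "\<lambda>r. r *\<^sub>R _"] cong: if_cong)
    then have "?d f' = ?d f * det (\<chi> k l. if k = l then s l else 0)" by (rule det_joint_matrix_right)
    also have "det (\<chi> k l. if k = l then s l else 0) = (\<Prod>l\<in>UNIV. s l)"
      by (subst det_diagonal) auto
    also have "\<dots> = - 1" by (simp add: s_def prod.delta)
    finally have "0 < ?d f'" using False det_joint_jacobian_nonzero[OF c f] by simp
    then show ?thesis using f' f'N unfolding pos_normal_frame_iff[OF c] by blast
  qed
qed

end

section \<open>Fields along curves\<close>

context imbedded_manifold
begin

text \<open>The conclusion has the shape of the local hypothesis in \<open>Bolzano\<close>, so that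
  a chart around one point of the curve can feed a bisection.\<close>

lemma chart_interval:
  fixes x :: "real \<Rightarrow> 'p"
  assumes x: "continuous_on {a..b} x" and t: "t \<in> {a..b}"
  shows "\<exists>c\<in>charts_at M (x t). \<exists>d>0. \<forall>u v. a \<le> u \<longrightarrow> u \<le> t \<longrightarrow> t \<le> v \<longrightarrow> v \<le> b \<longrightarrow>
    v - u < d \<longrightarrow> x ` {u..v} \<subseteq> fst c"
proof -
  obtain c where c: "c \<in> charts_at M (x t)" using chart_exists by blast
  then have "open (fst c)" "x t \<in> fst c" using chart_homeomorphism(1) by (auto simp: charts_at_iff)
  then obtain A where A: "open A" "t \<in> A" "\<And>s. s \<in> {a..b} \<Longrightarrow> s \<in> A \<Longrightarrow> x s \<in> fst c"
    using x t unfolding continuous_on_topological by metis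
  obtain d where d: "0 < d" "ball t d \<subseteq> A" using A(1,2) open_contains_ball by blast
  have "x ` {u..v} \<subseteq> fst c" if uv: "a \<le> u" "u \<le> t" "t \<le> v" "v \<le> b" "v - u < d" for u v
  proof (rule image_subsetI)
    fix s assume s: "s \<in> {u..v}"
    then have "s \<in> ball t d" using uv by (auto simp: dist_real_def abs_less_iff)
    then show "x s \<in> fst c" using A(3)[of s] d(2) s uv by auto
  qed
  then show ?thesis using c d(1) by blast
qed

lemma abs_cont_on_charts:
  fixes x :: "real \<Rightarrow> 'p"
  assumes "a \<le> b" and x: "continuous_on {a..b} x"
    and f: "\<And>c u v. c \<in> atlas M \<Longrightarrow> a \<le> u \<Longrightarrow> u \<le> v \<Longrightarrow> v \<le> b \<Longrightarrow> x ` {u..v} \<subseteq> fst c \<Longrightarrow> abs_cont_on u v f"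
  shows "abs_cont_on a b f"
proof (rule abs_cont_on_local[OF \<open>a \<le> b\<close>])
  fix t assume t: "a \<le> t" "t \<le> b"
  then have "t \<in> {a..b}" by simp
  from chart_interval[OF x this] obtain c where "c \<in> charts_at M (x t)" and ex: "\<exists>d>0. \<forall>u v. a \<le> u \<longrightarrow>
      u \<le> t \<longrightarrow> t \<le> v \<longrightarrow> v \<le> b \<longrightarrow> v - u < d \<longrightarrow> x ` {u..v} \<subseteq> fst c"
    by (rule bexE)
  then have c: "c \<in> atlas M" by (simp add: charts_at_iff)
  obtain d where "0 < d" and sub: "\<And>u v. a \<le> u \<Longrightarrow> u \<le> t \<Longrightarrow> t \<le> v \<Longrightarrow> v \<le> b \<Longrightarrow>
      v - u < d \<Longrightarrow> x ` {u..v} \<subseteq> fst c"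
    using ex by blast
  have "abs_cont_on u v f" if "a \<le> u" "u \<le> t" "t \<le> v" "v \<le> b" "v - u < d" for u v
    using f[OF c that(1) _ that(4) sub[OF that]] that(2,3) by linarith
  then show "\<exists>d>0. \<forall>u v. a \<le> u \<longrightarrow> u \<le> t \<longrightarrow> t \<le> v \<longrightarrow> v \<le> b \<longrightarrow> v - u < d \<longrightarrow> abs_cont_on u v f"
    using \<open>0 < d\<close> by blast
qed

lemma jacobian_expand:
  assumes c: "c \<in> charts_at M p"
  shows "jacobian c (snd c p) w = (\<Sum>i\<in>UNIV. w $ i *\<^sub>R jacobian c (snd c p) (axis i 1))"
proof -
  have "w = (\<Sum>i\<in>UNIV. w $ i *\<^sub>R axis i 1)"
    by (rule basis_expansion[of w, unfolded scalar_mult_eq_scaleR, symmetric])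
  from arg_cong[OF this, of "jacobian c (snd c p)"] show ?thesis
    unfolding linear_sum[OF linear_jacobian[OF c]] linear_scale[OF linear_jacobian[OF c]] .
qed

lemma jacobian_diff_le:
  assumes "c \<in> charts_at M p" "c \<in> charts_at M q"
  shows "norm (jacobian c (snd c p) w - jacobian c (snd c q) w) \<le>
    norm w * (\<Sum>i\<in>UNIV. norm (jacobian c (snd c p) (axis i 1) - jacobian c (snd c q) (axis i 1)))"
proof -
  have "jacobian c (snd c p) w - jacobian c (snd c q) w =
      (\<Sum>i\<in>UNIV. w $ i *\<^sub>R (jacobian c (snd c p) (axis i 1) - jacobian c (snd c q) (axis i 1)))"
    unfolding jacobian_expand[OF assms(1), of w] jacobian_expand[OF assms(2), of w]
    by (simp add: sum_subtractf[symmetric] scaleR_diff_right)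
  then show ?thesis
    unfolding sum_distrib_left
    by (auto intro!: sum_norm_le mult_right_mono simp: component_le_norm_cart)
qed

context
  fixes \<tau> :: real and x :: "real \<Rightarrow> 'p"
  assumes tau: "0 \<le> \<tau>" and x: "ac_curve M \<tau> x"
begin

lemma continuous_curve: "continuous_on {0..\<tau>} x"
  using x by (simp add: ac_curve_def)

section \<open>Estimates on a piece of the curve inside one chart\<close>

context
  fixes c u v
  assumes c: "c \<in> atlas M" and uv: "0 \<le> u" "u \<le> v" "v \<le> \<tau>" and sub: "x ` {u..v} \<subseteq> fst c"
begin

lemma chart_at: "t \<in> {u..v} \<Longrightarrow> c \<in> charts_at M (x t)"
  using c sub by (auto simp: charts_at_iff)

lemma abs_cont_on_jacobian: "abs_cont_on u v (\<lambda>t. jacobian c (snd c (x t)) w)"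
  unfolding jacobian_def
proof (rule abs_cont_on_compose_smooth[where f = "\<lambda>t. snd c (x t)"])
  show "open (snd c ` fst c)" by (rule chart_homeomorphism(2)[OF c])
  show "smooth_on (snd c ` fst c) (\<lambda>y. frechet_derivative (local_imbedding c) (at y) w)"
    by (rule smooth_onD(3)[OF local_imbedding_smooth[OF c]])
  show "abs_cont_on u v (\<lambda>t. snd c (x t))"
    using x c uv sub unfolding ac_curve_def comp_def by blast
  show "(\<lambda>t. snd c (x t)) ` {u..v} \<subseteq> snd c ` fst c" using sub by blast
qed (rule uv)

text \<open>The Jacobians are injective and continuous in time, so the norm of their values attains
  a positive minimum on the compact product of \<open>{u..v}\<close> and the unit sphere.\<close>

lemma jacobian_lower_bound:
  "\<exists>C>0. \<forall>t\<in>{u..v}. \<forall>w. norm w \<le> C * norm (jacobian c (snd c (x t)) w)"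
proof -
  let ?K = "{u..v} \<times> sphere (0 :: real ^ 'n) 1"
  \<comment> \<open>The expression by columns makes joint continuity in time and vector follow from
    continuity of each column.\<close>
  define g where "g z = norm (\<Sum>i\<in>UNIV. snd z $ i *\<^sub>R jacobian c (snd c (x (fst z))) (axis i 1))"
    for z :: "real \<times> (real ^ 'n)"
  have J: "continuous_on ?K (\<lambda>z. jacobian c (snd c (x (fst z))) (axis i 1))" for i
    by (rule continuous_on_compose2[OF abs_cont_on_imp_continuous_on[OF abs_cont_on_jacobian]])
      (auto intro!: continuous_intros)
  have "continuous_on ?K g"
    unfolding g_def[abs_def] by (intro continuous_intros J)
  moreover have "compact ?K" by (intro compact_Times compact_sphere) simp
  moreover have "(u, axis undefined 1) \<in> ?K" using uv by (simp add: norm_axis_1)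
  then have "?K \<noteq> {}" by blast
  ultimately obtain z where z: "z \<in> ?K" "\<And>z'. z' \<in> ?K \<Longrightarrow> g z \<le> g z'"
    using continuous_attains_inf by metis
  have g: "g (t, w) = norm (jacobian c (snd c (x t)) w)" if "t \<in> {u..v}" for t w
    using jacobian_expand[OF chart_at[OF that], of w] by (simp add: g_def)
  have "0 < g z"
  proof -
    obtain t w where tw: "z = (t, w)" "t \<in> {u..v}" "norm w = 1" using z(1) by auto
    then have "jacobian c (snd c (x t)) w \<noteq> 0" using jacobian_inject[OF chart_at[OF tw(2)], of w] by auto
    then show ?thesis unfolding tw(1) g[OF tw(2)] by simp
  qed
  have "norm w \<le> 1 / g z * norm (jacobian c (snd c (x t)) w)" if t: "t \<in> {u..v}" for t w
  proof (cases "w = 0")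
    case False
    have "g z \<le> g (t, (1 / norm w) *\<^sub>R w)" using t False by (intro z(2)) simp
    also have "\<dots> = norm (jacobian c (snd c (x t)) w) / norm w"
      unfolding g[OF t] linear_scale[OF linear_jacobian[OF chart_at[OF t]]] by simp
    finally show ?thesis using False \<open>0 < g z\<close> by (simp add: field_simps)
  qed (use \<open>0 < g z\<close> in simp)
  then show ?thesis using \<open>0 < g z\<close> by (intro exI[of _ "1 / g z"]) simp
qed

text \<open>One function \<open>V\<close> serves for all \<open>w\<close>, because increments of the
  Jacobian are controlled by its finitely many columns.\<close>

lemma jacobian_majorant:
  "\<exists>V :: real \<Rightarrow> real. abs_cont_on u v V \<and> (\<forall>s t w. u \<le> s \<longrightarrow> s \<le> t \<longrightarrow> t \<le> v \<longrightarrow>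
    norm (jacobian c (snd c (x t)) w - jacobian c (snd c (x s)) w) \<le> norm w * norm (V t - V s))"
proof -
  obtain V :: "real \<Rightarrow> real" where V: "abs_cont_on u v V" "\<And>s t. u \<le> s \<Longrightarrow> s \<le> t \<Longrightarrow> t \<le> v \<Longrightarrow>
      (\<Sum>i\<in>UNIV. norm (jacobian c (snd c (x t)) (axis i 1) - jacobian c (snd c (x s)) (axis i 1))) \<le> norm (V t - V s)"
    using abs_cont_on_common_majorant[of u v "\<lambda>i t. jacobian c (snd c (x t)) (axis i 1)"]
      abs_cont_on_jacobian by blast
  have "norm (jacobian c (snd c (x t)) w - jacobian c (snd c (x s)) w) \<le> norm w * norm (V t - V s)"
    if st: "u \<le> s" "s \<le> t" "t \<le> v" for s t w
  proof -
    have "c \<in> charts_at M (x t)" "c \<in> charts_at M (x s)" using st by (auto intro!: chart_at)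
    from jacobian_diff_le[OF this, of w] mult_left_mono[OF V(2)[OF st] norm_ge_zero[of w]]
    show ?thesis by (rule order_trans)
  qed
  then show ?thesis using V(1) by blast
qed

text \<open>Tangent vectors with equal coordinates at two times are close relative to their length,
  by the majorant and the lower bound. The gap between the two tangent images is therefore at most
  \<open>C * norm (V t - V s)\<close>, and \<open>orth_proj_diff_le\<close> applies.\<close>

lemma abs_cont_on_orth_proj_chart:
  "abs_cont_on u v (\<lambda>t. orth_proj (tangent_image M \<iota> (x t)) w)"
proof -
  let ?J = "\<lambda>t. jacobian c (snd c (x t))" and ?T = "\<lambda>t. tangent_image M \<iota> (x t)"
  obtain C where C: "0 < C" "\<And>t w. t \<in> {u..v} \<Longrightarrow> norm w \<le> C * norm (?J t w)"
    using jacobian_lower_bound by auto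
  obtain V :: "real \<Rightarrow> real" where V: "abs_cont_on u v V" "\<And>s t w. u \<le> s \<Longrightarrow> s \<le> t \<Longrightarrow> t \<le> v \<Longrightarrow>
      norm (?J t w - ?J s w) \<le> norm w * norm (V t - V s)"
    using jacobian_majorant by blast
  show ?thesis
  proof (rule abs_cont_on_dominated[OF V(1)])
    show "0 \<le> 2 * C * norm w" using C(1) by simp
    fix s t assume st: "u \<le> s" "s \<le> t" "t \<le> v"
    let ?\<delta> = "C * norm (V t - V s)"
    have near: "\<exists>y'\<in>?T r'. norm (y - y') \<le> ?\<delta> * norm y"
      if r: "r \<in> {s, t}" "r' \<in> {s, t}" and y: "y \<in> ?T r" for r r' y
    proof -
      have in_uv: "r \<in> {u..v}" "r' \<in> {u..v}" using r st by auto
      obtain w where w: "y = ?J r w" using y unfolding tangent_image_chart[OF chart_at[OF in_uv(1)]] by blast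
      have "norm (?J r w - ?J r' w) \<le> norm w * norm (V t - V s)"
        using r V(2)[OF st, of w] by (auto simp: norm_minus_commute)
      also have "\<dots> \<le> (C * norm y) * norm (V t - V s)"
        unfolding w by (intro mult_right_mono C(2) in_uv) simp
      finally have "norm (y - ?J r' w) \<le> ?\<delta> * norm y" by (simp add: w mult_ac)
      moreover have "?J r' w \<in> ?T r'" unfolding tangent_image_chart[OF chart_at[OF in_uv(2)]] by blast
      ultimately show ?thesis by blast
    qed
    have "norm (orth_proj (?T t) w - orth_proj (?T s) w) \<le> 2 * ?\<delta> * norm w"
    proof (rule orth_proj_diff_le[OF subspace_tangent_image subspace_tangent_image])
      show "0 \<le> ?\<delta>" using C(1) by simp
      show "\<exists>y'\<in>?T s. norm (y - y') \<le> ?\<delta> * norm y" if "y \<in> ?T t" for y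
        by (rule near[OF _ _ that]) auto
      show "\<exists>y\<in>?T t. norm (y' - y) \<le> ?\<delta> * norm y'" if "y' \<in> ?T s" for y'
        by (rule near[OF _ _ that]) auto
    qed
    then show "norm (orth_proj (?T t) w - orth_proj (?T s) w) \<le> 2 * C * norm w * norm (V t - V s)"
      by (simp add: mult_ac)
  qed
qed

text \<open>With \<open>J\<close> the Jacobian, \<open>z\<close> the coordinates and
  \<open>W\<close> the ambient field,
  \<open>J t (z t - z s) = (W t - W s) - (J t - J s) (z s)\<close>. The right side has dominated
  increments, and the lower bound for \<open>J t\<close> passes the estimate to
  \<open>z t - z s\<close>.\<close>

lemma abs_cont_on_coordinates:
  assumes Z: "\<And>t. t \<in> {u..v} \<Longrightarrow> Z t \<in> tangent_space_at M (x t)"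
    and AC: "abs_cont_on u v (\<lambda>t. differential M \<iota> (x t) (Z t))"
  shows "abs_cont_on u v (\<lambda>t. Z t c)"
proof -
  let ?J = "\<lambda>t. jacobian c (snd c (x t))" and ?W = "\<lambda>t. differential M \<iota> (x t) (Z t)"
  obtain C where C: "0 < C" "\<And>t w. t \<in> {u..v} \<Longrightarrow> norm w \<le> C * norm (?J t w)"
    using jacobian_lower_bound by auto
  obtain V :: "real \<Rightarrow> real" where V: "abs_cont_on u v V" "\<And>s t w. u \<le> s \<Longrightarrow> s \<le> t \<Longrightarrow> t \<le> v \<Longrightarrow>
      norm (?J t w - ?J s w) \<le> norm w * norm (V t - V s)"
    using jacobian_majorant by blast
  obtain K where K: "0 < K" "\<And>t. t \<in> {u..v} \<Longrightarrow> norm (?W t) \<le> K"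
    using abs_cont_on_bounded[OF AC] by auto
  have W: "?W t = ?J t (Z t c)" if "t \<in> {u..v}" for t
    by (rule differential_chart[OF Z[OF that] chart_at[OF that]])
  show ?thesis
  proof (rule abs_cont_on_dominated2[OF AC V(1)])
    show "0 \<le> C * (1 + C * K)" using C(1) K(1) by simp
    fix s t assume st: "u \<le> s" "s \<le> t" "t \<le> v"
    then have s: "s \<in> {u..v}" and t: "t \<in> {u..v}" by auto
    have "?J t (Z t c - Z s c) = (?W t - ?W s) - (?J t (Z s c) - ?J s (Z s c))"
      unfolding W[OF s] W[OF t] linear_diff[OF linear_jacobian[OF chart_at[OF t]]] by simp
    then have "norm (?J t (Z t c - Z s c)) \<le> norm (?W t - ?W s) + norm (?J t (Z s c) - ?J s (Z s c))"
      by (metis norm_triangle_ineq4)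
    also have "\<dots> \<le> norm (?W t - ?W s) + (C * K) * norm (V t - V s)"
    proof (intro add_left_mono order_trans[OF V(2)[OF st]] mult_right_mono norm_ge_zero)
      have "norm (Z s c) \<le> C * norm (?W s)" unfolding W[OF s] by (rule C(2)[OF s])
      also have "\<dots> \<le> C * K" using C(1) K(2)[OF s] by simp
      finally show "norm (Z s c) \<le> C * K" .
    qed
    also have "\<dots> \<le> (1 + C * K) * (norm (?W t - ?W s) + norm (V t - V s))"
      using C(1) K(1) by (simp add: algebra_simps)
    finally have "norm (?J t (Z t c - Z s c)) \<le> (1 + C * K) * (norm (?W t - ?W s) + norm (V t - V s))" .
    from mult_left_mono[OF this less_imp_le[OF C(1)]]
    show "norm (Z t c - Z s c) \<le> C * (1 + C * K) * (norm (?W t - ?W s) + norm (V t - V s))"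
      using C(2)[OF t, of "Z t c - Z s c"] by (simp only: mult.assoc)
  qed
qed

lemma abs_cont_on_differential_chart:
  assumes Z: "\<And>t. t \<in> {u..v} \<Longrightarrow> Z t \<in> tangent_space_at M (x t)" and AC: "abs_cont_on u v (\<lambda>t. Z t c)"
  shows "abs_cont_on u v (\<lambda>t. differential M \<iota> (x t) (Z t))"
proof (rule abs_cont_on_cong)
  show "abs_cont_on u v (\<lambda>t. \<Sum>i\<in>UNIV. (Z t c \<bullet> axis i 1) *\<^sub>R jacobian c (snd c (x t)) (axis i 1))"
    by (intro abs_cont_on_sum abs_cont_on_scaleR abs_cont_on_inner abs_cont_on_const AC abs_cont_on_jacobian)
  fix t assume "u \<le> t" "t \<le> v"
  then have t: "t \<in> {u..v}" by simp
  show "(\<Sum>i\<in>UNIV. (Z t c \<bullet> axis i 1) *\<^sub>R jacobian c (snd c (x t)) (axis i 1)) = differential M \<iota> (x t) (Z t)"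
    unfolding differential_chart[OF Z[OF t] chart_at[OF t]] jacobian_expand[OF chart_at[OF t], of "Z t c"]
    by (simp add: inner_axis)
qed

text \<open>Along an orthonormal frame the joint determinant in the chart is continuous in time and
  never zero, so its sign cannot change.\<close>

lemma normal_frame_sign_chart:
  assumes \<epsilon>: "\<And>l. abs_cont_on 0 \<tau> (\<epsilon> l)"
    and on: "\<And>t. t \<in> {0..\<tau>} \<Longrightarrow> orthonormal_frame (normal_space_at M \<iota> (x t)) (\<lambda>l. \<epsilon> l t)"
  shows "pos_normal_frame M \<iota> (x u) (\<lambda>l. \<epsilon> l u) \<longleftrightarrow> pos_normal_frame M \<iota> (x v) (\<lambda>l. \<epsilon> l v)"
proof -
  let ?A = "\<lambda>t. joint_matrix (\<lambda>k. jacobian c (snd c (x t)) (axis k 1)) (\<lambda>l. \<epsilon> l t)"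
  have tau: "t \<in> {0..\<tau>}" if "t \<in> {u..v}" for t using that uv by auto
  have "continuous_on {u..v} (\<lambda>t. ?A t $ i $ j)" for i j
  proof (cases j)
    case (Inl k)
    then show ?thesis
      using abs_cont_on_imp_continuous_on[OF abs_cont_on_jacobian[of "axis k 1"]]
      by (simp add: joint_matrix_def continuous_intros)
  next
    case (Inr l)
    have "continuous_on {u..v} (\<epsilon> l)"
      using continuous_on_subset[OF abs_cont_on_imp_continuous_on[OF \<epsilon>]] tau by blast
    then show ?thesis using Inr by (simp add: joint_matrix_def continuous_intros)
  qed
  then have "continuous_on {u..v} (\<lambda>t. det (?A t))" by (rule continuous_on_det)
  then have "0 < det (?A u) \<longleftrightarrow> 0 < det (?A v)"
    using det_joint_jacobian_nonzero[OF chart_at on[OF tau]] uv(2)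
    by (intro continuous_nonzero_same_sign) auto
  moreover have "pos_normal_frame M \<iota> (x r) (\<lambda>l. \<epsilon> l r) \<longleftrightarrow> 0 < det (?A r)" if "r \<in> {u..v}" for r
    unfolding pos_normal_frame_iff[OF chart_at[OF that]]
    using orthonormal_frameD(1)[OF on[OF tau[OF that]]] by blast
  ultimately show ?thesis using uv(2) by simp
qed

end

section \<open>Fields and parallel frames along the whole curve\<close>

lemma abs_cont_on_orth_proj_tangent: "abs_cont_on 0 \<tau> (\<lambda>t. orth_proj (tangent_image M \<iota> (x t)) w)"
  by (rule abs_cont_on_charts[OF tau continuous_curve]) (rule abs_cont_on_orth_proj_chart)

lemma abs_cont_on_orth_proj_normal: "abs_cont_on 0 \<tau> (\<lambda>t. orth_proj (normal_space_at M \<iota> (x t)) w)"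
  unfolding normal_space_eq orth_proj_complement[OF subspace_tangent_image]
  by (intro abs_cont_on_diff abs_cont_on_const abs_cont_on_orth_proj_tangent)

text \<open>This links two descriptions: absolute continuity of a tangent field is defined in
  charts, while its covariant derivative is taken in the ambient space.\<close>

lemma tangent_field_iff:
  "tangent_field M \<tau> x Z \<longleftrightarrow> (\<forall>t\<in>{0..\<tau>}. Z t \<in> tangent_space_at M (x t)) \<and>
    section_along \<tau> (\<lambda>t. tangent_image M \<iota> (x t)) (\<lambda>t. differential M \<iota> (x t) (Z t))"
proof -
  have "abs_cont_on 0 \<tau> (\<lambda>t. differential M \<iota> (x t) (Z t)) \<longleftrightarrow>
      (\<forall>c\<in>atlas M. \<forall>a b. 0 \<le> a \<and> a \<le> b \<and> b \<le> \<tau> \<and> x ` {a..b} \<subseteq> fst c \<longrightarrow> abs_cont_on a b (\<lambda>t. Z t c))"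
    if Z: "\<And>t. t \<in> {0..\<tau>} \<Longrightarrow> Z t \<in> tangent_space_at M (x t)"
  proof
    assume AC: "abs_cont_on 0 \<tau> (\<lambda>t. differential M \<iota> (x t) (Z t))"
    show "\<forall>c\<in>atlas M. \<forall>a b. 0 \<le> a \<and> a \<le> b \<and> b \<le> \<tau> \<and> x ` {a..b} \<subseteq> fst c \<longrightarrow> abs_cont_on a b (\<lambda>t. Z t c)"
    proof (intro ballI allI impI, elim conjE)
      fix c a b assume *: "c \<in> atlas M" "0 \<le> a" "a \<le> b" "b \<le> \<tau>" "x ` {a..b} \<subseteq> fst c"
      show "abs_cont_on a b (\<lambda>t. Z t c)"
        by (rule abs_cont_on_coordinates[OF * _ abs_cont_on_subinterval[OF AC *(2,4)]])
          (use Z * in auto)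
    qed
  next
    assume AC: "\<forall>c\<in>atlas M. \<forall>a b. 0 \<le> a \<and> a \<le> b \<and> b \<le> \<tau> \<and> x ` {a..b} \<subseteq> fst c \<longrightarrow> abs_cont_on a b (\<lambda>t. Z t c)"
    show "abs_cont_on 0 \<tau> (\<lambda>t. differential M \<iota> (x t) (Z t))"
    proof (rule abs_cont_on_charts[OF tau continuous_curve])
      fix c u v assume *: "c \<in> atlas M" "0 \<le> u" "u \<le> v" "v \<le> \<tau>" "x ` {u..v} \<subseteq> fst c"
      show "abs_cont_on u v (\<lambda>t. differential M \<iota> (x t) (Z t))"
        by (rule abs_cont_on_differential_chart[OF *]) (use Z AC * in auto)
    qed
  qed
  moreover have "differential M \<iota> p u \<in> tangent_image M \<iota> p" if "u \<in> tangent_space_at M p" for p u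
    using that unfolding tangent_image_def by blast
  ultimately show ?thesis unfolding tangent_field_def section_along_def by blast
qed

lemma parallel_iff:
  "parallel M \<iota> \<tau> x Z \<longleftrightarrow> (\<forall>t\<in>{0..\<tau>}. Z t \<in> tangent_space_at M (x t)) \<and>
    parallel_along \<tau> (\<lambda>t. tangent_image M \<iota> (x t)) (\<lambda>t. differential M \<iota> (x t) (Z t))"
  unfolding parallel_def parallel_along_def tangent_field_iff cov_deriv_eq_0_iff by blast

lemma parallel_tangent_frame_exists:
  "\<exists>E :: 'n \<Rightarrow> real \<Rightarrow> real ^ ('n + 'v). parallel_frame_along \<tau> (\<lambda>t. tangent_image M \<iota> (x t)) E"
proof -
  obtain e :: "'n \<Rightarrow> real ^ ('n + 'v)" where "orthonormal_frame (tangent_image M \<iota> (x 0)) e"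
    using orthonormal_frame_exists[OF subspace_tangent_image dim_tangent_image] by blast
  then show ?thesis
    using parallel_frame_along_exists[OF tau, of "\<lambda>t. tangent_image M \<iota> (x t)" e]
      subspace_tangent_image dim_tangent_image abs_cont_on_orth_proj_tangent by blast
qed

lemma parallel_normal_frame_iff:
  "parallel_normal_frame M \<iota> \<tau> x \<epsilon> \<longleftrightarrow> parallel_frame_along \<tau> (\<lambda>t. normal_space_at M \<iota> (x t)) \<epsilon> \<and>
    (\<forall>t\<in>{0..\<tau>}. pos_normal_frame M \<iota> (x t) (\<lambda>l. \<epsilon> l t))"
proof -
  have "normal_parallel M \<iota> \<tau> x \<Psi> \<longleftrightarrow> parallel_along \<tau> (\<lambda>t. normal_space_at M \<iota> (x t)) \<Psi>" for \<Psi>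
    unfolding normal_parallel_def normal_field_def normal_deriv_def parallel_along_def section_along_def ..
  moreover have "orthonormal_frame (normal_space_at M \<iota> p) f \<longleftrightarrow>
      (\<forall>k l. f k \<bullet> f l = (if k = l then 1 else 0))" if "pos_normal_frame M \<iota> p f" for p f
    using orthonormal_frameI[OF subspace_normal_space dim_normal_space, of f p] orthonormal_frameD(2) that
    unfolding pos_normal_frame_def by blast
  ultimately show ?thesis
    unfolding parallel_normal_frame_def parallel_frame_along_def by blast
qed

text \<open>Agreement of orientation at two times is transitive and holds on short intervals inside
  one chart, so bisection extends it to \<open>{0..t}\<close>.\<close>

lemma pos_normal_frame_along:
  assumes \<epsilon>: "parallel_frame_along \<tau> (\<lambda>t. normal_space_at M \<iota> (x t)) \<epsilon>"
    and pos: "pos_normal_frame M \<iota> (x 0) (\<lambda>l. \<epsilon> l 0)" and t: "t \<in> {0..\<tau>}"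
  shows "pos_normal_frame M \<iota> (x t) (\<lambda>l. \<epsilon> l t)"
proof -
  let ?pos = "\<lambda>t. pos_normal_frame M \<iota> (x t) (\<lambda>l. \<epsilon> l t)"
  have "0 \<le> t" using t by simp
  then have "0 \<le> (0::real) \<longrightarrow> t \<le> \<tau> \<longrightarrow> (?pos 0 \<longleftrightarrow> ?pos t)"
  proof (induction rule: Bolzano[where P = "\<lambda>u v. 0 \<le> u \<longrightarrow> v \<le> \<tau> \<longrightarrow> (?pos u \<longleftrightarrow> ?pos v)"])
    case (trans u v w)
    have "u \<le> w" using trans(3,4) by linarith
    show ?case
    proof (intro impI)
      assume uw: "0 \<le> u" "w \<le> \<tau>"
      have "0 \<le> v" "v \<le> \<tau>" using uw trans(3,4) by linarith+
      then show "?pos u \<longleftrightarrow> ?pos w" using trans(1,2) uw by blast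
    qed
  next
    case (local s)
    have "s \<in> {0..\<tau>}" using local t by auto
    from chart_interval[OF continuous_curve this]
    obtain c where "c \<in> charts_at M (x s)" and ex: "\<exists>d>0. \<forall>u v. 0 \<le> u \<longrightarrow>
        u \<le> s \<longrightarrow> s \<le> v \<longrightarrow> v \<le> \<tau> \<longrightarrow> v - u < d \<longrightarrow> x ` {u..v} \<subseteq> fst c"
      by (rule bexE)
    then have c: "c \<in> atlas M" by (simp add: charts_at_iff)
    obtain d where "0 < d" and sub: "\<And>u v. 0 \<le> u \<Longrightarrow> u \<le> s \<Longrightarrow> s \<le> v \<Longrightarrow> v \<le> \<tau> \<Longrightarrow>
        v - u < d \<Longrightarrow> x ` {u..v} \<subseteq> fst c"
      using ex by blast
    have "?pos u \<longleftrightarrow> ?pos v" if uv: "u \<le> s" "s \<le> v" "v - u < d" "0 \<le> u" "v \<le> \<tau>" for u v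
    proof (rule normal_frame_sign_chart[OF c uv(4) _ uv(5)])
      show "u \<le> v" using uv by linarith
      show "x ` {u..v} \<subseteq> fst c" using sub uv by blast
      show "abs_cont_on 0 \<tau> (\<epsilon> l)" for l by (rule parallel_frame_alongD(1)[OF \<epsilon>])
      show "orthonormal_frame (normal_space_at M \<iota> (x t)) (\<lambda>l. \<epsilon> l t)" if "t \<in> {0..\<tau>}" for t
        by (rule parallel_frame_alongD(2)[OF \<epsilon> that])
    qed
    then show ?case using \<open>0 < d\<close> by blast
  qed
  then show ?thesis using pos t by simp
qed

lemma parallel_normal_frame_exists: "\<exists>\<epsilon>. parallel_normal_frame M \<iota> \<tau> x \<epsilon>"
proof -
  obtain e where e: "orthonormal_frame (normal_space_at M \<iota> (x 0)) e" "pos_normal_frame M \<iota> (x 0) e"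
    using pos_orthonormal_normal_frame_exists by blast
  obtain \<epsilon> where \<epsilon>: "parallel_frame_along \<tau> (\<lambda>t. normal_space_at M \<iota> (x t)) \<epsilon>" "\<And>l. \<epsilon> l 0 = e l"
    using parallel_frame_along_exists[OF tau subspace_normal_space dim_normal_space
        abs_cont_on_orth_proj_normal e(1)] by blast
  have "pos_normal_frame M \<iota> (x 0) (\<lambda>l. \<epsilon> l 0)" unfolding \<epsilon>(2) by (rule e(2))
  then show ?thesis
    unfolding parallel_normal_frame_iff using \<epsilon>(1) pos_normal_frame_along by blast
qed

end

end

section \<open>Rollings\<close>

lemma frame_map_eq:
  "frame_map f f' C v = (\<Sum>k\<in>UNIV. (C *v (\<chi> l. f l \<bullet> v)) $ k *\<^sub>R f' k)"
  by (simp add: frame_map_def matrix_vector_mult_def scaleR_sum_left)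

lemma right_action_eq: "right_action f f' A B v = frame_map f f' (frame_matrix f f' A ** B) v"
  by (simp add: right_action_def frame_map_def)

lemma frame_map_in:
  fixes S' :: "'b::euclidean_space set"
  assumes "subspace S'" "orthonormal_frame S' f'"
  shows "frame_map f f' C v \<in> S'"
  unfolding frame_map_eq by (intro subspace_sum subspace_scale assms(1) orthonormal_frameD(1)[OF assms(2)])

lemma frame_map_linear:
  "frame_map f f' C (a *\<^sub>R u + b *\<^sub>R v) = a *\<^sub>R frame_map f f' C u + b *\<^sub>R frame_map f f' C v"
  by (simp add: frame_map_def inner_add_right scaleR_sum_right sum.distrib[symmetric] algebra_simps)

lemma linear_frame_map: "linear (frame_map f f' C)"
proof (rule linearI)
  show "frame_map f f' C (u + v) = frame_map f f' C u + frame_map f f' C v" for u v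
    using frame_map_linear[of f f' C 1 u 1 v] by simp
  show "frame_map f f' C (c *\<^sub>R v) = c *\<^sub>R frame_map f f' C v" for c v
    using frame_map_linear[of f f' C c v 0 v] by simp
qed

lemma frame_map_coord:
  assumes "orthonormal_frame S' f'"
  shows "f' k \<bullet> frame_map f f' C v = (C *v (\<chi> l. f l \<bullet> v)) $ k"
  unfolding frame_map_eq
  by (simp add: inner_sum_right orthonormal_frameD(2)[OF assms] if_distrib cong: if_cong)

lemma frame_map_proj:
  fixes S :: "'b::euclidean_space set"
  assumes "subspace S" "orthonormal_frame S f"
  shows "frame_map f f' C (orth_proj S v) = frame_map f f' C v"
  unfolding frame_map_def orth_proj_inner[OF assms(1) orthonormal_frameD(1)[OF assms(2)]] ..

lemma frame_inner:
  assumes e: "orthonormal_frame S e" and v: "v \<in> S"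
  shows "(\<chi> l. e l \<bullet> u) \<bullet> (\<chi> l. e l \<bullet> v) = u \<bullet> v"
proof -
  have "u \<bullet> v = u \<bullet> (\<Sum>k\<in>UNIV. (e k \<bullet> v) *\<^sub>R e k)" unfolding orthonormal_frameD(3)[OF e v] ..
  then show ?thesis by (simp add: inner_sum_right inner_vec_def inner_commute mult.commute)
qed

text \<open>Passing to coordinates in the orthonormal frames preserves the inner products, and in
  coordinates the map is multiplication by the orthogonal matrix \<open>C\<close>.\<close>

lemma frame_map_inner:
  fixes S S' :: "'b::euclidean_space set"
  assumes S: "subspace S'" "orthonormal_frame S f" "orthonormal_frame S' f'"
    and C: "orthogonal_matrix C" and v: "v \<in> S"
  shows "frame_map f f' C u \<bullet> frame_map f f' C v = u \<bullet> v"
proof -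
  have "orthogonal_transformation ((*v) C)" using C by (simp add: orthogonal_transformation_matrix)
  then have "(C *v a) \<bullet> (C *v b) = a \<bullet> b" for a b by (simp add: orthogonal_transformation_def)
  moreover have "(\<chi> k. f' k \<bullet> frame_map f f' C w) = C *v (\<chi> l. f l \<bullet> w)" for w
    unfolding frame_map_coord[OF S(3)] by (simp add: vec_eq_iff)
  ultimately show ?thesis
    using frame_inner[OF S(3) frame_map_in[OF S(1,3)], of "frame_map f f' C u"] frame_inner[OF S(2) v, of u]
    by metis
qed

locale imbedded_pair = M: imbedded_manifold M \<iota> + M': imbedded_manifold M' \<iota>'
  for M :: "('p::{t2_space, second_countable_topology}, 'n::finite) riemannian"
    and \<iota> :: "'p \<Rightarrow> real ^ ('n + 'v::finite)"
    and M' :: "('q::{t2_space, second_countable_topology}, 'n) riemannian"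
    and \<iota>' :: "'q \<Rightarrow> real ^ ('n + 'v)"
begin

section \<open>Normal isometries between two points as rotation matrices\<close>

context
  fixes p :: 'p and p' :: 'q and \<epsilon> \<epsilon>' :: "'v \<Rightarrow> real ^ ('n + 'v)"
  assumes \<epsilon>: "orthonormal_frame (normal_space_at M \<iota> p) \<epsilon>" "pos_normal_frame M \<iota> p \<epsilon>"
    and \<epsilon>': "orthonormal_frame (normal_space_at M' \<iota>' p') \<epsilon>'" "pos_normal_frame M' \<iota>' p' \<epsilon>'"
begin

text \<open>Membership in \<open>isom_normal\<close> concerns only values on the normal space, so
  \<open>A\<close> is specified only there. Orientation is kept because a matrix of determinant 1
  leaves the determinant in \<open>pos_normal_frame_change\<close> as it is.\<close>

lemma frame_map_isom_normal:
  assumes C: "rotation_matrix C" and A: "\<And>v. v \<in> normal_space_at M \<iota> p \<Longrightarrow> A v = frame_map \<epsilon> \<epsilon>' C v"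
  shows "A \<in> isom_normal M \<iota> M' \<iota>' p p'"
proof -
  let ?N = "normal_space_at M \<iota> p"
  note N = M.subspace_normal_space[of p]
  have "pos_normal_frame M' \<iota>' p' (A \<circ> f)" if f: "pos_normal_frame M \<iota> p f" for f
  proof -
    have fN: "f l \<in> ?N" for l using f by (simp add: pos_normal_frame_def)
    have "(\<chi> k l. \<epsilon>' k \<bullet> (A \<circ> f) l) = C ** (\<chi> k l. \<epsilon> k \<bullet> f l)"
      unfolding comp_apply A[OF fN] frame_map_coord[OF \<epsilon>'(1)]
      by (simp add: vec_eq_iff matrix_matrix_mult_def matrix_vector_mult_def)
    then have "det (\<chi> k l. \<epsilon>' k \<bullet> (A \<circ> f) l) = det (\<chi> k l. \<epsilon> k \<bullet> f l)"
      using C by (simp add: det_mul rotation_matrix_def)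
    moreover have "(A \<circ> f) l \<in> normal_space_at M' \<iota>' p'" for l
      using A[OF fN] frame_map_in[OF M'.subspace_normal_space \<epsilon>'(1)] by simp
    ultimately show ?thesis
      using f M.pos_normal_frame_change[of p \<epsilon> f, OF \<epsilon> fN] M'.pos_normal_frame_change[of p' \<epsilon>' "A \<circ> f", OF \<epsilon>'] by simp
  qed
  moreover have "A u \<bullet> A v = u \<bullet> v" if "u \<in> ?N" "v \<in> ?N" for u v
    unfolding A[OF that(1)] A[OF that(2)]
    using C by (intro frame_map_inner[OF M'.subspace_normal_space \<epsilon>(1) \<epsilon>'(1) _ that(2)]) (simp add: rotation_matrix_def)
  moreover have "A (a *\<^sub>R u + b *\<^sub>R v) = a *\<^sub>R A u + b *\<^sub>R A v" if "u \<in> ?N" "v \<in> ?N" for u v a b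
  proof -
    have "a *\<^sub>R u + b *\<^sub>R v \<in> ?N" using that by (intro subspace_add subspace_scale N)
    from A[OF this] show ?thesis unfolding A[OF that(1)] A[OF that(2)] frame_map_linear .
  qed
  moreover have "A u \<in> normal_space_at M' \<iota>' p'" if "u \<in> ?N" for u
    unfolding A[OF that] by (rule frame_map_in[OF M'.subspace_normal_space \<epsilon>'(1)])
  ultimately show ?thesis unfolding isom_normal_def by blast
qed

lemma isom_normal_eq_frame_map:
  assumes A: "A \<in> isom_normal M \<iota> M' \<iota>' p p'" and v: "v \<in> normal_space_at M \<iota> p"
  shows "A v = frame_map \<epsilon> \<epsilon>' (frame_matrix \<epsilon> \<epsilon>' A) v"
proof -
  have "A (\<epsilon> l) \<in> normal_space_at M' \<iota>' p'" for l
    using A orthonormal_frameD(1)[OF \<epsilon>(1)] unfolding isom_normal_def by blast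
  note expand = orthonormal_frameD(3)[OF \<epsilon>'(1) this]
  have "A v = (\<Sum>l\<in>UNIV. (\<epsilon> l \<bullet> v) *\<^sub>R A (\<epsilon> l))"
    using A by (intro frame_expansion[OF M.subspace_normal_space _ \<epsilon>(1) v]) (simp add: isom_normal_def)
  also have "\<dots> = (\<Sum>l\<in>UNIV. (\<epsilon> l \<bullet> v) *\<^sub>R (\<Sum>k\<in>UNIV. (\<epsilon>' k \<bullet> A (\<epsilon> l)) *\<^sub>R \<epsilon>' k))"
    unfolding expand ..
  also have "\<dots> = (\<Sum>k\<in>UNIV. \<Sum>l\<in>UNIV. (frame_matrix \<epsilon> \<epsilon>' A $ k $ l * (\<epsilon> l \<bullet> v)) *\<^sub>R \<epsilon>' k)"
    unfolding scaleR_sum_right by (subst sum.swap) (simp add: frame_matrix_def mult.commute)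
  finally show ?thesis unfolding frame_map_def .
qed

text \<open>Orthogonality leaves determinant 1 or -1; the image of the positive frame \<epsilon> is
  positive, which excludes -1.\<close>

lemma isom_normal_rotation:
  assumes A: "A \<in> isom_normal M \<iota> M' \<iota>' p p'"
  shows "rotation_matrix (frame_matrix \<epsilon> \<epsilon>' A)"
proof -
  let ?C = "frame_matrix \<epsilon> \<epsilon>' A"
  have AN: "A (\<epsilon> l) \<in> normal_space_at M' \<iota>' p'" for l
    using A orthonormal_frameD(1)[OF \<epsilon>(1)] unfolding isom_normal_def by blast
  have inner: "A (\<epsilon> l) \<bullet> A (\<epsilon> m) = (if l = m then 1 else 0)" for l m
    using A orthonormal_frameD(1,2)[OF \<epsilon>(1)] unfolding isom_normal_def by auto
  have "(transpose ?C ** ?C) $ l $ m = mat 1 $ l $ m" for l m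
    using frame_inner[OF \<epsilon>'(1) AN, of "A (\<epsilon> l)" m] inner[of l m]
    by (simp add: matrix_matrix_mult_def transpose_def frame_matrix_def inner_vec_def mat_def)
  then have orth: "orthogonal_matrix ?C"
    unfolding orthogonal_matrix by (simp add: vec_eq_iff)
  have "pos_normal_frame M' \<iota>' p' (A \<circ> \<epsilon>)"
    using A \<epsilon>(2) unfolding isom_normal_def by blast
  then have "0 < det ?C"
    using M'.pos_normal_frame_change[of p' \<epsilon>' "A \<circ> \<epsilon>", OF \<epsilon>'] AN by (simp add: frame_matrix_def)
  then show ?thesis
    using orth det_orthogonal_matrix[OF orth] by (auto simp: rotation_matrix_def)
qed

end

section \<open>Covariant derivatives under an intrinsic rolling\<close>

context
  fixes \<tau> :: real and x :: "real \<Rightarrow> 'p" and x' :: "real \<Rightarrow> 'q"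
    and q :: "real \<Rightarrow> ('p, 'n) tvec \<Rightarrow> ('q, 'n) tvec"
  assumes tau: "0 \<le> \<tau>" and intrinsic: "intrinsic_rolling M \<iota> M' \<iota>' \<tau> x x' q"
begin

lemma curves: "ac_curve_Q M M' \<tau> x x' q" "ac_curve M \<tau> x" "ac_curve M' \<tau> x'"
  using intrinsic by (auto simp: intrinsic_rolling_def ac_curve_Q_def)

lemma isometry:
  assumes "t \<in> {0..\<tau>}"
  shows "q t \<in> isom_tangent M M' (x t) (x' t)"
  using curves(1) assms unfolding ac_curve_Q_def by blast

text \<open>In a parallel orthonormal tangent frame and its image under \<open>q\<close>, which is again parallel, the map
  \<open>q\<close> has the identity matrix and covariant derivatives are componentwise.\<close>

lemma intrinsic_rolling_cov_deriv:
  assumes Z: "tangent_field M \<tau> x Z"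
  shows "AE t in lebesgue_on {0..\<tau>}. q t (cov_deriv M \<iota> x Z t) = cov_deriv M' \<iota>' x' (\<lambda>s. q s (Z s)) t"
proof -
  let ?T = "\<lambda>t. tangent_image M \<iota> (x t)" and ?T' = "\<lambda>t. tangent_image M' \<iota>' (x' t)"
  obtain E :: "'n \<Rightarrow> real \<Rightarrow> real ^ ('n + 'v)" where E: "parallel_frame_along \<tau> ?T E"
    using M.parallel_tangent_frame_exists[OF tau curves(2)] by blast
  \<comment> \<open>This is \<open>q t\<close> carried over to the tangent images in the ambient
    space, where the results on frames apply.\<close>
  define A where "A t y = differential M' \<iota>' (x' t) (q t (M.lift (x t) y))" for t y
  have qT: "q t u \<in> tangent_space_at M' (x' t)" if "t \<in> {0..\<tau>}" "u \<in> tangent_space_at M (x t)" for t u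
    using isometry[OF that(1)] that(2) unfolding isom_tangent_def by blast
  have A_diff: "differential M' \<iota>' (x' t) (q t u) = A t (differential M \<iota> (x t) u)"
    if "u \<in> tangent_space_at M (x t)" for t u
    unfolding A_def M.lift_differential[OF that] ..
  have A_linear: "A t (a *\<^sub>R y + b *\<^sub>R z) = a *\<^sub>R A t y + b *\<^sub>R A t z"
    if t: "t \<in> {0..\<tau>}" and y: "y \<in> ?T t" and z: "z \<in> ?T t" for t y z a b
  proof -
    note ly = M.lift_tangent[OF y] and lz = M.lift_tangent[OF z]
    have "q t (lincomb a (M.lift (x t) y) b (M.lift (x t) z)) =
        lincomb a (q t (M.lift (x t) y)) b (q t (M.lift (x t) z))"
      using isometry[OF t] ly lz unfolding isom_tangent_def by blast
    then show ?thesis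
      unfolding A_def M.lift_lincomb[OF y z] using M'.differential_lincomb[OF qT[OF t ly] qT[OF t lz]] by simp
  qed
  have A_inner: "A t y \<bullet> A t z = y \<bullet> z" if t: "t \<in> {0..\<tau>}" and y: "y \<in> ?T t" and z: "z \<in> ?T t" for t y z
  proof -
    note ly = M.lift_tangent[OF y] and lz = M.lift_tangent[OF z]
    have "A t y \<bullet> A t z = metric M (x t) (M.lift (x t) y) (M.lift (x t) z)"
      unfolding A_def M'.differential_inner[OF qT[OF t ly] qT[OF t lz]]
      using isometry[OF t] ly lz unfolding isom_tangent_def by blast
    also have "\<dots> = y \<bullet> z"
      unfolding M.differential_inner[OF ly lz, symmetric] M.differential_lift[OF y] M.differential_lift[OF z] ..
    finally show ?thesis .
  qed
  note frame = parallel_frame_alongD(2)[OF E]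
  have ET: "E k t \<in> ?T t" if "t \<in> {0..\<tau>}" for k t by (rule orthonormal_frameD(1)[OF frame[OF that]])
  define L where "L k t = M.lift (x t) (E k t)" for k t
  have LT: "L k t \<in> tangent_space_at M (x t)" if "t \<in> {0..\<tau>}" for k t
    unfolding L_def by (rule M.lift_tangent[OF ET[OF that]])
  have LE: "differential M \<iota> (x t) (L k t) = E k t" if "t \<in> {0..\<tau>}" for k t
    unfolding L_def by (rule M.differential_lift[OF ET[OF that]])
  \<comment> \<open>The lifted frame reproduces \<open>E\<close> only for times in
    \<open>{0..\<tau>}\<close>, so parallelism has to depend on the values there alone.\<close>
  have cong: "parallel_along \<tau> T W'" if W: "parallel_along \<tau> T W" "\<And>t. t \<in> {0..\<tau>} \<Longrightarrow> W t = W' t"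
    for T :: "real \<Rightarrow> (real ^ ('n + 'v)) set" and W W'
  proof -
    have AC: "abs_cont_on 0 \<tau> W" and WT: "\<And>t. t \<in> {0..\<tau>} \<Longrightarrow> W t \<in> T t"
      and AE: "AE t in lebesgue_on {0..\<tau>}. orth_proj (T t) (vector_derivative W (at t)) = 0"
      using W(1) unfolding parallel_along_def section_along_def by blast+
    have "AE t in lebesgue_on {0..\<tau>}. orth_proj (T t) (vector_derivative W' (at t)) = 0"
      using AE_lebesgue_on_interior AE
    proof eventually_elim
      case (elim t)
      have "vector_derivative W (at t) = vector_derivative W' (at t)"
        by (rule vector_derivative_cong_interval[OF elim(1)]) (rule W(2))
      then show ?case using elim(2) by simp
    qed
    moreover have "abs_cont_on 0 \<tau> W'"
      by (rule abs_cont_on_cong[OF AC]) (simp add: W(2))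
    moreover have "W' t \<in> T t" if "t \<in> {0..\<tau>}" for t using WT[OF that] W(2)[OF that] by simp
    ultimately show ?thesis unfolding parallel_along_def section_along_def by blast
  qed
  define E' where "E' k t = A t (E k t)" for k t
  have "parallel_along \<tau> ?T' (E' k)" for k
  proof -
    have "parallel_along \<tau> ?T (E k)" using E by (simp add: parallel_frame_along_def)
    then have "parallel_along \<tau> ?T (\<lambda>t. differential M \<iota> (x t) (L k t))"
      by (rule cong) (simp add: LE)
    then have par: "parallel M \<iota> \<tau> x (L k)"
      unfolding M.parallel_iff[OF tau curves(2)] using LT by blast
    then have "tangent_field M \<tau> x (L k)" by (simp add: parallel_def)
    \<comment> \<open>Condition (II') enters here, applied to each vector of the frame.\<close>
    then have "parallel M' \<iota>' \<tau> x' (\<lambda>t. q t (L k t))"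
      using par intrinsic unfolding intrinsic_rolling_def by blast
    then have "parallel_along \<tau> ?T' (\<lambda>t. differential M' \<iota>' (x' t) (q t (L k t)))"
      unfolding M'.parallel_iff[OF tau curves(3)] by blast
    then show ?thesis
      by (rule cong) (simp add: E'_def A_def L_def)
  qed
  moreover have "orthonormal_frame (?T' t) (\<lambda>k. E' k t)" if t: "t \<in> {0..\<tau>}" for t
  proof (rule orthonormal_frameI[OF M'.subspace_tangent_image M'.dim_tangent_image])
    show "E' k t \<in> ?T' t" for k
      unfolding E'_def A_def tangent_image_def using qT[OF t M.lift_tangent[OF ET[OF t]]] by blast
    show "E' k t \<bullet> E' l t = (if k = l then 1 else 0)" for k l
      unfolding E'_def A_inner[OF t ET[OF t] ET[OF t]] by (rule orthonormal_frameD(2)[OF frame[OF t]])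
  qed
  ultimately have E': "parallel_frame_along \<tau> ?T' E'" unfolding parallel_frame_along_def by blast
  have A_frame: "A t y = frame_map (\<lambda>l. E l t) (\<lambda>k. E' k t) (mat 1) y"
    if t: "t \<in> {0..\<tau>}" and y: "y \<in> ?T t" for t y
    using frame_expansion[OF M.subspace_tangent_image A_linear[OF t] frame[OF t] y]
    by (simp add: frame_map_eq E'_def)
  let ?W = "\<lambda>s. differential M \<iota> (x s) (Z s)"
  have ZT: "Z t \<in> tangent_space_at M (x t)" if "t \<in> {0..\<tau>}" for t
    using Z that by (simp add: tangent_field_def)
  have W: "section_along \<tau> ?T ?W" using Z unfolding M.tangent_field_iff[OF tau curves(2)] by blast
  have qZ: "differential M' \<iota>' (x' s) (q s (Z s)) = frame_map (\<lambda>l. E l s) (\<lambda>k. E' k s) (mat 1) (?W s)"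
    if s: "s \<in> {0..\<tau>}" for s
    unfolding A_diff[OF ZT[OF s]]
    by (rule A_frame[OF s]) (use ZT[OF s] in \<open>auto simp: tangent_image_def\<close>)
  show ?thesis
    using AE_lebesgue_on_interior
      orth_proj_frame_map_derivative[OF tau M.subspace_tangent_image M'.subspace_tangent_image E E' W, of "mat 1"]
  proof eventually_elim
    case (elim t)
    have t: "t \<in> {0..\<tau>}" using elim(1) by simp
    note cd = M.cov_deriv_tangent[of x Z t]
    have "differential M \<iota> (x t) (cov_deriv M \<iota> x Z t) \<in> ?T t" using cd by (auto simp: tangent_image_def)
    from A_frame[OF t this] have "differential M' \<iota>' (x' t) (q t (cov_deriv M \<iota> x Z t)) =
        frame_map (\<lambda>l. E l t) (\<lambda>k. E' k t) (mat 1) (orth_proj (?T t) (vector_derivative ?W (at t)))"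
      unfolding A_diff[OF cd] unfolding M.differential_cov_deriv .
    also have "\<dots> = orth_proj (?T' t) (vector_derivative (\<lambda>s. frame_map (\<lambda>l. E l s) (\<lambda>k. E' k s) (mat 1) (?W s)) (at t))"
      using elim(2) by (rule sym)
    also have "vector_derivative (\<lambda>s. frame_map (\<lambda>l. E l s) (\<lambda>k. E' k s) (mat 1) (?W s)) (at t) =
        vector_derivative (\<lambda>s. differential M' \<iota>' (x' s) (q s (Z s))) (at t)"
      by (rule vector_derivative_cong_interval[OF elim(1)]) (rule qZ[symmetric])
    also have "orth_proj (?T' t) \<dots> = differential M' \<iota>' (x' t) (cov_deriv M' \<iota>' x' (\<lambda>s. q s (Z s)) t)"
      by (rule M'.differential_cov_deriv[symmetric])
    finally show ?case
      by (rule M'.differential_inject[OF qT[OF t cd] M'.cov_deriv_tangent[of x' _ t]])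
  qed
qed

section \<open>Rollings and constant rotation matrices\<close>

context
  fixes \<epsilon> \<epsilon>' :: "'v \<Rightarrow> real \<Rightarrow> real ^ ('n + 'v)"
  assumes \<epsilon>: "parallel_normal_frame M \<iota> \<tau> x \<epsilon>" and \<epsilon>': "parallel_normal_frame M' \<iota>' \<tau> x' \<epsilon>'"
begin

lemma normal_frames:
  shows "parallel_frame_along \<tau> (\<lambda>t. normal_space_at M \<iota> (x t)) \<epsilon>"
    and "parallel_frame_along \<tau> (\<lambda>t. normal_space_at M' \<iota>' (x' t)) \<epsilon>'"
    and "t \<in> {0..\<tau>} \<Longrightarrow> pos_normal_frame M \<iota> (x t) (\<lambda>l. \<epsilon> l t)"
    and "t \<in> {0..\<tau>} \<Longrightarrow> pos_normal_frame M' \<iota>' (x' t) (\<lambda>l. \<epsilon>' l t)"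
  using \<epsilon> \<epsilon>' unfolding M.parallel_normal_frame_iff[OF tau curves(2)] M'.parallel_normal_frame_iff[OF tau curves(3)]
  by blast+

lemmas frames_at = parallel_frame_alongD(2)[OF normal_frames(1)] normal_frames(3)
  parallel_frame_alongD(2)[OF normal_frames(2)] normal_frames(4)

text \<open>A constant matrix in parallel frames commutes with the normal derivative by
  \<open>orth_proj_frame_map_derivative\<close>, which is (III). Conditions (I) and (II) concern
  \<open>q\<close> alone: the first is inherited from the intrinsic rolling, the second is
  \<open>intrinsic_rolling_cov_deriv\<close>.\<close>

lemma rolling_of_frame_map:
  assumes C: "rotation_matrix C" and p: "\<And>t v. t \<in> {0..\<tau>} \<Longrightarrow> v \<in> normal_space_at M \<iota> (x t) \<Longrightarrow>
    p t v = frame_map (\<lambda>l. \<epsilon> l t) (\<lambda>k. \<epsilon>' k t) C v"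
  shows "rolling M \<iota> M' \<iota>' \<tau> x x' q p"
proof -
  let ?N = "\<lambda>t. normal_space_at M \<iota> (x t)" and ?N' = "\<lambda>t. normal_space_at M' \<iota>' (x' t)"
  let ?F = "\<lambda>t. frame_map (\<lambda>l. \<epsilon> l t) (\<lambda>k. \<epsilon>' k t) C"
  have "abs_cont_on 0 \<tau> (\<lambda>t. p t (orth_proj (?N t) w))" for w
  proof (rule abs_cont_on_cong)
    show "abs_cont_on 0 \<tau> (\<lambda>t. ?F t w)"
      by (rule abs_cont_on_frame_map[OF normal_frames(1,2) abs_cont_on_const])
    fix t assume "0 \<le> t" "t \<le> \<tau>"
    then have t: "t \<in> {0..\<tau>}" by simp
    show "?F t w = p t (orth_proj (?N t) w)"
      unfolding p[OF t orth_proj_in[OF M.subspace_normal_space]]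
        frame_map_proj[OF M.subspace_normal_space frames_at(1)[OF t]] ..
  qed
  moreover have "p t \<in> isom_normal M \<iota> M' \<iota>' (x t) (x' t)" if t: "t \<in> {0..\<tau>}" for t
    by (rule frame_map_isom_normal[OF frames_at[OF t] C p[OF t]])
  ultimately have "ac_curve_P M \<iota> M' \<iota>' \<tau> x x' p"
    unfolding ac_curve_P_def using curves(2,3) by blast
  moreover have "AE t in lebesgue_on {0..\<tau>}.
      p t (normal_deriv M \<iota> x \<Psi> t) = normal_deriv M' \<iota>' x' (\<lambda>s. p s (\<Psi> s)) t"
    if \<Psi>: "normal_field M \<iota> \<tau> x \<Psi>" for \<Psi>
  proof -
    have sec: "section_along \<tau> ?N \<Psi>" using \<Psi> by (simp add: normal_field_def section_along_def)
    have p\<Psi>: "p s (\<Psi> s) = ?F s (\<Psi> s)" if "s \<in> {0..\<tau>}" for s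
      using p[OF that] sec that by (simp add: section_along_def)
    show ?thesis
      using AE_lebesgue_on_interior
        orth_proj_frame_map_derivative[OF tau M.subspace_normal_space M'.subspace_normal_space normal_frames(1,2) sec, of C]
    proof eventually_elim
      case (elim t)
      have t: "t \<in> {0..\<tau>}" using elim(1) by simp
      have cong: "vector_derivative (\<lambda>s. p s (\<Psi> s)) (at t) = vector_derivative (\<lambda>s. ?F s (\<Psi> s)) (at t)"
        by (rule vector_derivative_cong_interval[OF elim(1)]) (rule p\<Psi>)
      show ?case
        unfolding normal_deriv_def p[OF t orth_proj_in[OF M.subspace_normal_space]] cong
        using elim(2) by (rule sym)
    qed
  qed
  ultimately show ?thesis
    unfolding rolling_def
    using curves(1) intrinsic_rolling_cov_deriv intrinsic by (simp add: intrinsic_rolling_def)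
qed

text \<open>Applied to the parallel field \<open>\<epsilon> l\<close>, condition (III) makes its
  image under \<open>p\<close> normal parallel. The inner products of that image with the fields
  \<open>\<epsilon>' k\<close> are therefore constant, and they are the matrix entries.\<close>

lemma rolling_imp_frame_map:
  assumes p: "rolling M \<iota> M' \<iota>' \<tau> x x' q p"
  shows "\<exists>C. rotation_matrix C \<and> (\<forall>t\<in>{0..\<tau>}. frame_matrix (\<lambda>l. \<epsilon> l t) (\<lambda>k. \<epsilon>' k t) (p t) = C \<and>
    (\<forall>v\<in>normal_space_at M \<iota> (x t). p t v = frame_map (\<lambda>l. \<epsilon> l t) (\<lambda>k. \<epsilon>' k t) C v))"
proof -
  let ?N = "\<lambda>t. normal_space_at M \<iota> (x t)" and ?N' = "\<lambda>t. normal_space_at M' \<iota>' (x' t)"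
  let ?C = "\<lambda>t. frame_matrix (\<lambda>l. \<epsilon> l t) (\<lambda>k. \<epsilon>' k t) (p t)"
  have iso: "p t \<in> isom_normal M \<iota> M' \<iota>' (x t) (x' t)" if "t \<in> {0..\<tau>}" for t
    using p that unfolding rolling_def ac_curve_P_def by blast
  have projAC: "abs_cont_on 0 \<tau> (\<lambda>t. p t (orth_proj (?N t) w))" for w
    using p unfolding rolling_def ac_curve_P_def by blast
  have \<epsilon>N: "\<epsilon> l t \<in> ?N t" if "t \<in> {0..\<tau>}" for l t by (rule orthonormal_frameD(1)[OF frames_at(1)[OF that]])
  \<comment> \<open>Absolute continuity of \<open>p\<close> is given on projections of fixed
    vectors, while \<open>\<epsilon> l\<close> moves; expanding it in the standard basis bridges the
    two.\<close>
  have p\<epsilon>AC: "abs_cont_on 0 \<tau> (\<lambda>t. p t (\<epsilon> l t))" for l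
  proof (rule abs_cont_on_cong)
    show "abs_cont_on 0 \<tau> (\<lambda>t. \<Sum>i\<in>UNIV. (\<epsilon> l t \<bullet> axis i 1) *\<^sub>R p t (orth_proj (?N t) (axis i 1)))"
      by (intro abs_cont_on_sum abs_cont_on_scaleR abs_cont_on_inner abs_cont_on_const projAC
          parallel_frame_alongD(1)[OF normal_frames(1)])
    fix t assume "0 \<le> t" "t \<le> \<tau>"
    then have t: "t \<in> {0..\<tau>}" by simp
    let ?A = "\<lambda>w. p t (orth_proj (?N t) w)" and ?F = "frame_map (\<lambda>l. \<epsilon> l t) (\<lambda>k. \<epsilon>' k t) (?C t)"
    have A: "?A w = ?F w" for w
      unfolding isom_normal_eq_frame_map[OF frames_at[OF t] iso[OF t] orth_proj_in[OF M.subspace_normal_space]]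
      by (rule frame_map_proj[OF M.subspace_normal_space frames_at(1)[OF t]])
    have "\<epsilon> l t = (\<Sum>i\<in>UNIV. \<epsilon> l t $ i *\<^sub>R axis i 1)"
      by (rule basis_expansion[of "\<epsilon> l t", unfolded scalar_mult_eq_scaleR, symmetric])
    from arg_cong[OF this, of ?F]
    have "?F (\<epsilon> l t) = (\<Sum>i\<in>UNIV. \<epsilon> l t $ i *\<^sub>R ?F (axis i 1))"
      unfolding linear_sum[OF linear_frame_map] linear_scale[OF linear_frame_map] .
    then show "(\<Sum>i\<in>UNIV. (\<epsilon> l t \<bullet> axis i 1) *\<^sub>R p t (orth_proj (?N t) (axis i 1))) = p t (\<epsilon> l t)"
      unfolding A isom_normal_eq_frame_map[OF frames_at[OF t] iso[OF t] \<epsilon>N[OF t]]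
      by (simp add: inner_axis)
  qed
  have const: "\<epsilon>' k t \<bullet> p t (\<epsilon> l t) = \<epsilon>' k 0 \<bullet> p 0 (\<epsilon> l 0)" if t: "t \<in> {0..\<tau>}" for k l t
  proof (rule parallel_along_inner_const[OF M'.subspace_normal_space _ _ t])
    show "parallel_along \<tau> ?N' (\<epsilon>' k)" using normal_frames(2) by (simp add: parallel_frame_along_def)
    have "normal_field M \<iota> \<tau> x (\<epsilon> l)"
      unfolding normal_field_def using \<epsilon>N parallel_frame_alongD(1)[OF normal_frames(1)] by blast
    then have III: "AE t in lebesgue_on {0..\<tau>}.
        p t (normal_deriv M \<iota> x (\<epsilon> l) t) = normal_deriv M' \<iota>' x' (\<lambda>s. p s (\<epsilon> l s)) t"
      using p unfolding rolling_def by blast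
    have "AE t in lebesgue_on {0..\<tau>}. orth_proj (?N' t) (vector_derivative (\<lambda>s. p s (\<epsilon> l s)) (at t)) = 0"
      using AE_lebesgue_on_interior III parallel_frame_alongD(3)[OF normal_frames(1), of l]
    proof eventually_elim
      case (elim s)
      have s: "s \<in> {0..\<tau>}" using elim(1) by simp
      \<comment> \<open>Linearity of \<open>p s\<close> is known on the normal space; its matrix
        form there gives the value at 0.\<close>
      have "p s 0 = 0"
        using isom_normal_eq_frame_map[OF frames_at[OF s] iso[OF s] subspace_0[OF M.subspace_normal_space]]
        by (simp add: frame_map_def)
      then show ?case using elim(2,3) unfolding normal_deriv_def by simp
    qed
    moreover have "p s (\<epsilon> l s) \<in> ?N' s" if "s \<in> {0..\<tau>}" for s
      using iso[OF that] \<epsilon>N[OF that] unfolding isom_normal_def by blast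
    ultimately show "parallel_along \<tau> ?N' (\<lambda>t. p t (\<epsilon> l t))"
      unfolding parallel_along_def section_along_def using p\<epsilon>AC by blast
  qed
  have C: "?C t = ?C 0" if "t \<in> {0..\<tau>}" for t
    unfolding frame_matrix_def const[OF that] ..
  have 0: "0 \<in> {0..\<tau>}" using tau by simp
  have "rotation_matrix (?C 0)" by (rule isom_normal_rotation[OF frames_at[OF 0] iso[OF 0]])
  moreover have "p t v = frame_map (\<lambda>l. \<epsilon> l t) (\<lambda>k. \<epsilon>' k t) (?C 0) v" if t: "t \<in> {0..\<tau>}" and "v \<in> ?N t" for t v
    using isom_normal_eq_frame_map[OF frames_at[OF t] iso[OF t] that(2)] unfolding C[OF t] .
  ultimately show ?thesis using C by (intro exI[of _ "?C 0"]) blast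
qed

text \<open>Under the action the constant matrix \<open>C0\<close> of \<open>p0\<close> becomes
  \<open>C0 ** B0\<close>. As \<open>C0\<close> is orthogonal, every rotation matrix
  \<open>C\<close> is reached, with \<open>B0 = transpose C0 ** C\<close>.\<close>

lemma rolling_iff_right_action:
  assumes p0: "rolling M \<iota> M' \<iota>' \<tau> x x' q p0"
  shows "rolling M \<iota> M' \<iota>' \<tau> x x' q p \<longleftrightarrow>
    (\<exists>B0. rotation_matrix B0 \<and> (\<forall>t\<in>{0..\<tau>}. \<forall>v\<in>normal_space_at M \<iota> (x t).
       p t v = right_action (\<lambda>l. \<epsilon> l t) (\<lambda>k. \<epsilon>' k t) (p0 t) B0 v))"
proof -
  obtain C0 where C0: "rotation_matrix C0"
    "\<And>t. t \<in> {0..\<tau>} \<Longrightarrow> frame_matrix (\<lambda>l. \<epsilon> l t) (\<lambda>k. \<epsilon>' k t) (p0 t) = C0"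
    using rolling_imp_frame_map[OF p0] by blast
  have act: "right_action (\<lambda>l. \<epsilon> l t) (\<lambda>k. \<epsilon>' k t) (p0 t) B v = frame_map (\<lambda>l. \<epsilon> l t) (\<lambda>k. \<epsilon>' k t) (C0 ** B) v"
    if "t \<in> {0..\<tau>}" for t B v
    unfolding right_action_eq C0(2)[OF that] ..
  have mult: "rotation_matrix (A ** B)" if "rotation_matrix A" "rotation_matrix B" for A B :: "real ^ 'v ^ 'v"
    using that by (simp add: rotation_matrix_def orthogonal_matrix_mul det_mul)
  have inv: "rotation_matrix (transpose C0)" "C0 ** transpose C0 = mat 1"
    using C0(1) by (simp_all add: rotation_matrix_def orthogonal_matrix_transpose det_transpose orthogonal_matrix_def)
  show ?thesis
  proof
    assume "rolling M \<iota> M' \<iota>' \<tau> x x' q p"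
    from rolling_imp_frame_map[OF this] obtain C where C: "rotation_matrix C"
      "\<And>t v. t \<in> {0..\<tau>} \<Longrightarrow> v \<in> normal_space_at M \<iota> (x t) \<Longrightarrow> p t v = frame_map (\<lambda>l. \<epsilon> l t) (\<lambda>k. \<epsilon>' k t) C v"
      by blast
    have "C0 ** (transpose C0 ** C) = C" by (simp add: matrix_mul_assoc inv)
    then show "\<exists>B0. rotation_matrix B0 \<and> (\<forall>t\<in>{0..\<tau>}. \<forall>v\<in>normal_space_at M \<iota> (x t).
       p t v = right_action (\<lambda>l. \<epsilon> l t) (\<lambda>k. \<epsilon>' k t) (p0 t) B0 v)"
      using C act mult[OF inv(1) C(1)] by (intro exI[of _ "transpose C0 ** C"]) simp
  next
    assume "\<exists>B0. rotation_matrix B0 \<and> (\<forall>t\<in>{0..\<tau>}. \<forall>v\<in>normal_space_at M \<iota> (x t).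
       p t v = right_action (\<lambda>l. \<epsilon> l t) (\<lambda>k. \<epsilon>' k t) (p0 t) B0 v)"
    then obtain B0 where B0: "rotation_matrix B0" "\<And>t v. t \<in> {0..\<tau>} \<Longrightarrow> v \<in> normal_space_at M \<iota> (x t) \<Longrightarrow>
       p t v = right_action (\<lambda>l. \<epsilon> l t) (\<lambda>k. \<epsilon>' k t) (p0 t) B0 v"
      by blast
    show "rolling M \<iota> M' \<iota>' \<tau> x x' q p"
    proof (rule rolling_of_frame_map[OF mult[OF C0(1) B0(1)]])
      show "p t v = frame_map (\<lambda>l. \<epsilon> l t) (\<lambda>k. \<epsilon>' k t) (C0 ** B0) v"
        if "t \<in> {0..\<tau>}" "v \<in> normal_space_at M \<iota> (x t)" for t v
        unfolding B0(2)[OF that] by (rule act[OF that(1)])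
    qed
  qed
qed

end

end

end

theorem theorem3:
  fixes M :: "('p::{t2_space, second_countable_topology}, 'n::finite) riemannian"
    and M' :: "('q::{t2_space, second_countable_topology}, 'n) riemannian"
    and \<iota> :: "'p \<Rightarrow> real ^ ('n + 'v::finite)"
    and \<iota>' :: "'q \<Rightarrow> real ^ ('n + 'v)"
    and \<tau> :: real
    and x :: "real \<Rightarrow> 'p" and x' :: "real \<Rightarrow> 'q"
    and q0 :: "real \<Rightarrow> ('p, 'n) tvec \<Rightarrow> ('q, 'n) tvec"
  assumes "oriented_riemannian_manifold M" and "connected (UNIV :: 'p set)"
    and "oriented_riemannian_manifold M'" and "connected (UNIV :: 'q set)"
    and "isometric_imbedding M \<iota>" and "isometric_imbedding M' \<iota>'"
    and "0 \<le> \<tau>"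
    and "intrinsic_rolling M \<iota> M' \<iota>' \<tau> x x' q0"
  shows "(\<exists>p. rolling M \<iota> M' \<iota>' \<tau> x x' q0 p) \<and>
    (\<exists>\<epsilon>. parallel_normal_frame M \<iota> \<tau> x \<epsilon>) \<and>
    (\<exists>\<epsilon>'. parallel_normal_frame M' \<iota>' \<tau> x' \<epsilon>') \<and>
    (\<forall>\<epsilon> \<epsilon>' p0. parallel_normal_frame M \<iota> \<tau> x \<epsilon> \<longrightarrow> parallel_normal_frame M' \<iota>' \<tau> x' \<epsilon>' \<longrightarrow>
       rolling M \<iota> M' \<iota>' \<tau> x x' q0 p0 \<longrightarrow>
       (\<forall>p. rolling M \<iota> M' \<iota>' \<tau> x x' q0 p \<longleftrightarrow>
          (\<exists>B0. rotation_matrix B0 \<and>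
             (\<forall>t\<in>{0..\<tau>}. \<forall>v\<in>normal_space_at M \<iota> (x t).
                p t v = right_action (\<lambda>l. \<epsilon> l t) (\<lambda>k. \<epsilon>' k t) (p0 t) B0 v))))"
proof -
  interpret imbedded_pair M \<iota> M' \<iota>'
    by unfold_locales (use assms in auto)
  note AC = curves(2,3)[OF assms(7,8)]
  have frames: "\<exists>\<epsilon>. parallel_normal_frame M \<iota> \<tau> x \<epsilon>" "\<exists>\<epsilon>'. parallel_normal_frame M' \<iota>' \<tau> x' \<epsilon>'"
    by (rule M.parallel_normal_frame_exists[OF assms(7) AC(1)], rule M'.parallel_normal_frame_exists[OF assms(7) AC(2)])
  then obtain \<epsilon> \<epsilon>' where \<epsilon>: "parallel_normal_frame M \<iota> \<tau> x \<epsilon>" "parallel_normal_frame M' \<iota>' \<tau> x' \<epsilon>'"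
    by blast
  \<comment> \<open>Any rotation matrix gives a rolling; the identity gives the one that sends each
    \<open>\<epsilon> l\<close> to \<open>\<epsilon>' l\<close>.\<close>
  have "rolling M \<iota> M' \<iota>' \<tau> x x' q0 (\<lambda>t. frame_map (\<lambda>l. \<epsilon> l t) (\<lambda>k. \<epsilon>' k t) (mat 1))"
    by (rule rolling_of_frame_map[OF assms(7,8) \<epsilon>, of "mat 1"])
      (simp_all add: rotation_matrix_def orthogonal_matrix_id)
  then show ?thesis
    using frames rolling_iff_right_action[OF assms(7,8)] by blast
qed

end
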